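(* Let $d$ be a positive integer, $m>0$, and let $A_k$ ($k\in\mathbb{N}$) be a fixed sequence of isometry invariant mollifiers on $\mathbb{S}^d$ (properties (1)--(5) in the context), with associated smoothing covariances $\widetilde{C}_{S,k}=A_k^*C_{S,k}A_k$ and Gaussian measures $\mu_{\widetilde{C}_{S,k}}$ on $\mathcal{D}(\mathbb{S}^d)$. Let $\rho^S_k$ be a sequence of densities on $\mathcal{D}(\mathbb{S}^d)$ such that $$\inf_{k}\|\rho^{S}_{k}\|_{L^{1}(\mu_{\widetilde{C}_{S,k}})} >0, \qquad \sup_{k}\|\rho^{S}_{k}\|_{L^{2}(\mu_{\widetilde{C}_{S,k}})} < \infty,$$ and let $\mu^{S,\rho}_k=\|\rho^S_k\|^{-1}_{L^1(\mu_{\widetilde{C}_{S,k}})}\,\rho^S_k\,\mu_{\widetilde{C}_{S,k}}$ be the corresponding probability measures on $\mathcal{D}(\mathbb{S}^d)$. Then: (a) The sequence of functionals $S_{\mu^{S,\rho}_k}\circ U_\alpha U_{\beta_k}$ on $\mathcal{D}(\mathbb{R}^d)$ is equicontinuous. (b) There exists a subsequence of $S_{\mu^{S,\rho}_k}\circ U_\alpha U_{\beta_k}$ converging pointwise on $\mathcal{D}(\mathbb{R}^d)$ to the characteristic functional $S_{\mu^{E,\rho}}$ of a probability measure $\mu^{E,\rho}$ on $\mathcal{D}'(\mathbb{R}^d)$.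
   Context: For a Riemannian manifold $X$, $\mathcal{D}(X)$ is the space of real-valued smooth compactly supported functions with its standard topology, $\mathcal{D}'(X)$ its topological dual with the weak* topology, and $L^2(X)$ is the real $L^2$ space of the Riemannian measure. All measures are Radon. The characteristic functional of a measure $\mu$ on $\mathcal{D}'(X)$ is $S_\mu(f)=\int e^{i\phi(f)}d\mu(\phi)$, $f\in\mathcal{D}(X)$. A measure on $\mathcal{D}(X)$ is also regarded as a measure on $\mathcal{D}'(X)$ by push-forward under the inclusion $\mathcal{D}(X)\hookrightarrow\mathcal{D}'(X)$, $g\mapsto\langle g,\cdot\rangle_{L^2}$; so then $S_\mu(f)=\int_{\mathcal{D}(X)}e^{i\langle g,f\rangle}d\mu(g)$. $\mathbb{S}^d\subset\mathbb{R}^{d+1}$ is the unit sphere with the round metric and coordinates $(x_0,\dots,x_d)$; $\mathbb{S}^d_p=\mathbb{S}^d\setminus\{(0,\dots,0,1)\}$. The stereographic projection $\alpha:\mathbb{S}^d_p\to\mathbb{R}^d$ is $\alpha_i(x)=x_i/(1-x_d)$, $i=0,\dots,d-1$. For a conformal diffeomorphism $\eta:X\to Y$ of $d$-dimensional Riemannian manifolds with $\eta^*g_Y=\Lambda_\eta^2g_X$, put $U_\eta f=\Lambda_\eta^{d/2}\,(f\circ\eta)$; it extends to a unitary operator $L^2(Y)\to L^2(X)$. Here $\Lambda_\alpha=(1-x_d)^{-1}$, and for $\beta_k(y)=ky$ on $\mathbb{R}^d$, $\Lambda_{\beta_k}=k$. We identify $L^2(\mathbb{S}^d_p)=L^2(\mathbb{S}^d)$,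 and $U_\alpha U_{\beta_k}$ maps $\mathcal{D}(\mathbb{R}^d)$ into $\mathcal{D}(\mathbb{S}^d_p)\subset\mathcal{D}(\mathbb{S}^d)$ (extension by $0$). $\triangle_E$ is the (nonnegative) Laplacian on $\mathbb{R}^d$ and $C_{S,k}=U_\alpha U_{\beta_k}(\triangle_E+m^2)^{-1}U_{\beta_k}^{-1}U_\alpha^{-1}$ on $L^2(\mathbb{S}^d)$. Mollifiers: $A_k:\mathcal{D}'(\mathbb{S}^d)\to\mathcal{D}(\mathbb{S}^d)$ are continuous smoothing operators with smooth kernels $A_k(x,y)$ such that (1) $A_k$ restricted to $L^2(\mathbb{S}^d)$ is trace class with $\mathrm{Tr}A_k=\int A_k(x,x)dx$; (2) $A_k$ are uniformly bounded on $L^2(\mathbb{S}^d)$; (3) $A_k\to1$ strongly on $L^2(\mathbb{S}^d)$; (4) $d(\mathrm{supp}\,A_k(x,y))$ decreases to $0$, where $d(U)$ is the largest distance between a point of $U\subset \mathbb{S}^d\times\mathbb{S}^d$ and the diagonal; (5) $A_k$ commutes with the action of the isometry group $O(d+1)$ on $L^2(\mathbb{S}^d)$. $\widetilde{C}_{S,k}=A_k^*C_{S,k}A_k$ is smoothing (maps $\mathcal{D}'(\mathbb{S}^d)$ to $\mathcal{D}(\mathbb{S}^d)$), and $\mu_{\widetilde{C}_{S,k}}$ is the unique centered Gaussian probability measure on $\mathcal{D}(\mathbb{S}^d)$ with characteristic functional $e^{-\frac12\langle\widetilde{C}_{S,k}f,f\rangle}$, $f\in\mathcal{D}'(\mathbb{S}^d)$.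 A density $\rho^S_k$ is a nonnegative element of $L^1(\mu_{\widetilde{C}_{S,k}})$. *)

theory Defs
  imports "HOL-Probability.Probability"
begin

section \<open>Smooth functions\<close>

primrec iter_deriv :: "'a::real_normed_vector list \<Rightarrow> ('a \<Rightarrow> real) \<Rightarrow> 'a \<Rightarrow> real" where
  "iter_deriv [] f = f"
| "iter_deriv (v # L) f = (\<lambda>x. frechet_derivative (iter_deriv L f) (at x) v)"

text \<open>Meant for open \<open>S\<close>.\<close>

definition smooth_on :: "'a::euclidean_space set \<Rightarrow> ('a \<Rightarrow> real) \<Rightarrow> bool" where
  "smooth_on S f \<longleftrightarrow> (\<forall>L x. set L \<subseteq> Basis \<and> x \<in> S \<longrightarrow> iter_deriv L f differentiable (at x))"

definition supp :: "('a::topological_space \<Rightarrow> real) \<Rightarrow> 'a set" where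
  "supp f = closure {x. f x \<noteq> 0}"

section \<open>Radon measures and equicontinuity\<close>

definition radon_prob :: "'a topology \<Rightarrow> 'a measure \<Rightarrow> bool" where
  "radon_prob T M \<longleftrightarrow> prob_space M \<and> space M = topspace T \<and>
     sets M = sigma_sets (topspace T) {U. openin T U} \<and>
     (\<forall>A\<in>sets M. emeasure M A =
        (SUP K\<in>{K. compactin T K \<and> K \<in> sets M \<and> K \<subseteq> A}. emeasure M K))"

definition equicontinuous_on :: "'a topology \<Rightarrow> 'i set \<Rightarrow> ('i \<Rightarrow> 'a \<Rightarrow> 'b::metric_space) \<Rightarrow> bool" where
  "equicontinuous_on T I F \<longleftrightarrow>
     (\<forall>f\<in>topspace T. \<forall>e>0. \<exists>U. openin T U \<and> f \<in> U \<and> (\<forall>k\<in>I. \<forall>g\<in>U. dist (F k g) (F k f) < e))"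

section \<open>Test functions and distributions on Euclidean space\<close>

definition test_R :: "(real^'n \<Rightarrow> real) set" where
  "test_R = {f. smooth_on UNIV f \<and> compact (supp f)}"

text \<open>The LF topology: a base of neighbourhoods of 0 is formed by the absolutely convex sets
  which meet, for each compact \<open>K\<close>, the Frechet space of test functions supported in \<open>K\<close>
  in a neighbourhood of 0.\<close>

definition nbhd0_R :: "(real^'n \<Rightarrow> real) set \<Rightarrow> bool" where
  "nbhd0_R V \<longleftrightarrow>
     (\<forall>u\<in>V. \<forall>v\<in>V. \<forall>s t. \<bar>s\<bar> + \<bar>t\<bar> \<le> 1 \<longrightarrow> (\<lambda>x. s * u x + t * v x) \<in> V) \<and>
     (\<forall>K. compact K \<longrightarrow> (\<exists>N::nat. \<exists>e>0. {f \<in> test_R. supp f \<subseteq> K \<and>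
        (\<forall>L x. set L \<subseteq> Basis \<and> length L \<le> N \<longrightarrow> \<bar>iter_deriv L f x\<bar> < e)} \<subseteq> V))"

definition test_R_topology :: "(real^'n \<Rightarrow> real) topology" where
  "test_R_topology = topology (\<lambda>U. U \<subseteq> test_R \<and>
     (\<forall>f\<in>U. \<exists>V. V \<subseteq> test_R \<and> nbhd0_R V \<and> (\<forall>v\<in>V. (\<lambda>x. f x + v x) \<in> U)))"

definition linear_functional_on :: "('a \<Rightarrow> real) set \<Rightarrow> (('a \<Rightarrow> real) \<Rightarrow> real) \<Rightarrow> bool" where
  "linear_functional_on D \<phi> \<longleftrightarrow>
     (\<forall>f\<in>D. \<forall>g\<in>D. \<forall>s t. \<phi> (\<lambda>x. s * f x + t * g x) = s * \<phi> f + t * \<phi> g)"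

definition distrib_R :: "((real^'n \<Rightarrow> real) \<Rightarrow> real) set" where
  "distrib_R = {\<phi> \<in> extensional test_R.
     linear_functional_on test_R \<phi> \<and> continuous_map test_R_topology euclideanreal \<phi>}"

text \<open>The weak* topology.\<close>

definition distrib_R_topology :: "((real^'n \<Rightarrow> real) \<Rightarrow> real) topology" where
  "distrib_R_topology = subtopology (product_topology (\<lambda>_. euclideanreal) test_R) distrib_R"

definition charfun_R :: "((real^'n \<Rightarrow> real) \<Rightarrow> real) measure \<Rightarrow> (real^'n \<Rightarrow> real) \<Rightarrow> complex" where
  "charfun_R \<mu> f = (\<integral>\<phi>. exp (\<i> * complex_of_real (\<phi> f)) \<partial>\<mu>)"

section \<open>The round sphere\<close>

text \<open>The ambient space of the \<open>CARD('n)\<close>-dimensional sphere; the second component is the last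
  coordinate. The norm is Euclidean.\<close>

type_synonym 'n amb = "(real^'n) \<times> real"

definition Sph :: "'n::finite amb set" where
  "Sph = sphere 0 1"

definition north :: "'n::finite amb" where
  "north = (0, 1)"

definition stereo :: "'n::finite amb \<Rightarrow> real^'n" where
  "stereo x = fst x /\<^sub>R (1 - snd x)"

definition stereo_inv :: "real^'n::finite \<Rightarrow> 'n amb" where
  "stereo_inv y = ((2 / (1 + (norm y)\<^sup>2)) *\<^sub>R y, ((norm y)\<^sup>2 - 1) / (1 + (norm y)\<^sup>2))"

text \<open>The Riemannian measure, i.e. \<open>sqrt (det g)\<close> times Lebesgue measure in the chart \<open>stereo\<close>,
  with \<open>g\<close> the metric induced from the ambient space. The point outside of the chart is a null
  set.\<close>

definition sphere_gram :: "real^'n::finite \<Rightarrow> real^'n^'n" where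
  "sphere_gram y = (\<chi> i j. frechet_derivative stereo_inv (at y) (axis i 1) \<bullet>
                           frechet_derivative stereo_inv (at y) (axis j 1))"

definition sphere_measure :: "'n::finite amb measure" where
  "sphere_measure =
     distr (density lborel (\<lambda>y. ennreal (sqrt (det (sphere_gram y))))) borel stereo_inv"

text \<open>Functions on the sphere are functions on the ambient space vanishing off the sphere.
  They are differentiated via their extension to nonzero vectors which is homogeneous of
  degree 0 (\<open>sgn x\<close> is \<open>x\<close> divided by its norm).\<close>

definition test_S :: "('n::finite amb \<Rightarrow> real) set" where
  "test_S = {f. (\<forall>x. x \<notin> Sph \<longrightarrow> f x = 0) \<and> smooth_on (- {0}) (\<lambda>x. f (sgn x))}"

definition nbhd0_S :: "('n::finite amb \<Rightarrow> real) set \<Rightarrow> bool" where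
  "nbhd0_S V \<longleftrightarrow> (\<exists>N::nat. \<exists>e>0. {f \<in> test_S. \<forall>L x. set L \<subseteq> Basis \<and> length L \<le> N \<and> x \<in> Sph \<longrightarrow>
     \<bar>iter_deriv L (\<lambda>x. f (sgn x)) x\<bar> < e} \<subseteq> V)"

definition test_S_topology :: "('n::finite amb \<Rightarrow> real) topology" where
  "test_S_topology = topology (\<lambda>U. U \<subseteq> test_S \<and>
     (\<forall>f\<in>U. \<exists>V. V \<subseteq> test_S \<and> nbhd0_S V \<and> (\<forall>v\<in>V. (\<lambda>x. f x + v x) \<in> U)))"

definition distrib_S :: "(('n::finite amb \<Rightarrow> real) \<Rightarrow> real) set" where
  "distrib_S = {\<phi> \<in> extensional test_S.
     linear_functional_on test_S \<phi> \<and> continuous_map test_S_topology euclideanreal \<phi>}"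

section \<open>Real \<open>L\<^sup>2\<close> spaces\<close>

definition L2 :: "'a measure \<Rightarrow> ('a \<Rightarrow> real) set" where
  "L2 M = {f \<in> borel_measurable M. integrable M (\<lambda>x. (f x)\<^sup>2)}"

definition L2_inner :: "'a measure \<Rightarrow> ('a \<Rightarrow> real) \<Rightarrow> ('a \<Rightarrow> real) \<Rightarrow> real" where
  "L2_inner M f g = (\<integral>x. f x * g x \<partial>M)"

definition L2_norm :: "'a measure \<Rightarrow> ('a \<Rightarrow> real) \<Rightarrow> real" where
  "L2_norm M f = sqrt (L2_inner M f f)"

text \<open>Norms of possibly non-integrable functions.\<close>

definition eL1_norm :: "'a measure \<Rightarrow> ('a \<Rightarrow> real) \<Rightarrow> ennreal" where
  "eL1_norm M f = (\<integral>\<^sup>+x. ennreal \<bar>f x\<bar> \<partial>M)"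

definition eL2_norm :: "'a measure \<Rightarrow> ('a \<Rightarrow> real) \<Rightarrow> ennreal" where
  "eL2_norm M f = (if f \<in> L2 M then ennreal (L2_norm M f) else \<infinity>)"

definition L2_onb :: "'a measure \<Rightarrow> (nat \<Rightarrow> 'a \<Rightarrow> real) \<Rightarrow> bool" where
  "L2_onb M e \<longleftrightarrow> (\<forall>i. e i \<in> L2 M) \<and>
     (\<forall>i j. L2_inner M (e i) (e j) = (if i = j then 1 else 0)) \<and>
     (\<forall>f\<in>L2 M. (\<forall>i. L2_inner M f (e i) = 0) \<longrightarrow> (AE x in M. f x = 0))"

text \<open>\<open>P\<close> is the positive square root of \<open>T\<^sup>* T\<close>; an everywhere defined symmetric operator is
  automatically linear (almost everywhere) and bounded.\<close>

definition L2_modulus ::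
  "'a measure \<Rightarrow> (('a \<Rightarrow> real) \<Rightarrow> 'a \<Rightarrow> real) \<Rightarrow> (('a \<Rightarrow> real) \<Rightarrow> 'a \<Rightarrow> real) \<Rightarrow> bool" where
  "L2_modulus M T P \<longleftrightarrow> (\<forall>f\<in>L2 M. P f \<in> L2 M \<and> 0 \<le> L2_inner M (P f) f) \<and>
     (\<forall>f\<in>L2 M. \<forall>g\<in>L2 M. L2_inner M (P f) g = L2_inner M f (P g) \<and>
        L2_inner M (P f) (P g) = L2_inner M (T f) (T g))"

definition trace_class :: "'a measure \<Rightarrow> (('a \<Rightarrow> real) \<Rightarrow> 'a \<Rightarrow> real) \<Rightarrow> bool" where
  "trace_class M T \<longleftrightarrow>
     (\<exists>P. L2_modulus M T P \<and> (\<forall>e. L2_onb M e \<longrightarrow> summable (\<lambda>i. L2_inner M (P (e i)) (e i))))"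

definition has_trace :: "'a measure \<Rightarrow> (('a \<Rightarrow> real) \<Rightarrow> 'a \<Rightarrow> real) \<Rightarrow> real \<Rightarrow> bool" where
  "has_trace M T t \<longleftrightarrow> (\<forall>e. L2_onb M e \<longrightarrow> (\<lambda>i. L2_inner M (T (e i)) (e i)) sums t)"

section \<open>The operators \<open>U\<^sub>\<alpha>\<close>, \<open>U\<^sub>\<beta>\<close> and the covariances\<close>

definition U_alpha :: "(real^'n \<Rightarrow> real) \<Rightarrow> 'n::finite amb \<Rightarrow> real" where
  "U_alpha f x = (if x \<in> Sph - {north}
     then (inverse (1 - snd x)) powr (real CARD('n) / 2) * f (stereo x) else 0)"

definition U_alpha_inv :: "('n::finite amb \<Rightarrow> real) \<Rightarrow> real^'n \<Rightarrow> real" where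
  "U_alpha_inv g y = (1 - snd (stereo_inv y)) powr (real CARD('n) / 2) * g (stereo_inv y)"

definition U_beta :: "nat \<Rightarrow> (real^'n \<Rightarrow> real) \<Rightarrow> real^'n::finite \<Rightarrow> real" where
  "U_beta k f y = real k powr (real CARD('n) / 2) * f (real k *\<^sub>R y)"

definition U_beta_inv :: "nat \<Rightarrow> (real^'n \<Rightarrow> real) \<Rightarrow> real^'n::finite \<Rightarrow> real" where
  "U_beta_inv k f y = inverse (real k) powr (real CARD('n) / 2) * f (inverse (real k) *\<^sub>R y)"

definition laplace_test :: "(real^'n \<Rightarrow> real) \<Rightarrow> real^'n::finite \<Rightarrow> real" where
  "laplace_test f x = - (\<Sum>b\<in>Basis. iter_deriv [b, b] f x)"

text \<open>The graph of the self-adjoint nonnegative Laplacian on \<open>L\<^sup>2\<close>, that is, of the adjoint of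
  the (essentially self-adjoint) Laplacian on test functions.\<close>

definition laplace_graph :: "(real^'n \<Rightarrow> real) \<Rightarrow> (real^'n::finite \<Rightarrow> real) \<Rightarrow> bool" where
  "laplace_graph u v \<longleftrightarrow> u \<in> L2 lborel \<and> v \<in> L2 lborel \<and>
     (\<forall>f\<in>test_R. L2_inner lborel u (laplace_test f) = L2_inner lborel v f)"

text \<open>The value is determined up to a null set for \<open>h \<in> L2 lborel\<close> and \<open>m > 0\<close>.\<close>

definition laplace_resolvent :: "real \<Rightarrow> (real^'n \<Rightarrow> real) \<Rightarrow> real^'n::finite \<Rightarrow> real" where
  "laplace_resolvent m h =
     (SOME u. \<exists>v. laplace_graph u v \<and> (AE x in lborel. v x + m\<^sup>2 * u x = h x))"

definition C_S :: "real \<Rightarrow> nat \<Rightarrow> ('n::finite amb \<Rightarrow> real) \<Rightarrow> 'n amb \<Rightarrow> real" where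
  "C_S m k g = U_alpha (U_beta k (laplace_resolvent m (U_beta_inv k (U_alpha_inv g))))"

section \<open>Mollifiers\<close>

text \<open>The distribution defined by a function.\<close>

definition L2_to_distrib :: "('n::finite amb \<Rightarrow> real) \<Rightarrow> ('n amb \<Rightarrow> real) \<Rightarrow> real" where
  "L2_to_distrib f = restrict (L2_inner sphere_measure f) test_S"

text \<open>A smoothing operator is represented by its kernel \<open>a\<close>, which vanishes off
  \<open>Sph \<times> Sph\<close>. The smoothing operators are exactly those of the form \<open>smoothing_op a\<close>.\<close>

definition smooth_kernel :: "('n::finite amb \<Rightarrow> 'n amb \<Rightarrow> real) \<Rightarrow> bool" where
  "smooth_kernel a \<longleftrightarrow> (\<forall>x y. x \<notin> Sph \<or> y \<notin> Sph \<longrightarrow> a x y = 0) \<and>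
     smooth_on ((- {0}) \<times> (- {0})) (\<lambda>(x, y). a (sgn x) (sgn y))"

definition smoothing_op ::
  "('n::finite amb \<Rightarrow> 'n amb \<Rightarrow> real) \<Rightarrow> (('n amb \<Rightarrow> real) \<Rightarrow> real) \<Rightarrow> 'n amb \<Rightarrow> real" where
  "smoothing_op a \<phi> x = (if x \<in> Sph then \<phi> (a x) else 0)"

definition L2_op ::
  "('n::finite amb \<Rightarrow> 'n amb \<Rightarrow> real) \<Rightarrow> ('n amb \<Rightarrow> real) \<Rightarrow> 'n amb \<Rightarrow> real" where
  "L2_op a f = smoothing_op a (L2_to_distrib f)"

text \<open>The kernel of the \<open>L\<^sup>2\<close> adjoint.\<close>

definition adjoint_kernel ::
  "('n::finite amb \<Rightarrow> 'n amb \<Rightarrow> real) \<Rightarrow> 'n amb \<Rightarrow> 'n amb \<Rightarrow> real" where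
  "adjoint_kernel a x y = a y x"

definition geodesic_dist :: "'n::finite amb \<Rightarrow> 'n amb \<Rightarrow> real" where
  "geodesic_dist x y = arccos (x \<bullet> y)"

text \<open>The inner infimum is the distance to the diagonal in the Riemannian product of two
  spheres. The value is 0 for \<open>W = {}\<close>.\<close>

definition diag_dist :: "('n::finite amb \<times> 'n amb) set \<Rightarrow> ennreal" where
  "diag_dist W = (SUP (x, y)\<in>W.
     ennreal (INF z\<in>Sph. sqrt ((geodesic_dist x z)\<^sup>2 + (geodesic_dist y z)\<^sup>2)))"

definition isometry_invariant_mollifiers ::
  "(nat \<Rightarrow> 'n::finite amb \<Rightarrow> 'n amb \<Rightarrow> real) \<Rightarrow> bool" where
  "isometry_invariant_mollifiers a \<longleftrightarrow>
     (\<forall>k\<ge>1. smooth_kernel (a k)) \<and>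
     (\<forall>k\<ge>1. trace_class sphere_measure (L2_op (a k)) \<and>
        has_trace sphere_measure (L2_op (a k)) (\<integral>x. a k x x \<partial>sphere_measure)) \<and>
     (\<exists>B. \<forall>k\<ge>1. \<forall>f\<in>L2 sphere_measure.
        L2_norm sphere_measure (L2_op (a k) f) \<le> B * L2_norm sphere_measure f) \<and>
     (\<forall>f\<in>L2 sphere_measure.
        (\<lambda>k. L2_norm sphere_measure (\<lambda>x. L2_op (a k) f x - f x)) \<longlonglongrightarrow> 0) \<and>
     (\<forall>k\<ge>1. diag_dist (supp (\<lambda>(x, y). a (Suc k) x y)) \<le> diag_dist (supp (\<lambda>(x, y). a k x y))) \<and>
     (\<lambda>k. diag_dist (supp (\<lambda>(x, y). a k x y))) \<longlonglongrightarrow> 0 \<and>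
     (\<forall>k\<ge>1. \<forall>T. orthogonal_transformation T \<longrightarrow>
        (\<forall>f\<in>L2 sphere_measure. AE x in sphere_measure.
           L2_op (a k) (\<lambda>x. f (inv T x)) x = L2_op (a k) f (inv T x)))"

definition C_tilde ::
  "real \<Rightarrow> (nat \<Rightarrow> 'n::finite amb \<Rightarrow> 'n amb \<Rightarrow> real) \<Rightarrow> nat \<Rightarrow>
   (('n amb \<Rightarrow> real) \<Rightarrow> real) \<Rightarrow> 'n amb \<Rightarrow> real" where
  "C_tilde m a k \<phi> = L2_op (adjoint_kernel (a k)) (C_S m k (smoothing_op (a k) \<phi>))"

section \<open>Measures on the test functions of the sphere\<close>

text \<open>\<open>M\<close> is the centered Gaussian measure with covariance \<open>C\<close>; this determines \<open>M\<close>.\<close>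

definition gaussian_measure_S ::
  "((('n::finite amb \<Rightarrow> real) \<Rightarrow> real) \<Rightarrow> 'n amb \<Rightarrow> real) \<Rightarrow> ('n amb \<Rightarrow> real) measure \<Rightarrow> bool" where
  "gaussian_measure_S C M \<longleftrightarrow> radon_prob test_S_topology M \<and>
     (\<forall>\<phi>\<in>distrib_S. (\<integral>g. exp (\<i> * complex_of_real (\<phi> g)) \<partial>M) =
        complex_of_real (exp (- (1/2) * \<phi> (C \<phi>))))"

definition charfun_S :: "('n::finite amb \<Rightarrow> real) measure \<Rightarrow> ('n amb \<Rightarrow> real) \<Rightarrow> complex" where
  "charfun_S \<mu> f = (\<integral>g. exp (\<i> * complex_of_real (L2_inner sphere_measure g f)) \<partial>\<mu>)"

definition is_density :: "'a measure \<Rightarrow> ('a \<Rightarrow> real) \<Rightarrow> bool" where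
  "is_density M r \<longleftrightarrow> integrable M r \<and> (AE g in M. 0 \<le> r g)"

definition normalized_density :: "'a measure \<Rightarrow> ('a \<Rightarrow> real) \<Rightarrow> 'a measure" where
  "normalized_density M r = density M (\<lambda>g. inverse (eL1_norm M r) * ennreal (r g))"

section \<open>Basic facts\<close>

lemma stereo_stereo_inv: "stereo (stereo_inv y) = y"
proof -
  have "1 + (norm y)\<^sup>2 > 0" by (simp add: add_pos_nonneg)
  hence "1 - ((norm y)\<^sup>2 - 1) / (1 + (norm y)\<^sup>2) = 2 / (1 + (norm y)\<^sup>2)" "1 + (norm y)\<^sup>2 \<noteq> 0"
    by (auto simp: field_simps)
  hence "(2 / (1 + (norm y)\<^sup>2)) / (1 - ((norm y)\<^sup>2 - 1) / (1 + (norm y)\<^sup>2)) = 1" by simp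
  thus ?thesis unfolding stereo_def stereo_inv_def by (simp add: divide_inverse mult.commute)
qed

lemma stereo_inv_in_Sph: "stereo_inv y \<in> Sph - {north}"
proof -
  define s where "s = (norm y)\<^sup>2"
  have s: "s \<ge> 0" by (simp add: s_def)
  have "(norm (stereo_inv y))\<^sup>2 = (2 / (1 + s))\<^sup>2 * s + ((s - 1) / (1 + s))\<^sup>2"
    by (simp add: stereo_inv_def norm_Pair s_def power_mult_distrib power_divide)
  also have "\<dots> = (4 * s + (s - 1)\<^sup>2) / (1 + s)\<^sup>2"
    by (simp add: power_divide add_divide_distrib)
  also have "4 * s + (s - 1)\<^sup>2 = (1 + s)\<^sup>2"
    by (simp add: power2_eq_square algebra_simps)
  finally have "(norm (stereo_inv y))\<^sup>2 = 1" using s by simp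
  hence "norm (stereo_inv y) = 1" by (metis norm_ge_zero one_power2 power2_eq_imp_eq zero_le_one)
  moreover have "(s - 1) / (1 + s) \<noteq> 1" using s by (simp add: field_simps)
  ultimately show ?thesis by (auto simp: Sph_def north_def stereo_inv_def s_def)
qed

lemma stereo_inv_stereo:
  assumes "x \<in> Sph - {north}" shows "stereo_inv (stereo x) = x"
proof -
  obtain a t where x: "x = (a, t)" by (cases x)
  have n: "(norm a)\<^sup>2 + t\<^sup>2 = 1"
    using assms by (auto simp: Sph_def x norm_Pair)
  have t: "t \<noteq> 1" using assms n by (auto simp: north_def x)
  have "(norm a)\<^sup>2 = (1 - t) * (1 + t)" using n by (simp add: algebra_simps power2_eq_square)
  hence s: "(norm (stereo x))\<^sup>2 = (1 + t) / (1 - t)"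
    using t by (simp add: stereo_def x power_mult_distrib power_divide divide_simps power2_eq_square)
  have p: "1 + (1 + t) / (1 - t) = 2 / (1 - t)" "(1 + t) / (1 - t) - 1 = 2 * t / (1 - t)"
    using t by (simp_all add: field_simps)
  have "2 / (2 / (1 - t)) * inverse (1 - t) = 1" "2 * t / (1 - t) / (2 / (1 - t)) = t"
    using t by (simp_all add: field_simps)
  thus ?thesis unfolding stereo_inv_def s p by (simp only: stereo_def x fst_conv snd_conv scaleR_scaleR scaleR_one)
qed

lemma iter_deriv_lincomb:
  assumes "open S" "smooth_on S f" "smooth_on S g" "set L \<subseteq> Basis" "x \<in> S"
  shows "iter_deriv L (\<lambda>x. s * f x + t * g x) x = s * iter_deriv L f x + t * iter_deriv L g x"
    and "iter_deriv L (\<lambda>x. s * f x + t * g x) differentiable (at x)"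
proof -
  have *: "((iter_deriv L (\<lambda>x. s * f x + t * g x)) has_derivative
      (\<lambda>h. s * frechet_derivative (iter_deriv L f) (at x) h
         + t * frechet_derivative (iter_deriv L g) (at x) h)) (at x)"
    if "set L \<subseteq> Basis" "x \<in> S"
      and eq: "\<And>x. x \<in> S \<Longrightarrow> iter_deriv L (\<lambda>x. s * f x + t * g x) x
                 = s * iter_deriv L f x + t * iter_deriv L g x" for L x
  proof -
    have "(iter_deriv L f has_derivative frechet_derivative (iter_deriv L f) (at x)) (at x)"
      "(iter_deriv L g has_derivative frechet_derivative (iter_deriv L g) (at x)) (at x)"
      using assms(2,3) that(1,2) by (auto simp: smooth_on_def frechet_derivative_works)
    hence "((\<lambda>x. s * iter_deriv L f x + t * iter_deriv L g x) has_derivative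
      (\<lambda>h. s * frechet_derivative (iter_deriv L f) (at x) h
         + t * frechet_derivative (iter_deriv L g) (at x) h)) (at x)"
      by (intro derivative_intros)
    thus ?thesis
      by (rule has_derivative_transform_within_open[OF _ assms(1) that(2)]) (simp add: eq)
  qed
  have eq: "iter_deriv L (\<lambda>x. s * f x + t * g x) x = s * iter_deriv L f x + t * iter_deriv L g x"
    if "set L \<subseteq> Basis" "x \<in> S" for L x
    using that
  proof (induction L arbitrary: x)
    case (Cons v L)
    have "((iter_deriv L (\<lambda>x. s * f x + t * g x)) has_derivative
      (\<lambda>h. s * frechet_derivative (iter_deriv L f) (at x) h
         + t * frechet_derivative (iter_deriv L g) (at x) h)) (at x)"
      using Cons by (intro *) auto
    from frechet_derivative_at[OF this] show ?case by (simp add: fun_eq_iff)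
  qed simp
  show "iter_deriv L (\<lambda>x. s * f x + t * g x) x = s * iter_deriv L f x + t * iter_deriv L g x"
    using assms eq by blast
  show "iter_deriv L (\<lambda>x. s * f x + t * g x) differentiable (at x)"
    using *[OF assms(4,5)] eq[OF assms(4)] by (auto simp: differentiable_def)
qed

lemma smooth_on_lincomb:
  fixes f g :: "'a::euclidean_space \<Rightarrow> real"
  assumes "open S" "smooth_on S f" "smooth_on S g"
  shows "smooth_on S (\<lambda>x. s * f x + t * g x)"
  unfolding smooth_on_def
proof (intro allI impI, elim conjE)
  fix L :: "'a list" and x assume "set L \<subseteq> Basis" "x \<in> S"
  thus "iter_deriv L (\<lambda>x. s * f x + t * g x) differentiable (at x)"
    by (rule iter_deriv_lincomb(2)[OF assms])
qed

lemma test_R_lincomb: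
  assumes "f \<in> test_R" "g \<in> test_R"
  shows "(\<lambda>x. s * f x + t * g x) \<in> test_R"
proof -
  have "supp (\<lambda>x. s * f x + t * g x) \<subseteq> supp f \<union> supp g"
    unfolding supp_def closure_Un[symmetric] by (rule closure_mono) auto
  moreover have "compact (supp f \<union> supp g)" using assms by (auto simp: test_R_def)
  ultimately have "compact (supp (\<lambda>x. s * f x + t * g x))"
    using compact_Int_closed[of "supp f \<union> supp g" "supp (\<lambda>x. s * f x + t * g x)"]
    by (simp add: inf.absorb2) (simp add: supp_def)
  moreover have "smooth_on UNIV (\<lambda>x. s * f x + t * g x)"
    using assms by (intro smooth_on_lincomb) (auto simp: test_R_def)
  ultimately show ?thesis by (simp add: test_R_def)
qed

lemma test_S_lincomb:
  assumes "f \<in> test_S" "g \<in> test_S"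
  shows "(\<lambda>x. s * f x + t * g x) \<in> test_S"
proof -
  have "smooth_on (- {0}) (\<lambda>x. s * f (sgn x) + t * g (sgn x))"
    using assms by (intro smooth_on_lincomb) (auto simp: test_S_def)
  thus ?thesis using assms by (simp add: test_S_def)
qed

lemma istopology_nbhd0:
  assumes int: "\<And>V W. V \<subseteq> D \<Longrightarrow> W \<subseteq> D \<Longrightarrow> nb V \<Longrightarrow> nb W \<Longrightarrow> nb (V \<inter> W)"
  shows "istopology (\<lambda>U. U \<subseteq> D \<and>
     (\<forall>f\<in>U. \<exists>V. V \<subseteq> D \<and> nb V \<and> (\<forall>v\<in>V. (\<lambda>x. f x + v x :: real) \<in> U)))"
  unfolding istopology_def
proof (intro conjI allI impI ballI; (elim conjE)?)
  fix S T f
  assume S: "S \<subseteq> D" "\<forall>f\<in>S. \<exists>V. V \<subseteq> D \<and> nb V \<and> (\<forall>v\<in>V. (\<lambda>x. f x + v x) \<in> S)"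
    and T: "T \<subseteq> D" "\<forall>f\<in>T. \<exists>V. V \<subseteq> D \<and> nb V \<and> (\<forall>v\<in>V. (\<lambda>x. f x + v x) \<in> T)"
    and f: "f \<in> S \<inter> T"
  obtain V where "V \<subseteq> D" "nb V" "\<forall>v\<in>V. (\<lambda>x. f x + v x) \<in> S" using S f by blast
  moreover obtain W where "W \<subseteq> D" "nb W" "\<forall>v\<in>W. (\<lambda>x. f x + v x) \<in> T" using T f by blast
  ultimately show "\<exists>V. V \<subseteq> D \<and> nb V \<and> (\<forall>v\<in>V. (\<lambda>x. f x + v x) \<in> S \<inter> T)"
    by (intro exI[of _ "V \<inter> W"]) (auto intro: int)
next
  fix \<K> f
  assume "\<forall>K\<in>\<K>. K \<subseteq> D \<and> (\<forall>f\<in>K. \<exists>V. V \<subseteq> D \<and> nb V \<and> (\<forall>v\<in>V. (\<lambda>x. f x + v x) \<in> K))"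
    "f \<in> \<Union>\<K>"
  thus "\<exists>V. V \<subseteq> D \<and> nb V \<and> (\<forall>v\<in>V. (\<lambda>x. f x + v x) \<in> \<Union>\<K>)" by (meson UnionI UnionE)
qed blast+

lemma nbhd0_R_Int:
  assumes "nbhd0_R V" "nbhd0_R W" shows "nbhd0_R (V \<inter> W)"
  unfolding nbhd0_R_def
proof (intro conjI allI impI)
  show "\<forall>u\<in>V \<inter> W. \<forall>v\<in>V \<inter> W. \<forall>s t. \<bar>s\<bar> + \<bar>t\<bar> \<le> 1 \<longrightarrow> (\<lambda>x. s * u x + t * v x) \<in> V \<inter> W"
    using assms by (simp add: nbhd0_R_def)
next
  fix K :: "(real^'a) set" assume "compact K"
  then obtain M d N e where "d > 0" "e > 0"
    and M: "{f \<in> test_R. supp f \<subseteq> K \<and>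
        (\<forall>L x. set L \<subseteq> Basis \<and> length L \<le> M \<longrightarrow> \<bar>iter_deriv L f x\<bar> < d)} \<subseteq> V"
    and N: "{f \<in> test_R. supp f \<subseteq> K \<and>
        (\<forall>L x. set L \<subseteq> Basis \<and> length L \<le> N \<longrightarrow> \<bar>iter_deriv L f x\<bar> < e)} \<subseteq> W"
    using assms[unfolded nbhd0_R_def, THEN conjunct2, rule_format, of K] by blast
  show "\<exists>N. \<exists>e>0. {f \<in> test_R. supp f \<subseteq> K \<and>
        (\<forall>L x. set L \<subseteq> Basis \<and> length L \<le> N \<longrightarrow> \<bar>iter_deriv L f x\<bar> < e)} \<subseteq> V \<inter> W"
  proof (intro exI[of _ "max M N"] exI[of _ "min d e"] conjI)
    show "min d e > 0" using \<open>d > 0\<close> \<open>e > 0\<close> by simp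
    show "{f \<in> test_R. supp f \<subseteq> K \<and>
        (\<forall>L x. set L \<subseteq> Basis \<and> length L \<le> max M N \<longrightarrow> \<bar>iter_deriv L f x\<bar> < min d e)} \<subseteq> V \<inter> W"
      by (intro Int_greatest order.trans[OF _ M] order.trans[OF _ N] Collect_mono)
        (simp_all add: le_max_iff_disj)
  qed
qed

lemma nbhd0_S_Int:
  assumes "nbhd0_S V" "nbhd0_S W" shows "nbhd0_S (V \<inter> W)"
proof -
  obtain M d N e where "d > 0" "e > 0"
    and M: "{f \<in> test_S. \<forall>L x. set L \<subseteq> Basis \<and> length L \<le> M \<and> x \<in> Sph \<longrightarrow>
      \<bar>iter_deriv L (\<lambda>x. f (sgn x)) x\<bar> < d} \<subseteq> V"
    and N: "{f \<in> test_S. \<forall>L x. set L \<subseteq> Basis \<and> length L \<le> N \<and> x \<in> Sph \<longrightarrow>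
      \<bar>iter_deriv L (\<lambda>x. f (sgn x)) x\<bar> < e} \<subseteq> W"
    using assms unfolding nbhd0_S_def by blast
  show ?thesis unfolding nbhd0_S_def
  proof (intro exI[of _ "max M N"] exI[of _ "min d e"] conjI)
    show "min d e > 0" using \<open>d > 0\<close> \<open>e > 0\<close> by simp
    show "{f \<in> test_S. \<forall>L x. set L \<subseteq> Basis \<and> length L \<le> max M N \<and> x \<in> Sph \<longrightarrow>
      \<bar>iter_deriv L (\<lambda>x. f (sgn x)) x\<bar> < min d e} \<subseteq> V \<inter> W"
      by (intro Int_greatest order.trans[OF _ M] order.trans[OF _ N] Collect_mono)
        (simp_all add: le_max_iff_disj)
  qed
qed

lemma openin_test_R_topology:
  "openin test_R_topology U \<longleftrightarrow> U \<subseteq> test_R \<and>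
     (\<forall>f\<in>U. \<exists>V. V \<subseteq> test_R \<and> nbhd0_R V \<and> (\<forall>v\<in>V. (\<lambda>x. f x + v x) \<in> U))"
  unfolding test_R_topology_def
  by (subst topology_inverse'[OF istopology_nbhd0]) (auto intro: nbhd0_R_Int)

lemma openin_test_S_topology:
  "openin test_S_topology U \<longleftrightarrow> U \<subseteq> test_S \<and>
     (\<forall>f\<in>U. \<exists>V. V \<subseteq> test_S \<and> nbhd0_S V \<and> (\<forall>v\<in>V. (\<lambda>x. f x + v x) \<in> U))"
  unfolding test_S_topology_def
  by (subst topology_inverse'[OF istopology_nbhd0]) (auto intro: nbhd0_S_Int)

lemma topspace_test_R_topology: "topspace test_R_topology = test_R"
proof
  show "topspace test_R_topology \<subseteq> test_R"
    using openin_test_R_topology openin_topspace by blast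
  have "nbhd0_R test_R"
    unfolding nbhd0_R_def
  proof (intro conjI allI impI ballI exI)
    show "(1::real) > 0" by simp
  qed (auto intro: test_R_lincomb)
  hence "openin test_R_topology test_R"
    unfolding openin_test_R_topology using test_R_lincomb[where s = 1 and t = 1] by (intro conjI ballI exI[of _ test_R]) simp_all
  thus "test_R \<subseteq> topspace test_R_topology" by (rule openin_subset)
qed

lemma topspace_test_S_topology: "topspace test_S_topology = test_S"
proof
  show "topspace test_S_topology \<subseteq> test_S"
    using openin_test_S_topology openin_topspace by blast
  have "nbhd0_S test_S"
    unfolding nbhd0_S_def
  proof (intro conjI exI)
    show "(1::real) > 0" by simp
  qed auto
  hence "openin test_S_topology test_S"
    unfolding openin_test_S_topology using test_S_lincomb[where s = 1 and t = 1] by (intro conjI ballI exI[of _ test_S]) simp_all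
  thus "test_S \<subseteq> topspace test_S_topology" by (rule openin_subset)
qed

end

theory Submission
  imports Defs
begin

text \<open>The Gaussian second moment of \<open>\<langle>g, U f\<rangle>\<close> is at most \<open>(B / m)\<^sup>2\<close> times the squared \<open>L\<^sup>2\<close> norm of
  \<open>f\<close>, where \<open>B\<close> bounds the mollifiers, because the Laplacian is nonnegative and \<open>U\<close> is unitary. By
  Cauchy-Schwarz, the hypotheses on the densities turn this into a bound, uniform in \<open>k\<close>, of the
  first absolute moment under the interacting measures, and this gives equicontinuity.

  For the limit, a test function is written as \<open>f = (\<integral>y. h y * corner y)\<close>, where \<open>h\<close> is up to sign
  the mixed derivative \<open>\<partial>\<^sub>1 \<dots> \<partial>\<^sub>d f\<close> and \<open>corner y\<close> is, up to sign, the indicator of the box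
  spanned by \<open>0\<close> and \<open>y\<close>. So the distributions are the mixed derivatives of the random functions
  \<open>y \<mapsto> \<langle>g, U (corner y)\<rangle>\<close>, which are Hoelder continuous with exponent 1/2 in mean. The joint laws
  of their values at the countably many dyadic points have a convergent subsequence: the cube
  \<open>[0, 1]\<^sup>\<nat>\<close> is a continuous image of the line (Schoenberg's curve), which reduces this to Helly's
  theorem on the line. The mean Hoelder bound makes the sums over dyadic cells converge almost
  surely to a random distribution, as a function on the line which is continuous on sets of almost
  full measure, and its law is a Radon measure.\<close>

section \<open>Lebesgue measure and the real \<open>L\<^sup>2\<close> space\<close>

text \<open>A mean bound by the L2 norm of \<open>f\<close> gives, for each \<open>f\<close>, an
  estimate off a null set that depends on \<open>f\<close>; the samples themselves need not be
  square integrable, as white noise shows. Boxes gain the missing regularity: the boxes of two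
  nearby points differ by a set whose volume is of the order of the distance, so the norm of the
  difference is of the order of its square root. This is the exponent 1/2. With first moments alone
  it is too weak for a uniform modulus of continuity in the manner of Kolmogorov. An integrated
  modulus is enough, because the random function is only paired with the bounded function
  \<open>mixed f\<close>: the increments between two dyadic levels, averaged over the cells, have a
  mean of order 2 to the power -l/2, which is summable.

  The line replaces the nonmetrizable space of distributions as the place where compactness is used.
  Tightness and inner regularity are those of measures on the line, and continuity on large subsets
  carries compact sets of the line to compact sets of distributions.\<close>

lemma L2_mult_integrable:
  assumes "f \<in> L2 M" "g \<in> L2 M" shows "integrable M (\<lambda>x. f x * g x)"
proof (rule Bochner_Integration.integrable_bound[where f = "\<lambda>x. (f x)\<^sup>2 + (g x)\<^sup>2"])
  show "integrable M (\<lambda>x. (f x)\<^sup>2 + (g x)\<^sup>2)" using assms by (auto simp: L2_def)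
  show "(\<lambda>x. f x * g x) \<in> borel_measurable M" using assms by (auto simp: L2_def)
  have "\<bar>f x * g x\<bar> \<le> (f x)\<^sup>2 + (g x)\<^sup>2" for x
    using sum_squares_bound[of "\<bar>f x\<bar>" "\<bar>g x\<bar>"] mult_nonneg_nonneg[of "\<bar>f x\<bar>" "\<bar>g x\<bar>"]
    unfolding abs_mult power2_abs by linarith
  then show "AE x in M. norm (f x * g x) \<le> norm ((f x)\<^sup>2 + (g x)\<^sup>2)"
    by (auto intro: order_trans[OF _ abs_ge_self])
qed

lemma L2_lincomb:
  assumes "f \<in> L2 M" "g \<in> L2 M" shows "(\<lambda>x. s * f x + t * g x) \<in> L2 M"
proof -
  have "integrable M (\<lambda>x. s\<^sup>2 * (f x)\<^sup>2 + (2 * s * t * (f x * g x) + t\<^sup>2 * (g x)\<^sup>2))"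
    using assms L2_mult_integrable[OF assms] by (auto simp: L2_def)
  also have "(\<lambda>x. s\<^sup>2 * (f x)\<^sup>2 + (2 * s * t * (f x * g x) + t\<^sup>2 * (g x)\<^sup>2))
      = (\<lambda>x. (s * f x + t * g x)\<^sup>2)"
    by (simp add: fun_eq_iff power2_eq_square algebra_simps)
  finally show ?thesis using assms by (auto simp: L2_def)
qed

lemma L2_scale: "f \<in> L2 M \<Longrightarrow> (\<lambda>x. s * f x) \<in> L2 M"
  using L2_lincomb[of f M f s 0] by simp

lemma L2_add: "f \<in> L2 M \<Longrightarrow> g \<in> L2 M \<Longrightarrow> (\<lambda>x. f x + g x) \<in> L2 M"
  using L2_lincomb[of f M g 1 1] by simp

lemma L2_diff: "f \<in> L2 M \<Longrightarrow> g \<in> L2 M \<Longrightarrow> (\<lambda>x. f x - g x) \<in> L2 M"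
  using L2_lincomb[of f M g 1 "-1"] by simp

lemma L2_zero: "(\<lambda>x. 0) \<in> L2 M" by (simp add: L2_def)

lemma L2_sum: "(\<And>i. i \<in> I \<Longrightarrow> f i \<in> L2 M) \<Longrightarrow> (\<lambda>x. \<Sum>i\<in>I. f i x) \<in> L2 M"
  by (induction I rule: infinite_finite_induct) (auto intro: L2_add L2_zero)

lemma L2_inner_commute: "L2_inner M f g = L2_inner M g f"
  by (simp add: L2_inner_def mult.commute)

lemma L2_inner_lincomb_right:
  assumes "f \<in> L2 M" "g \<in> L2 M" "h \<in> L2 M"
  shows "L2_inner M h (\<lambda>x. s * f x + t * g x) = s * L2_inner M h f + t * L2_inner M h g"
proof -
  have "L2_inner M h (\<lambda>x. s * f x + t * g x) = (\<integral>x. s * (h x * f x) + t * (h x * g x) \<partial>M)"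
    by (simp add: L2_inner_def algebra_simps)
  then show ?thesis using assms by (simp add: L2_inner_def L2_mult_integrable)
qed

lemma L2_inner_scale_right: "L2_inner M h (\<lambda>x. s * f x) = s * L2_inner M h f"
  by (simp add: L2_inner_def mult.left_commute)

lemma L2_inner_self_nonneg: "0 \<le> L2_inner M f f"
  unfolding L2_inner_def by (rule Bochner_Integration.integral_nonneg) simp

lemma L2_norm_nonneg: "0 \<le> L2_norm M f"
  by (simp add: L2_norm_def L2_inner_self_nonneg)

lemma L2_norm_sq: "(L2_norm M f)\<^sup>2 = L2_inner M f f"
  by (simp add: L2_norm_def L2_inner_self_nonneg)

lemma L2_Cauchy_Schwarz:
  assumes f: "f \<in> L2 M" and g: "g \<in> L2 M"
  shows "\<bar>L2_inner M f g\<bar> \<le> L2_norm M f * L2_norm M g"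
proof -
  define A B C where "A = L2_inner M f f" and "B = L2_inner M g g" and "C = L2_inner M f g"
  have "C\<^sup>2 \<le> A * B"
  proof (cases "B = 0")
    case True
    then have "AE x in M. g x * g x = 0"
      using integral_nonneg_eq_0_iff_AE[OF L2_mult_integrable[OF g g]]
      by (simp add: B_def L2_inner_def)
    then have "C = (\<integral>x. 0 \<partial>M)" unfolding C_def L2_inner_def
      using f g by (intro integral_cong_AE) (auto simp: L2_def)
    then show ?thesis using True by simp
  next
    case False
    then have B: "B > 0" using L2_inner_self_nonneg[of M g] by (simp add: B_def)
    \<comment> \<open>\<open>?h\<close> is \<open>B\<close> times the component of \<open>f\<close>
      orthogonal to \<open>g\<close>, so its squared norm is
      \<open>B * (A * B - C\<^sup>2)\<close>.\<close>
    let ?h = "\<lambda>x. B * f x + (- C) * g x"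
    have h: "?h \<in> L2 M" by (rule L2_lincomb[OF f g])
    have "L2_inner M ?h ?h = B * L2_inner M ?h f + (- C) * L2_inner M ?h g"
      by (rule L2_inner_lincomb_right[OF f g h])
    also have "L2_inner M ?h f = B * A + (- C) * C"
      unfolding L2_inner_commute[of M ?h] L2_inner_lincomb_right[OF f g f] by (simp add: A_def C_def)
    also have "L2_inner M ?h g = B * C + (- C) * B"
      unfolding L2_inner_commute[of M ?h] L2_inner_lincomb_right[OF f g g]
      by (simp add: B_def C_def L2_inner_commute)
    finally have "L2_inner M ?h ?h = B * (A * B - C\<^sup>2)"
      by (simp add: power2_eq_square algebra_simps)
    then have "0 \<le> B * (A * B - C\<^sup>2)" using L2_inner_self_nonneg[of M ?h] by simp
    then show ?thesis using B by (simp add: zero_le_mult_iff)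
  qed
  then have "sqrt (C\<^sup>2) \<le> sqrt (A * B)" by (rule real_sqrt_le_mono)
  then show ?thesis by (simp add: L2_norm_def A_def B_def C_def real_sqrt_mult)
qed

lemma L2_norm_triangle:
  assumes f: "f \<in> L2 M" and g: "g \<in> L2 M"
  shows "L2_norm M (\<lambda>x. f x + g x) \<le> L2_norm M f + L2_norm M g"
proof (rule power2_le_imp_le)
  let ?h = "\<lambda>x. 1 * f x + 1 * g x"
  have h: "?h \<in> L2 M" by (rule L2_lincomb[OF f g])
  have "L2_inner M ?h ?h = L2_inner M ?h f + L2_inner M ?h g"
    using L2_inner_lincomb_right[OF f g h, of 1 1] by simp
  also have "L2_inner M ?h f = L2_inner M f f + L2_inner M f g"
    unfolding L2_inner_commute[of M ?h] L2_inner_lincomb_right[OF f g f] by simp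
  also have "L2_inner M ?h g = L2_inner M f g + L2_inner M g g"
    unfolding L2_inner_commute[of M ?h] L2_inner_lincomb_right[OF f g g]
    by (simp add: L2_inner_commute)
  finally have "(L2_norm M (\<lambda>x. f x + g x))\<^sup>2 \<le> (L2_norm M f)\<^sup>2 + 2 * L2_inner M f g + (L2_norm M g)\<^sup>2"
    by (simp add: L2_norm_sq)
  also have "\<dots> \<le> (L2_norm M f + L2_norm M g)\<^sup>2"
    using L2_Cauchy_Schwarz[OF f g] by (simp add: power2_sum)
  finally show "(L2_norm M (\<lambda>x. f x + g x))\<^sup>2 \<le> (L2_norm M f + L2_norm M g)\<^sup>2" .
qed (simp add: L2_norm_nonneg)

lemma L2_norm_scale: "L2_norm M (\<lambda>x. s * f x) = \<bar>s\<bar> * L2_norm M f"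
proof -
  have "L2_inner M (\<lambda>x. s * f x) (\<lambda>x. s * f x) = s\<^sup>2 * L2_inner M f f"
    by (simp add: L2_inner_def power2_eq_square algebra_simps flip: integral_mult_right_zero)
  then show ?thesis by (simp add: L2_norm_def real_sqrt_mult)
qed

lemma L2_norm_eq: "L2_norm M f = sqrt (\<integral>x. (f x)\<^sup>2 \<partial>M)"
  by (simp add: L2_norm_def L2_inner_def power2_eq_square)

section \<open>Affine changes of variables and continuity of translations in L2\<close>

lemma lborel_integral_affine:
  fixes f :: "'a::euclidean_space \<Rightarrow> real"
  assumes c: "c \<noteq> 0" and f [measurable]: "f \<in> borel_measurable borel"
  shows "(\<integral>x. f x \<partial>lborel) = \<bar>c\<bar> ^ DIM('a) * (\<integral>x. f (t + c *\<^sub>R x) \<partial>lborel)"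
    and "integrable lborel f \<longleftrightarrow> integrable lborel (\<lambda>x. f (t + c *\<^sub>R x))"
proof -
  have "(\<integral>x. f x \<partial>lborel) = (\<integral>x. f x \<partial>density (distr lborel borel (\<lambda>x. t + c *\<^sub>R x)) (\<lambda>_. \<bar>c\<bar> ^ DIM('a)))"
    by (subst lborel_affine[OF c, of t]) simp
  also have "\<dots> = \<bar>c\<bar> ^ DIM('a) * (\<integral>x. f (t + c *\<^sub>R x) \<partial>lborel)"
    by (subst integral_density) (simp_all add: integral_distr)
  finally show "(\<integral>x. f x \<partial>lborel) = \<bar>c\<bar> ^ DIM('a) * (\<integral>x. f (t + c *\<^sub>R x) \<partial>lborel)" .
  have "integrable lborel f \<longleftrightarrow> integrable (density (distr lborel borel (\<lambda>x. t + c *\<^sub>R x)) (\<lambda>_. \<bar>c\<bar> ^ DIM('a))) f"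
    by (subst lborel_affine[OF c, of t]) simp
  also have "\<dots> \<longleftrightarrow> integrable lborel (\<lambda>x. f (t + c *\<^sub>R x))"
    using c by (subst integrable_density) (simp_all add: integrable_distr_eq)
  finally show "integrable lborel f \<longleftrightarrow> integrable lborel (\<lambda>x. f (t + c *\<^sub>R x))" .
qed

lemma L2_translate:
  fixes u :: "'a::euclidean_space \<Rightarrow> real"
  assumes "u \<in> L2 lborel"
  shows "(\<lambda>x. u (x - r)) \<in> L2 lborel"
    and "L2_norm lborel (\<lambda>x. u (x - r)) = L2_norm lborel u"
proof -
  have u [measurable]: "u \<in> borel_measurable borel" using assms by (auto simp: L2_def)
  have "integrable lborel (\<lambda>x. (u x)\<^sup>2)" using assms by (auto simp: L2_def)
  then have "integrable lborel (\<lambda>x. (u (x - r))\<^sup>2)"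
    using lborel_integral_affine(2)[of 1 "\<lambda>x. (u x)\<^sup>2" "- r"] by (simp add: add.commute)
  then show "(\<lambda>x. u (x - r)) \<in> L2 lborel" by (simp add: L2_def)
  show "L2_norm lborel (\<lambda>x. u (x - r)) = L2_norm lborel u"
    using lborel_integral_affine(1)[of 1 "\<lambda>x. (u x)\<^sup>2" "- r"] by (simp add: L2_norm_eq add.commute)
qed

lemma L2_bounded_support:
  fixes f :: "'a::euclidean_space \<Rightarrow> real"
  assumes [measurable]: "f \<in> borel_measurable borel" and S: "S \<in> lmeasurable" "S \<in> sets borel"
    and b: "\<And>x. \<bar>f x\<bar> \<le> B" and z: "\<And>x. x \<notin> S \<Longrightarrow> f x = 0"
  shows "integrable lborel f" "f \<in> L2 lborel" "L2_norm lborel f \<le> B * sqrt (measure lborel S)"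
proof -
  have B: "B \<ge> 0" using b[of undefined] by (rule order_trans[OF abs_ge_zero])
  have fin: "emeasure lborel S < \<infinity>" using S by (simp add: fmeasurable_def emeasure_completion)
  have i: "integrable lborel (\<lambda>x. c * indicator S x :: real)" for c
    using S fin by (intro integrable_mult_right integrable_real_indicator) auto
  show "integrable lborel f"
    by (rule Bochner_Integration.integrable_bound[OF i[of B]])
      (auto simp: indicator_def z intro!: AE_I2 order_trans[OF b])
  have sq: "(f x)\<^sup>2 \<le> B\<^sup>2 * indicator S x" for x
    using b[of x] z[of x] B by (auto simp: indicator_def abs_le_square_iff[symmetric])
  have i2: "integrable lborel (\<lambda>x. (f x)\<^sup>2)"
    by (rule Bochner_Integration.integrable_bound[OF i[of "B\<^sup>2"]])
      (use sq in \<open>auto intro!: AE_I2 order_trans[OF _ abs_ge_self]\<close>)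
  then show "f \<in> L2 lborel" by (simp add: L2_def)
  have "(\<integral>x. (f x)\<^sup>2 \<partial>lborel) \<le> (\<integral>x. B\<^sup>2 * indicator S x \<partial>lborel)"
    by (rule integral_mono[OF i2 i sq])
  also have "\<dots> = B\<^sup>2 * measure lborel S" using S fin by simp
  finally have "L2_norm lborel f \<le> sqrt (B\<^sup>2 * measure lborel S)"
    unfolding L2_norm_eq by (rule real_sqrt_le_mono)
  then show "L2_norm lborel f \<le> B * sqrt (measure lborel S)"
    using B by (simp add: real_sqrt_mult)
qed

lemma L2_norm_tendsto_zero:
  assumes "\<And>n. f n \<in> borel_measurable M" "integrable M w"
    and "\<And>n x. (f n x)\<^sup>2 \<le> w x" and "AE x in M. (\<lambda>n. f n x) \<longlonglongrightarrow> 0"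
  shows "(\<lambda>n. L2_norm M (f n)) \<longlonglongrightarrow> 0"
proof -
  have "(\<lambda>n. \<integral>x. (f n x)\<^sup>2 \<partial>M) \<longlonglongrightarrow> (\<integral>x. 0 \<partial>M)"
  proof (rule integral_dominated_convergence[where w = w])
    show "AE x in M. (\<lambda>n. (f n x)\<^sup>2) \<longlonglongrightarrow> 0"
      using assms(4) by eventually_elim (auto intro: tendsto_eq_intros)
  qed (use assms in auto)
  then have "(\<lambda>n. sqrt (\<integral>x. (f n x)\<^sup>2 \<partial>M)) \<longlonglongrightarrow> sqrt 0"
    by (intro tendsto_real_sqrt) simp
  then show ?thesis by (simp add: L2_norm_eq)
qed

text \<open>Two approximations by dominated convergence. Clamping the values and cutting off at
  infinity makes the function bounded with bounded support. A bounded measurable function is then an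
  almost everywhere limit of continuous ones, and the same clamp and cut applied to these supplies
  the dominating function.\<close>

lemma L2_continuous_approx:
  fixes u :: "'a::euclidean_space \<Rightarrow> real"
  assumes u: "u \<in> L2 lborel" and e: "e > 0"
  shows "\<exists>g R. continuous_on UNIV g \<and> (\<forall>x. norm x > R \<longrightarrow> g x = 0) \<and> g \<in> L2 lborel \<and>
    L2_norm lborel (\<lambda>x. u x - g x) < e"
proof -
  have um [measurable]: "u \<in> borel_measurable borel" using u by (auto simp: L2_def)
  define cl where "cl c y = max (- c) (min c y)" for c y :: real
  define cut where "cut N x = max 0 (min 1 (real N + 1 - norm x))" for N and x :: 'a
  have cut: "0 \<le> cut N x" "cut N x \<le> 1" "norm x > real N + 1 \<Longrightarrow> cut N x = 0" for N x
    by (auto simp: cut_def)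
  have cutm [measurable]: "cut N \<in> borel_measurable borel" for N
    unfolding cut_def by measurable
  have clm [measurable]: "cl c \<in> borel_measurable borel" for c unfolding cl_def by measurable
  define v where "v N x = cl (real N) (u x) * cut N x" for N x
  have vm [measurable]: "v N \<in> borel_measurable borel" for N unfolding v_def by measurable
  have "(\<lambda>N. L2_norm lborel (\<lambda>x. u x - v N x)) \<longlonglongrightarrow> 0"
  proof (rule L2_norm_tendsto_zero[where w = "\<lambda>x. (u x)\<^sup>2"])
    show "integrable lborel (\<lambda>x. (u x)\<^sup>2)" using u by (simp add: L2_def)
    show "(u x - v N x)\<^sup>2 \<le> (u x)\<^sup>2" for N x
    proof -
      have "\<bar>u x - v N x\<bar> \<le> \<bar>u x\<bar>"
      proof (cases "u x \<ge> 0")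
        case True
        then have "0 \<le> cl (real N) (u x)" "cl (real N) (u x) \<le> u x" by (auto simp: cl_def)
        then have "0 \<le> v N x" "v N x \<le> u x"
          using cut[where N=N and x=x] mult_mono[of "cl (real N) (u x)" "u x" "cut N x" 1] by (auto simp: v_def)
        then show ?thesis by simp
      next
        case False
        then have "0 \<le> - cl (real N) (u x)" "- cl (real N) (u x) \<le> - u x" by (auto simp: cl_def)
        then have "0 \<le> - v N x" "- v N x \<le> - u x"
          using cut[where N=N and x=x] mult_mono[of "- cl (real N) (u x)" "- u x" "cut N x" 1]
            mult_nonneg_nonneg[of "- cl (real N) (u x)" "cut N x"] by (auto simp: v_def)
        then show ?thesis by simp
      qed
      then show ?thesis by (simp add: abs_le_square_iff)
    qed
    have "(\<lambda>N. u x - v N x) \<longlonglongrightarrow> 0" for x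
    proof (rule tendsto_eventually)
      obtain N0 where "real N0 > max \<bar>u x\<bar> (norm x)" using reals_Archimedean2 by blast
      then have "u x - v N x = 0" if "N \<ge> N0" for N
        using that of_nat_mono[OF that, where 'a = real] by (auto simp: v_def cl_def cut_def)
      then show "\<forall>\<^sub>F N in sequentially. u x - v N x = 0" by (auto simp: eventually_sequentially)
    qed
    then show "AE x in lborel. (\<lambda>N. u x - v N x) \<longlonglongrightarrow> 0" by simp
  qed (use vm um in measurable)
  then obtain N where N: "L2_norm lborel (\<lambda>x. u x - v N x) < e / 2"
    using e by (auto simp: lim_sequentially L2_norm_nonneg dest!: spec[of _ "e/2"])
  have "(\<lambda>x. cl (real N) (u x)) measurable_on UNIV"
    by (intro lebesgue_measurable_imp_measurable_on_real)
      (auto intro!: measurable_completion)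
  then obtain Z h where Z: "negligible Z" and h: "\<And>n. continuous_on UNIV (h n)"
    and lim: "\<And>x. x \<notin> Z \<Longrightarrow> (\<lambda>n. h n x) \<longlonglongrightarrow> cl (real N) (u x)"
    unfolding measurable_on_def by auto
  define g where "g n x = cl (real N) (h n x) * cut N x" for n :: nat and x
  have gc: "continuous_on UNIV (g n)" for n
    unfolding g_def cl_def cut_def by (intro continuous_intros h)
  have g0: "g n x = 0" if "norm x > real N + 1" for n x using cut that by (simp add: g_def)
  have bd: "\<bar>cl (real N) y * cut N x\<bar> \<le> real N" for y x
    using cut[where N=N and x=x] mult_mono[of "\<bar>cl (real N) y\<bar>" "real N" "cut N x" 1]
    by (auto simp: cl_def abs_mult)
  have cb: "cball 0 (real N + 1) \<in> lmeasurable" "cball 0 (real N + 1) \<in> sets borel" for N by auto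
  have gm [measurable]: "g n \<in> borel_measurable borel" for n by (rule borel_measurable_continuous_onI[OF gc])
  have gL: "g n \<in> L2 lborel" for n
    by (rule L2_bounded_support(2)[OF gm cb[of N], of n "real N"]) (use bd g0 in \<open>auto simp: g_def\<close>)
  have vL: "v N \<in> L2 lborel"
    by (rule L2_bounded_support(2)[OF vm cb[of N], of N "real N"]) (use bd cut in \<open>auto simp: v_def\<close>)
  have "(\<lambda>n. L2_norm lborel (\<lambda>x. v N x - g n x)) \<longlonglongrightarrow> 0"
  proof (rule L2_norm_tendsto_zero[where w = "\<lambda>x. (2 * real N)\<^sup>2 * indicator (cball 0 (real N + 1)) x"])
    show "integrable lborel (\<lambda>x. (2 * real N)\<^sup>2 * indicator (cball (0::'a) (real N + 1)) x :: real)"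
      using emeasure_bounded_finite[of "cball (0::'a) (real N + 1)"]
      by (intro integrable_mult_right integrable_real_indicator) (auto simp: less_top)
    show "(v N x - g n x)\<^sup>2 \<le> (2 * real N)\<^sup>2 * indicator (cball 0 (real N + 1)) x" for n x
    proof (cases "norm x > real N + 1")
      case False
      have "\<bar>v N x - g n x\<bar> \<le> 2 * real N"
        using bd[of "u x" x] bd[of "h n x" x] unfolding v_def g_def by linarith
      then show ?thesis using False abs_le_square_iff[of "v N x - g n x" "2 * real N"] by simp
    qed (simp add: g0 v_def cut)
    have "AE x in lborel. x \<notin> Z"
      using Z AE_not_in[of Z lebesgue] by (simp add: negligible_iff_null_sets AE_completion_iff)
    then show "AE x in lborel. (\<lambda>n. v N x - g n x) \<longlonglongrightarrow> 0"
    proof eventually_elim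
      case (elim x)
      have "(\<lambda>n. v N x - g n x) \<longlonglongrightarrow> v N x - cl (real N) (cl (real N) (u x)) * cut N x"
        unfolding g_def cl_def by (intro tendsto_intros lim[OF elim, unfolded cl_def])
      then show ?case by (simp add: v_def cl_def)
    qed
  qed measurable
  then obtain n where n: "L2_norm lborel (\<lambda>x. v N x - g n x) < e / 2"
    using e by (auto simp: lim_sequentially L2_norm_nonneg dest!: spec[of _ "e/2"])
  have "L2_norm lborel (\<lambda>x. (u x - v N x) + (v N x - g n x)) < e"
    using L2_norm_triangle[OF L2_diff[OF u vL] L2_diff[OF vL gL[of n]]] N n by simp
  then have "L2_norm lborel (\<lambda>x. u x - g n x) < e" by simp
  then show ?thesis using gc g0 gL by blast
qed

text \<open>Translations are isometries of L2, so replacing \<open>u\<close> by a continuous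
  \<open>g\<close> costs the same before and after the shift. For \<open>g\<close> uniform
  continuity on a ball suffices.\<close>

lemma L2_translation_continuous:
  fixes u :: "'a::euclidean_space \<Rightarrow> real"
  assumes u: "u \<in> L2 lborel" and e: "e > 0"
  shows "\<exists>d>0. \<forall>r. norm r < d \<longrightarrow> L2_norm lborel (\<lambda>x. u (x - r) - u x) < e"
proof -
  obtain g R where gc: "continuous_on UNIV g" and g0: "\<And>x. norm x > R \<Longrightarrow> g x = 0"
    and g: "g \<in> L2 lborel" and ug: "L2_norm lborel (\<lambda>x. u x - g x) < e / 4"
    using L2_continuous_approx[OF u, of "e/4"] e by auto
  have gm [measurable]: "g \<in> borel_measurable borel" by (rule borel_measurable_continuous_onI[OF gc])
  define m where "m = measure lborel (cball (0::'a) (\<bar>R\<bar> + 1))"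
  \<comment> \<open>\<open>m\<close> is the volume of a ball outside of which \<open>g\<close> and
    its shift by less than 1 both vanish; a function bounded by \<open>e'\<close> on this ball and 0
    elsewhere has norm at most \<open>e' * sqrt m\<close>.\<close>
  define e' where "e' = e / (4 * (sqrt m + 1))"
  have m: "m \<ge> 0" by (simp add: m_def)
  then have e': "e' > 0" using e by (auto simp: e'_def intro!: divide_pos_pos add_nonneg_pos)
  have "uniformly_continuous_on (cball 0 (\<bar>R\<bar> + 2)) g"
    by (intro compact_uniformly_continuous continuous_on_subset[OF gc]) auto
  then obtain d where d: "d > 0" and dd: "\<And>x y. x \<in> cball 0 (\<bar>R\<bar> + 2) \<Longrightarrow> y \<in> cball 0 (\<bar>R\<bar> + 2) \<Longrightarrow> dist y x < d \<Longrightarrow> dist (g y) (g x) < e'"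
    using e' unfolding uniformly_continuous_on_def by metis
  show ?thesis
  proof (intro exI[of _ "min d 1"] conjI allI impI)
    show "min d 1 > 0" using d by simp
    fix r :: 'a assume r: "norm r < min d 1"
    have z: "g (x - r) - g x = 0" if "x \<notin> cball 0 (\<bar>R\<bar> + 1)" for x
    proof -
      have "norm (x - r) > R" "norm x > R"
        using that r norm_triangle_sub[of x r] by auto
      then show ?thesis by (simp add: g0)
    qed
    have b: "\<bar>g (x - r) - g x\<bar> \<le> e'" for x
    proof (cases "x \<in> cball 0 (\<bar>R\<bar> + 1)")
      case True
      then have "x \<in> cball 0 (\<bar>R\<bar> + 2)" "x - r \<in> cball 0 (\<bar>R\<bar> + 2)"
        using r norm_triangle_ineq4[of x r] by auto
      moreover have "dist (x - r) x < d" using r by (simp add: dist_norm)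
      ultimately show ?thesis using dd by (fastforce simp: dist_real_def)
    qed (use z e' in auto)
    have gr: "(\<lambda>x. g (x - r) - g x) \<in> L2 lborel" "L2_norm lborel (\<lambda>x. g (x - r) - g x) \<le> e' * sqrt m"
      unfolding m_def by (rule L2_bounded_support[of _ "cball 0 (\<bar>R\<bar> + 1)"]; use b z in auto)+
    have "e' * sqrt m \<le> e' * (sqrt m + 1)" using e' by simp
    also have "\<dots> = e / 4"
    proof -
      have "sqrt m + 1 \<noteq> 0" using m real_sqrt_ge_zero[OF m] by linarith
      then show ?thesis by (simp add: e'_def field_simps)
    qed
    finally have gr': "L2_norm lborel (\<lambda>x. g (x - r) - g x) \<le> e / 4" using gr by linarith
    have ug': "(\<lambda>x. u x - g x) \<in> L2 lborel" by (rule L2_diff[OF u g])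
    have gu': "(\<lambda>x. g x - u x) \<in> L2 lborel" by (rule L2_diff[OF g u])
    have gun: "L2_norm lborel (\<lambda>x. g x - u x) < e / 4"
      using ug L2_norm_scale[of lborel "-1" "\<lambda>x. u x - g x"] by simp
    note t = L2_translate[OF ug', of r]
    have "L2_norm lborel (\<lambda>x. (u (x - r) - g (x - r)) + ((g (x - r) - g x) + (g x - u x))) < e"
      using L2_norm_triangle[OF t(1) L2_add[OF gr(1) gu']] L2_norm_triangle[OF gr(1) gu'] gr' ug gun t(2) e
      by linarith
    then show "L2_norm lborel (\<lambda>x. u (x - r) - u x) < e" by simp
  qed
qed

section \<open>Lebesgue measure as a product over the coordinates\<close>

lemma measurable_vec_lambda_PiM:
  "(\<lambda>f. \<chi> i. f i) \<in> (\<Pi>\<^sub>M i\<in>(UNIV::'n::finite set). lborel) \<rightarrow>\<^sub>M (borel :: (real^'n) measure)"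
proof -
  have "(\<chi> i. f i) = (\<Sum>i\<in>UNIV. f i *\<^sub>R axis i (1::real))" for f :: "'n \<Rightarrow> real"
    by (simp add: vec_eq_iff axis_def if_distrib[of "\<lambda>x. _ * x"] cong: if_cong)
  then show ?thesis by simp
qed

text \<open>The two measures agree on boxes. The product form is what allows the coordinates to be
  integrated out one at a time.\<close>

lemma lborel_vec_eq_PiM:
  "distr (\<Pi>\<^sub>M i\<in>(UNIV::'n::finite set). lborel) borel (\<lambda>f. \<chi> i. f i) = (lborel :: (real^'n) measure)"
proof (rule lborel_eqI[symmetric])
  interpret product_sigma_finite "\<lambda>_::'n. lborel :: real measure" by standard
  fix l u :: "real^'n" assume le: "\<And>b. b \<in> Basis \<Longrightarrow> l \<bullet> b \<le> u \<bullet> b"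
  have le': "l $ i \<le> u $ i" for i
    using le[of "axis i 1"] by (simp add: inner_axis axis_in_Basis_iff)
  have "(\<lambda>f. \<chi> i. f i) -` box l u \<inter> space (\<Pi>\<^sub>M i\<in>(UNIV::'n set). lborel) = (\<Pi>\<^sub>E i\<in>UNIV. {l $ i<..<u $ i})"
    by (auto simp: mem_box_cart space_PiM PiE_iff)
  then have "emeasure (distr (\<Pi>\<^sub>M i\<in>(UNIV::'n set). lborel) borel (\<lambda>f. \<chi> i. f i)) (box l u)
      = emeasure (\<Pi>\<^sub>M i\<in>(UNIV::'n set). lborel) (\<Pi>\<^sub>E i\<in>UNIV. {l $ i<..<u $ i})"
    by (subst emeasure_distr[OF measurable_vec_lambda_PiM]) auto
  also have "\<dots> = (\<Prod>i\<in>UNIV. ennreal (u $ i - l $ i))"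
    using le' by (subst emeasure_PiM) auto
  also have "\<dots> = ennreal (\<Prod>i\<in>UNIV. u $ i - l $ i)"
    using le' by (intro prod_ennreal) auto
  also have "(\<Prod>i\<in>UNIV. u $ i - l $ i) = (\<Prod>b\<in>Basis. (u - l) \<bullet> b)"
  proof -
    have B: "(Basis :: (real^'n) set) = (\<lambda>i. axis i 1) ` UNIV" by (auto simp: Basis_vec_def)
    show ?thesis unfolding B by (subst prod.reindex) (auto simp: inj_on_def axis_eq_axis inner_axis)
  qed
  finally show "emeasure (distr (\<Pi>\<^sub>M i\<in>(UNIV::'n set). lborel) borel (\<lambda>f. \<chi> i. f i)) (box l u)
      = ennreal (\<Prod>b\<in>Basis. (u - l) \<bullet> b)" .
qed simp

lemma integrable_prod_coordinates:
  fixes f :: "'n::finite \<Rightarrow> real \<Rightarrow> real"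
  assumes f: "\<And>i. integrable lborel (f i)"
  shows "integrable lborel (\<lambda>x::real^'n. \<Prod>i\<in>UNIV. f i (x $ i))"
proof -
  interpret product_sigma_finite "\<lambda>_::'n. lborel :: real measure" by standard
  have [measurable]: "f i \<in> borel_measurable borel" for i using f[of i] by auto
  have "integrable (\<Pi>\<^sub>M i\<in>(UNIV::'n set). lborel) (\<lambda>x. \<Prod>i\<in>UNIV. f i (x i))"
    by (intro product_integrable_prod f) auto
  then have "integrable (distr (\<Pi>\<^sub>M i\<in>(UNIV::'n set). lborel) borel (\<lambda>f. \<chi> i. f i))
      (\<lambda>x::real^'n. \<Prod>i\<in>UNIV. f i (x $ i))"
    by (subst integrable_distr_eq[OF measurable_vec_lambda_PiM]) auto
  then show ?thesis by (simp add: lborel_vec_eq_PiM)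
qed

section \<open>Test functions on Euclidean space\<close>

lemma smooth_on_iter_deriv:
  fixes f :: "'a::euclidean_space \<Rightarrow> real"
  assumes "smooth_on S f" "set L \<subseteq> Basis" shows "smooth_on S (iter_deriv L f)"
proof -
  have app: "iter_deriv L' (iter_deriv L f) = iter_deriv (L' @ L) f" for L'
    by (induction L') auto
  show ?thesis using assms unfolding smooth_on_def app by auto
qed

lemma iter_deriv_has_derivative:
  assumes "smooth_on UNIV f" "set L \<subseteq> Basis"
  shows "(iter_deriv L f has_derivative frechet_derivative (iter_deriv L f) (at x)) (at x)"
  using assms by (auto simp: smooth_on_def frechet_derivative_works)

lemma iter_deriv_eq_0_outside_supp:
  assumes "x \<notin> supp f" shows "iter_deriv L f x = 0"
  using assms
proof (induction L arbitrary: x)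
  case Nil
  then show ?case using closure_subset[of "{x. f x \<noteq> 0}"] by (auto simp: supp_def)
next
  case (Cons v L)
  have o: "open (- supp f)" by (simp add: supp_def open_closed)
  have "(iter_deriv L f has_derivative (\<lambda>h. 0)) (at x)"
    by (rule has_derivative_transform_within_open[where f = "\<lambda>_. 0", OF _ o]) (use Cons in auto)
  from frechet_derivative_at[OF this] show ?case by (simp add: fun_eq_iff)
qed

lemma supp_iter_deriv: "supp (iter_deriv L f) \<subseteq> supp f"
  unfolding supp_def[of "iter_deriv L f"]
  by (rule closure_minimal) (auto intro: ccontr iter_deriv_eq_0_outside_supp, simp add: supp_def)

lemma compact_supp_subset:
  assumes "compact K" "supp f \<subseteq> K" shows "compact (supp f)"
  using compact_Int_closed[of K "supp f"] assms by (simp add: inf.absorb2) (simp add: supp_def)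

lemma test_R_iter_deriv:
  assumes "f \<in> test_R" "set L \<subseteq> Basis" shows "iter_deriv L f \<in> test_R"
  using assms smooth_on_iter_deriv compact_supp_subset[OF _ supp_iter_deriv]
  by (auto simp: test_R_def)

lemma test_R_differentiable:
  assumes "f \<in> test_R" shows "f differentiable (at x)"
  using assms by (auto simp: test_R_def smooth_on_def dest: spec[of _ "[]"])

lemma test_R_continuous: "f \<in> test_R \<Longrightarrow> continuous_on UNIV f"
  by (intro continuous_at_imp_continuous_on ballI differentiable_imp_continuous_within test_R_differentiable)

lemma test_R_measurable: "f \<in> test_R \<Longrightarrow> f \<in> borel_measurable borel"
  by (intro borel_measurable_continuous_onI test_R_continuous)

lemma not_in_supp: "x \<notin> supp f \<Longrightarrow> f x = 0"
  using closure_subset[of "{x. f x \<noteq> 0}"] by (auto simp: supp_def)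

lemma test_R_bounded:
  assumes "f \<in> test_R" obtains B where "B \<ge> 0" "\<And>x. \<bar>f x\<bar> \<le> B"
proof -
  have "compact (f ` supp f)"
    using assms by (intro compact_continuous_image continuous_on_subset[OF test_R_continuous])
      (auto simp: test_R_def)
  then obtain B where B: "\<And>y. y \<in> f ` supp f \<Longrightarrow> \<bar>y\<bar> \<le> B"
    using compact_imp_bounded bounded_real by metis
  have "\<bar>f x\<bar> \<le> max B 0" for x
    using B[of "f x"] not_in_supp[of x f] by (cases "x \<in> supp f") auto
  then show ?thesis by (intro that[of "max B 0"]) auto
qed

lemma test_R_directional:
  assumes "f \<in> test_R" "b \<in> Basis"
  shows "((\<lambda>t. f (x + t *\<^sub>R b)) has_real_derivative iter_deriv [b] f (x + t *\<^sub>R b)) (at t)"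
proof -
  have f: "(f has_derivative frechet_derivative f (at (x + t *\<^sub>R b))) (at (x + t *\<^sub>R b))"
    using test_R_differentiable[OF assms(1)] by (simp add: frechet_derivative_works)
  have "((\<lambda>t. x + t *\<^sub>R b) has_derivative (\<lambda>s. s *\<^sub>R b)) (at t)"
    by (auto intro!: derivative_eq_intros)
  from diff_chain_at[OF this f]
  have "((\<lambda>t. f (x + t *\<^sub>R b)) has_derivative (\<lambda>s. frechet_derivative f (at (x + t *\<^sub>R b)) (s *\<^sub>R b))) (at t)"
    by (simp add: o_def)
  moreover have "frechet_derivative f (at (x + t *\<^sub>R b)) (s *\<^sub>R b) = s * iter_deriv [b] f (x + t *\<^sub>R b)" for s
    using linear_frechet_derivative[OF test_R_differentiable[OF assms(1)]] by (simp add: linear_cmul)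
  ultimately show ?thesis
    unfolding has_field_derivative_def by (simp add: mult_commute_abs)
qed

lemma test_R_cong:
  fixes f :: "real^'n \<Rightarrow> real"
  assumes smooth: "\<And>L x. set L \<subseteq> Basis \<Longrightarrow> (iter_deriv L f) differentiable (at x)"
    and "compact K" "\<And>x. x \<notin> K \<Longrightarrow> f x = 0"
  shows "f \<in> test_R"
proof -
  have "supp f \<subseteq> K" unfolding supp_def using assms
    by (intro closure_minimal) (auto intro: compact_imp_closed)
  then show ?thesis using assms compact_supp_subset by (auto simp: test_R_def smooth_on_def)
qed

text \<open>Each derivative contributes one sign. The reflected translate of a mollifier is the test
  function that turns the weak equation of the Laplacian into an equation for the
  convolution.\<close>

lemma iter_deriv_reflect:
  fixes f :: "real^'n \<Rightarrow> real"
  assumes "f \<in> test_R" "set L \<subseteq> Basis"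
  shows "iter_deriv L (\<lambda>y. f (x - y)) y = (- 1) ^ length L * iter_deriv L f (x - y)"
    and "iter_deriv L (\<lambda>y. f (x - y)) differentiable (at y)"
proof -
  have D: "((\<lambda>y. (- 1) ^ length L * iter_deriv L f (x - y)) has_derivative
      (\<lambda>h. (- 1) ^ length L * frechet_derivative (iter_deriv L f) (at (x - y)) (- h))) (at y)"
    if "set L \<subseteq> Basis" for L y
  proof -
    have "(iter_deriv L f has_derivative frechet_derivative (iter_deriv L f) (at (x - y))) (at (x - y))"
      using assms that by (intro iter_deriv_has_derivative) (auto simp: test_R_def)
    moreover have "((\<lambda>y. x - y) has_derivative (\<lambda>h. - h)) (at y)"
      by (auto intro!: derivative_eq_intros)
    ultimately have "((\<lambda>y. iter_deriv L f (x - y)) has_derivative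
        (\<lambda>h. frechet_derivative (iter_deriv L f) (at (x - y)) (- h))) (at y)"
      using diff_chain_at[of "\<lambda>y. x - y" _ y "iter_deriv L f"] by (simp add: o_def)
    then show ?thesis by (intro derivative_intros)
  qed
  have eq: "iter_deriv L (\<lambda>y. f (x - y)) = (\<lambda>y. (- 1) ^ length L * iter_deriv L f (x - y))"
    if "set L \<subseteq> Basis" for L
    using that
  proof (induction L)
    case (Cons v L)
    have lin: "linear (frechet_derivative (iter_deriv L f) (at (x - y)))" for y
      using test_R_iter_deriv[OF assms(1), of L] Cons.prems
      by (intro linear_frechet_derivative test_R_differentiable) auto
    show ?case
    proof
      fix y
      have "frechet_derivative (\<lambda>y. (- 1) ^ length L * iter_deriv L f (x - y)) (at y)
        = (\<lambda>h. (- 1) ^ length L * frechet_derivative (iter_deriv L f) (at (x - y)) (- h))"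
        using frechet_derivative_at[OF D[of L y]] Cons.prems by auto
      then show "iter_deriv (v # L) (\<lambda>y. f (x - y)) y = (- 1) ^ length (v # L) * iter_deriv (v # L) f (x - y)"
        using Cons lin[of y] by (simp add: linear_neg)
    qed
  qed simp
  then show "iter_deriv L (\<lambda>y. f (x - y)) y = (- 1) ^ length L * iter_deriv L f (x - y)"
    using assms(2) by simp
  show "iter_deriv L (\<lambda>y. f (x - y)) differentiable (at y)"
    unfolding eq[OF assms(2)] using D[OF assms(2)] by (auto simp: differentiable_def)
qed

lemma test_R_reflect:
  assumes "f \<in> test_R" shows "(\<lambda>y. f (x - y)) \<in> test_R"
proof (rule test_R_cong[where K = "(\<lambda>y. x - y) ` supp f"])
  show "compact ((\<lambda>y. x - y) ` supp f)"
    using assms by (intro compact_continuous_image continuous_intros) (auto simp: test_R_def)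
  show "f (x - y) = 0" if "y \<notin> (\<lambda>y. x - y) ` supp f" for y
  proof (rule not_in_supp[of "x - y" f])
    show "x - y \<notin> supp f" using that by (metis diff_diff_eq2 add_diff_cancel_left' image_eqI)
  qed
qed (rule iter_deriv_reflect(2)[OF assms])

section \<open>Smooth bump functions\<close>

definition exp_inv_poly :: "real poly \<Rightarrow> real \<Rightarrow> real" where
  "exp_inv_poly p t = (if t > 0 then poly p (1 / t) * exp (- (1 / t)) else 0)"

lemma poly_times_exp_minus_tendsto_0: "((\<lambda>s. poly p s * exp (- s)) \<longlongrightarrow> (0::real)) at_top"
proof -
  have "((\<lambda>s. (\<Sum>i\<le>degree p. coeff p i * (s ^ i / exp s))) \<longlongrightarrow> (\<Sum>i\<le>degree p. coeff p i * 0)) at_top"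
    by (intro tendsto_sum tendsto_mult tendsto_const tendsto_power_div_exp_0)
  moreover have "poly p s * exp (- s) = (\<Sum>i\<le>degree p. coeff p i * (s ^ i / exp s))" for s
    unfolding poly_altdef sum_distrib_right by (intro sum.cong) (simp_all add: exp_minus field_simps)
  ultimately show ?thesis by simp
qed

text \<open>The functions p(1/t) exp(-1/t), extended by 0 to t \<le> 0, are closed under
  differentiation: with s = 1/t the derivative belongs to the polynomial s^2 (p - p'), and
  \<open>[:0, 0, 1:]\<close> is s^2. At 0 the exponential beats the polynomial.\<close>

lemma exp_inv_poly_has_derivative:
  "(exp_inv_poly p has_real_derivative exp_inv_poly ([:0, 0, 1:] * (p - pderiv p)) t) (at t)"
proof -
  consider "t > 0" | "t < 0" | "t = 0" by linarith
  then show ?thesis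
  proof cases
    case 1
    have i: "((\<lambda>t. 1 / t) has_real_derivative - (1 / t)\<^sup>2) (at t)"
      using 1 by (auto intro!: derivative_eq_intros simp: power2_eq_square)
    have "((\<lambda>t. exp (- (1 / t))) has_real_derivative exp (- (1 / t)) * (1 / t)\<^sup>2) (at t)"
      using DERIV_chain2[where f = exp, OF DERIV_exp DERIV_minus[OF i]] by simp
    from DERIV_mult[OF DERIV_chain2[where f = "poly p", OF poly_DERIV i] this]
    have "((\<lambda>t. poly p (1 / t) * exp (- (1 / t))) has_real_derivative
        exp_inv_poly ([:0, 0, 1:] * (p - pderiv p)) t) (at t)"
      by (rule DERIV_cong) (use 1 in \<open>simp add: exp_inv_poly_def power2_eq_square algebra_simps\<close>)
    then show ?thesis
      by (rule has_field_derivative_transform_within_open[where S = "{0<..}"])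
        (use 1 in \<open>auto simp: exp_inv_poly_def\<close>)
  next
    case 2
    have "((\<lambda>t. 0) has_real_derivative exp_inv_poly ([:0, 0, 1:] * (p - pderiv p)) t) (at t)"
      using 2 by (auto simp: exp_inv_poly_def)
    then show ?thesis
      by (rule has_field_derivative_transform_within_open[where S = "{..<0}"])
        (use 2 in \<open>auto simp: exp_inv_poly_def\<close>)
  next
    case 3
    have "((\<lambda>h. exp_inv_poly p h / h) \<longlongrightarrow> 0) (at 0)"
    proof (rule filterlim_split_at)
      have "\<forall>\<^sub>F h in at_left 0. exp_inv_poly p h / h = (0::real)"
        unfolding eventually_at_filter by (auto simp: exp_inv_poly_def)
      then show "((\<lambda>h. exp_inv_poly p h / h) \<longlongrightarrow> 0) (at_left 0)" by (rule tendsto_eventually)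
      have "((\<lambda>h. poly ([:0, 1:] * p) (inverse h) * exp (- inverse h)) \<longlongrightarrow> (0::real)) (at_right 0)"
        by (rule filterlim_compose[OF poly_times_exp_minus_tendsto_0 filterlim_inverse_at_top_right])
      moreover have "\<forall>\<^sub>F h in at_right 0. poly ([:0, 1:] * p) (inverse h) * exp (- inverse h) = exp_inv_poly p h / h"
        unfolding eventually_at_filter by (auto simp: exp_inv_poly_def divide_inverse)
      ultimately show "((\<lambda>h. exp_inv_poly p h / h) \<longlongrightarrow> 0) (at_right 0)"
        by (rule Lim_transform_eventually)
    qed
    then show ?thesis using 3 by (simp add: has_field_derivative_iff exp_inv_poly_def)
  qed
qed

text \<open>Inside the interval the bump is exp(-1/(\<delta> + t)) exp(-1/(\<delta> - t)). Its
  derivatives are sums of products of the same kind, recorded as lists \<open>ps\<close> of pairs of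
  polynomials; \<open>nxt\<close> is the product rule, with the sign of the inner derivative of
  \<delta> - t moved to the first polynomial.\<close>

lemma bump_1d:
  fixes \<delta> :: real
  assumes \<delta>: "\<delta> > 0"
  obtains D :: "nat \<Rightarrow> real \<Rightarrow> real" where
    "\<And>n t. (D n has_real_derivative D (Suc n) t) (at t)" "\<And>t. D 0 t \<ge> 0" "D 0 0 > 0"
    "\<And>t. \<bar>t\<bar> \<ge> \<delta> \<Longrightarrow> D 0 t = 0"
proof -
  define S where "S ps t = (\<Sum>(p, q)\<leftarrow>ps. exp_inv_poly p (\<delta> + t) * exp_inv_poly q (\<delta> - t))" for ps t
  define d :: "real poly \<Rightarrow> real poly" where "d p = [:0, 0, 1:] * (p - pderiv p)" for p
  define nxt where "nxt ps = concat (map (\<lambda>(p, q). [(d p, q), (- p, d q)]) ps)" for ps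
  have neg: "exp_inv_poly (- p) t = - exp_inv_poly p t" for p t by (simp add: exp_inv_poly_def)
  have step: "(S ps has_real_derivative S (nxt ps) t) (at t)" for ps t
  proof (induction ps)
    case Nil
    then show ?case by (simp add: S_def[abs_def] nxt_def)
  next
    case (Cons pq ps)
    obtain p q where pq: "pq = (p, q)" by (cases pq)
    have e: "S (pq # ps) = (\<lambda>t. exp_inv_poly p (\<delta> + t) * exp_inv_poly q (\<delta> - t) + S ps t)"
      by (simp add: S_def pq fun_eq_iff)
    have g: "((\<lambda>t. \<delta> + t) has_real_derivative 1) (at t)" "((\<lambda>t. \<delta> - t) has_real_derivative -1) (at t)"
      by (auto intro!: derivative_eq_intros)
    have 1: "((\<lambda>t. exp_inv_poly p (\<delta> + t)) has_real_derivative exp_inv_poly (d p) (\<delta> + t)) (at t)"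
      using DERIV_chain2[where f = "exp_inv_poly p", OF exp_inv_poly_has_derivative g(1)] by (simp add: d_def)
    have 2: "((\<lambda>t. exp_inv_poly q (\<delta> - t)) has_real_derivative - exp_inv_poly (d q) (\<delta> - t)) (at t)"
      using DERIV_chain2[where f = "exp_inv_poly q", OF exp_inv_poly_has_derivative g(2)] by (simp add: d_def)
    have "((\<lambda>t. exp_inv_poly p (\<delta> + t) * exp_inv_poly q (\<delta> - t) + S ps t) has_real_derivative
       (exp_inv_poly (d p) (\<delta> + t) * exp_inv_poly q (\<delta> - t) + - exp_inv_poly (d q) (\<delta> - t) * exp_inv_poly p (\<delta> + t)) + S (nxt ps) t) (at t)"
      by (intro DERIV_add DERIV_mult 1 2 Cons)
    moreover have "(exp_inv_poly (d p) (\<delta> + t) * exp_inv_poly q (\<delta> - t) + - exp_inv_poly (d q) (\<delta> - t) * exp_inv_poly p (\<delta> + t)) + S (nxt ps) t = S (nxt (pq # ps)) t"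
      by (simp add: S_def nxt_def pq neg)
    ultimately show ?case by (simp add: e)
  qed
  define D where "D n = S ((nxt ^^ n) [([:1:], [:1:])])" for n
  show ?thesis
  proof
    show "(D n has_real_derivative D (Suc n) t) (at t)" for n t using step by (simp add: D_def)
    have D0: "D 0 t = exp_inv_poly [:1:] (\<delta> + t) * exp_inv_poly [:1:] (\<delta> - t)" for t by (simp add: D_def S_def)
    show "D 0 t \<ge> 0" for t by (simp add: D0 exp_inv_poly_def)
    show "D 0 0 > 0" using \<delta> by (simp add: D0 exp_inv_poly_def)
    show "D 0 t = 0" if "\<bar>t\<bar> \<ge> \<delta>" for t using that by (auto simp: D0 exp_inv_poly_def)
  qed
qed

lemma prod_has_derivative_coordinates:
  fixes F :: "'n::finite \<Rightarrow> real \<Rightarrow> real"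
  assumes "\<And>i. (F i has_real_derivative F' i (x $ i)) (at (x $ i))"
  shows "((\<lambda>x. \<Prod>i\<in>UNIV. F i (x $ i)) has_derivative
    (\<lambda>h. \<Sum>i\<in>UNIV. F' i (x $ i) * h $ i * (\<Prod>j\<in>UNIV - {i}. F j (x $ j)))) (at (x :: real^'n))"
proof -
  have "((\<lambda>x. F i (x $ i)) has_derivative (\<lambda>h. F' i (x $ i) * h $ i)) (at x)" for i
    using has_derivative_compose[OF bounded_linear_imp_has_derivative[OF bounded_linear_vec_nth[of i]]
        assms[of i, unfolded has_field_derivative_def]]
    by simp
  then show ?thesis by (intro has_derivative_prod) auto
qed

text \<open>A product of one-dimensional bumps. Every iterated partial derivative is
  \<open>E k\<close> for some multi-index \<open>k\<close>, so differentiability of all the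
  \<open>E k\<close> gives smoothness.\<close>

lemma bump_exists:
  assumes "\<epsilon> > 0"
  obtains \<eta> :: "real^'n::finite \<Rightarrow> real" where "\<eta> \<in> test_R" "\<And>x. \<eta> x \<ge> 0"
    "\<And>x. norm x > \<epsilon> \<Longrightarrow> \<eta> x = 0" "\<eta> 0 > 0"
proof -
  \<comment> \<open>If no coordinate exceeds \<delta> in modulus, then the norm is at most
    \<epsilon>.\<close>
  define \<delta> where "\<delta> = \<epsilon> / real CARD('n)"
  have \<delta>: "\<delta> > 0" using assms by (simp add: \<delta>_def)
  from bump_1d[OF \<delta>] obtain D where D: "\<And>n t. (D n has_real_derivative D (Suc n) t) (at t)" 
    and D0: "\<And>t. D 0 t \<ge> 0" "D 0 0 > 0" "\<And>t. \<bar>t\<bar> \<ge> \<delta> \<Longrightarrow> D 0 t = 0" by blast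
  define E where "E k x = (\<Prod>i\<in>UNIV. D (k i) (x $ i))" for k :: "'n \<Rightarrow> nat" and x :: "real^'n"
  have der: "(E k has_derivative (\<lambda>h. \<Sum>i\<in>UNIV. D (Suc (k i)) (x $ i) * h $ i * (\<Prod>j\<in>UNIV - {i}. D (k j) (x $ j)))) (at x)" for k x
    unfolding E_def[abs_def] by (intro prod_has_derivative_coordinates) (rule D)
  have "\<exists>k. iter_deriv L (E (\<lambda>_. 0)) = E k" if "set L \<subseteq> Basis" for L
    using that
  proof (induction L)
    case (Cons v L)
    then obtain k where k: "iter_deriv L (E (\<lambda>_. 0)) = E k" by auto
    obtain i where v: "v = axis i 1" using Cons.prems by (auto simp: Basis_vec_def)
    have "iter_deriv (v # L) (E (\<lambda>_. 0)) x = E (k(i := Suc (k i))) x" for x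
    proof -
      have "frechet_derivative (E k) (at x) v
          = (\<Sum>j\<in>UNIV. D (Suc (k j)) (x $ j) * v $ j * (\<Prod>j\<in>UNIV - {j}. D (k j) (x $ j)))"
        using frechet_derivative_at[OF der[of k x]] by (simp add: fun_eq_iff)
      also have "\<dots> = (\<Sum>j\<in>UNIV. if j = i then D (Suc (k i)) (x $ i) * (\<Prod>j\<in>UNIV - {i}. D (k j) (x $ j)) else 0)"
        by (intro sum.cong) (auto simp: v axis_def)
      also have "\<dots> = D (Suc (k i)) (x $ i) * (\<Prod>j\<in>UNIV - {i}. D (k j) (x $ j))" by simp
      also have "\<dots> = E (k(i := Suc (k i))) x"
        unfolding E_def by (subst prod.remove[of UNIV i]) (auto intro!: prod.cong)
      finally show ?thesis using k by simp
    qed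
    then show ?case by blast
  qed auto
  then have smooth: "iter_deriv L (E (\<lambda>_. 0)) differentiable (at x)" if "set L \<subseteq> Basis" for L x
  proof -
    from that obtain k where "iter_deriv L (E (\<lambda>_. 0)) = E k"
      using \<open>\<And>L. set L \<subseteq> Basis \<Longrightarrow> \<exists>k. iter_deriv L (E (\<lambda>_. 0)) = E k\<close> by blast
    then show ?thesis using der[of k x] by (auto simp: differentiable_def)
  qed
  have z: "E (\<lambda>_. 0) x = 0" if "norm x > \<epsilon>" for x
  proof -
    have "norm x \<le> (\<Sum>i\<in>UNIV. \<bar>x $ i\<bar>)" by (rule norm_le_l1_cart)
    then have "(\<Sum>i\<in>UNIV. \<bar>x $ i\<bar>) > (\<Sum>i\<in>(UNIV::'n set). \<delta>)" using that by (simp add: \<delta>_def)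
    then obtain i where "\<bar>x $ i\<bar> > \<delta>" by (meson not_le sum_mono)
    then have "D 0 (x $ i) = 0" using D0(3)[of "x $ i"] by simp
    then show ?thesis by (auto simp: E_def)
  qed
  show ?thesis
  proof
    show "E (\<lambda>_. 0) \<in> test_R"
      by (rule test_R_cong[where K = "cball 0 \<epsilon>"]) (use smooth z in auto)
    show "E (\<lambda>_. 0) x \<ge> 0" for x using D0 by (auto simp: E_def intro: prod_nonneg)
    show "E (\<lambda>_. 0) 0 > 0" using D0 by (auto simp: E_def intro: prod_pos)
  qed (rule z)
qed

section \<open>Positivity of the Laplacian\<close>

definition bounded_compact_support :: "('a::euclidean_space \<Rightarrow> real) \<Rightarrow> bool" where
  "bounded_compact_support g \<longleftrightarrow> g \<in> borel_measurable borel \<and> (\<exists>B. \<forall>x. \<bar>g x\<bar> \<le> B) \<and>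
     (\<exists>K. compact K \<and> (\<forall>x. x \<notin> K \<longrightarrow> g x = 0))"

lemma bounded_compact_supportD:
  assumes "bounded_compact_support g"
  shows "g \<in> borel_measurable borel" "integrable lborel g" "g \<in> L2 lborel"
proof -
  obtain B K where *: "g \<in> borel_measurable borel" "\<And>x. \<bar>g x\<bar> \<le> B" "compact K" "\<And>x. x \<notin> K \<Longrightarrow> g x = 0"
    using assms unfolding bounded_compact_support_def by blast
  have K: "K \<in> lmeasurable" "K \<in> sets borel" using *(3) by (auto simp: lmeasurable_compact borel_compact)
  show "g \<in> borel_measurable borel" "integrable lborel g" "g \<in> L2 lborel"
    using * L2_bounded_support[OF *(1) K] by auto
qed

lemma bounded_compact_support_mult:
  assumes g: "bounded_compact_support g" and w: "w \<in> borel_measurable borel" "\<And>x. \<bar>w x\<bar> \<le> C"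
  shows "bounded_compact_support (\<lambda>x. g x * w x)"
proof -
  obtain B K where *: "g \<in> borel_measurable borel" "\<And>x. \<bar>g x\<bar> \<le> B" "compact K" "\<And>x. x \<notin> K \<Longrightarrow> g x = 0"
    using g unfolding bounded_compact_support_def by blast
  have "\<bar>g x * w x\<bar> \<le> B * C" for x
    unfolding abs_mult using *(2)[of x] w(2)[of x] abs_ge_zero[of "g x"] by (intro mult_mono) linarith+
  then show ?thesis using * w unfolding bounded_compact_support_def by (auto intro!: exI[of _ K])
qed

lemma bounded_compact_support_times:
  fixes g :: "'a::euclidean_space \<Rightarrow> real" and h :: "'b::euclidean_space \<Rightarrow> real"
  assumes g: "bounded_compact_support g" and h: "bounded_compact_support h"
  shows "bounded_compact_support (\<lambda>p. g (fst p) * h (snd p))"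
proof -
  obtain B K where g: "g \<in> borel_measurable borel" "\<And>x. \<bar>g x\<bar> \<le> B" "compact K" "\<And>x. x \<notin> K \<Longrightarrow> g x = 0"
    using g unfolding bounded_compact_support_def by blast
  obtain C L where h: "h \<in> borel_measurable borel" "\<And>x. \<bar>h x\<bar> \<le> C" "compact L" "\<And>x. x \<notin> L \<Longrightarrow> h x = 0"
    using h unfolding bounded_compact_support_def by blast
  note [measurable] = g(1) h(1)
  have "(\<lambda>p. g (fst p) * h (snd p)) \<in> borel_measurable (borel \<Otimes>\<^sub>M borel)" by measurable
  then have "(\<lambda>p. g (fst p) * h (snd p)) \<in> borel_measurable borel" by (simp add: borel_prod)
  moreover have "\<bar>g (fst p) * h (snd p)\<bar> \<le> B * C" for p
    unfolding abs_mult using g(2)[of "fst p"] h(2)[of "snd p"] abs_ge_zero[of "g (fst p)"] by (intro mult_mono) linarith+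
  moreover have "compact (K \<times> L)" "\<And>p. p \<notin> K \<times> L \<Longrightarrow> g (fst p) * h (snd p) = 0"
    using g(4) h(4) by (auto intro: compact_Times g h)
  ultimately show ?thesis unfolding bounded_compact_support_def by blast
qed

lemma test_R_bounded_compact_support: "f \<in> test_R \<Longrightarrow> bounded_compact_support f"
  unfolding bounded_compact_support_def
  by (metis (no_types, lifting) not_in_supp test_R_bounded test_R_measurable test_R_def mem_Collect_eq)

text \<open>The integral of a difference quotient vanishes by translation invariance. The mean value
  theorem bounds the quotients by \<open>B\<close>, and \<open>K'\<close> contains their supports,
  so dominated convergence applies.\<close>

lemma integral_directional_derivative_zero:
  fixes f :: "'a::euclidean_space \<Rightarrow> real"
  assumes der: "\<And>x t. ((\<lambda>t. f (x + t *\<^sub>R b)) has_real_derivative g (x + t *\<^sub>R b)) (at t)"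
    and f: "bounded_compact_support f" and g: "g \<in> borel_measurable borel" "\<And>x. \<bar>g x\<bar> \<le> B"
  shows "(\<integral>x. g x \<partial>lborel) = 0"
proof -
  note fD = bounded_compact_supportD[OF f]
  obtain K where K: "compact K" "\<And>x. x \<notin> K \<Longrightarrow> f x = 0"
    using f unfolding bounded_compact_support_def by blast
  define K' where "K' = {x + y |x y. x \<in> K \<and> y \<in> cball 0 (norm b)}"
  have K': "compact K'" unfolding K'_def by (intro compact_sums K) simp
  define h where "h n = inverse (real (Suc n))" for n
  have h: "h n > 0" "h n \<le> 1" for n by (auto simp: h_def field_simps)
  have h0: "h \<longlonglongrightarrow> 0" unfolding h_def by (rule LIMSEQ_inverse_real_of_nat)
  define q where "q n x = (f (x + h n *\<^sub>R b) - f x) / h n" for n x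
  have qm: "q n \<in> borel_measurable borel" for n
    unfolding q_def using fD(1) by measurable
  have qB: "\<bar>q n x\<bar> \<le> B" for n x
  proof -
    obtain z where "f (x + h n *\<^sub>R b) - f (x + 0 *\<^sub>R b) = (h n - 0) * g (x + z *\<^sub>R b)"
      using MVT2[where a = 0 and b = "h n" and f = "\<lambda>t. f (x + t *\<^sub>R b)" and f' = "\<lambda>t. g (x + t *\<^sub>R b)"] h(1) der by blast
    then have "q n x = g (x + z *\<^sub>R b)" using h(1)[of n] by (simp add: q_def)
    then show ?thesis using g(2) by simp
  qed
  have q0: "q n x = 0" if "x \<notin> K'" for n x
  proof -
    have hb: "norm (h n *\<^sub>R b) \<le> norm b" using h[of n] by (simp add: mult_left_le_one_le)
    have "x \<notin> K" using that by (auto simp: K'_def intro!: exI[of _ x] exI[of _ 0])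
    moreover have "x + h n *\<^sub>R b \<notin> K"
    proof
      assume "x + h n *\<^sub>R b \<in> K"
      moreover have "- (h n *\<^sub>R b) \<in> cball 0 (norm b)" using hb by simp
      ultimately have "(x + h n *\<^sub>R b) + - (h n *\<^sub>R b) \<in> K'" unfolding K'_def by blast
      then show False using that by simp
    qed
    ultimately show ?thesis using K(2) by (simp add: q_def)
  qed
  have lim: "(\<lambda>n. q n x) \<longlonglongrightarrow> g x" for x
  proof -
    have "((\<lambda>t. (f (x + t *\<^sub>R b) - f x) / t) \<longlongrightarrow> g x) (at 0)"
      using der[of x 0] by (simp add: has_field_derivative_iff)
    moreover have "filterlim h (at 0) sequentially"
      using h0 h(1) by (auto simp: filterlim_at intro!: always_eventually less_imp_neq[symmetric])
    ultimately show ?thesis unfolding q_def by (rule filterlim_compose)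
  qed
  have "(\<lambda>n. \<integral>x. q n x \<partial>lborel) \<longlonglongrightarrow> (\<integral>x. g x \<partial>lborel)"
  proof (rule integral_dominated_convergence[where w = "\<lambda>x. B * indicator K' x"])
    show "integrable lborel (\<lambda>x. B * indicator K' x)"
      using K' emeasure_compact_finite[OF K'] by (intro integrable_mult_right integrable_real_indicator) (auto simp: borel_compact)
    show "AE x in lborel. norm (q n x) \<le> B * indicator K' x" for n
      using qB q0 by (auto simp: indicator_def)
  qed (use lim g qm in auto)
  moreover have "(\<integral>x. q n x \<partial>lborel) = 0" for n
  proof -
    have i: "integrable lborel (\<lambda>x. f (x + h n *\<^sub>R b))" "(\<integral>x. f (x + h n *\<^sub>R b) \<partial>lborel) = (\<integral>x. f x \<partial>lborel)"
      using lborel_integral_affine[of 1 f "h n *\<^sub>R b"] fD by (auto simp: add.commute)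
    then show ?thesis unfolding q_def using fD by simp
  qed
  ultimately show ?thesis by (simp add: LIMSEQ_const_iff)
qed

section \<open>Convolutions and correlations of L2 functions\<close>

definition conv :: "('a::euclidean_space \<Rightarrow> real) \<Rightarrow> ('a \<Rightarrow> real) \<Rightarrow> 'a \<Rightarrow> real" where
  "conv g u x = (\<integral>s. g s * u (x - s) \<partial>lborel)"

lemma conv_commute:
  assumes [measurable]: "g \<in> borel_measurable borel" "u \<in> borel_measurable borel"
  shows "conv g u x = (\<integral>y. u y * g (x - y) \<partial>lborel)"
  using lborel_integral_affine(1)[of "-1" "\<lambda>s. g s * u (x - s)" x]
  by (simp add: conv_def mult.commute)

definition correlation :: "('a::euclidean_space \<Rightarrow> real) \<Rightarrow> ('a \<Rightarrow> real) \<Rightarrow> 'a \<Rightarrow> real" where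
  "correlation u v r = (\<integral>x. u (x - r) * v x \<partial>lborel)"

lemma correlation_measurable:
  assumes "u \<in> L2 lborel" "v \<in> L2 lborel"
  shows "correlation u v \<in> borel_measurable borel"
proof -
  have [measurable]: "u \<in> borel_measurable borel" "v \<in> borel_measurable borel"
    using assms by (auto simp: L2_def)
  show ?thesis unfolding correlation_def[abs_def] by measurable
qed

lemma correlation_bounded:
  assumes "u \<in> L2 lborel" "v \<in> L2 lborel"
  shows "\<bar>correlation u v r\<bar> \<le> L2_norm lborel u * L2_norm lborel v"
  using L2_Cauchy_Schwarz[OF L2_translate(1)[OF assms(1), of r] assms(2)] L2_translate(2)[OF assms(1), of r]
  by (simp add: correlation_def L2_inner_def)

lemma correlation_shift:
  assumes "u \<in> L2 lborel" "v \<in> L2 lborel"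
  shows "(\<integral>x. u (x - s) * v (x - t) \<partial>lborel) = correlation u v (s - t)"
proof -
  have [measurable]: "u \<in> borel_measurable borel" "v \<in> borel_measurable borel"
    using assms by (auto simp: L2_def)
  show ?thesis
    using lborel_integral_affine(1)[of 1 "\<lambda>x. u (x - s) * v (x - t)" t]
    by (simp add: correlation_def algebra_simps)
qed

lemma L2_abs: "f \<in> L2 M \<Longrightarrow> (\<lambda>x. \<bar>f x\<bar>) \<in> L2 M" "L2_norm M (\<lambda>x. \<bar>f x\<bar>) = L2_norm M f"
  by (auto simp: L2_def L2_norm_eq)

lemma integral_pair_product:
  fixes f :: "'a::euclidean_space \<Rightarrow> real" and g :: "'b::euclidean_space \<Rightarrow> real"
  assumes f: "integrable lborel f" and g: "integrable lborel g"
  shows "(\<integral>p. f (fst p) * g (snd p) \<partial>lborel) = (\<integral>x. f x \<partial>lborel) * (\<integral>y. g y \<partial>lborel)"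
proof -
  have [measurable]: "f \<in> borel_measurable borel" "g \<in> borel_measurable borel" using f g by auto
  have i: "integrable (lborel \<Otimes>\<^sub>M lborel) (\<lambda>(x, y). f x * g y)"
    by (rule lborel_pair.Fubini_integrable) (use f g in \<open>auto simp: abs_mult\<close>)
  have "(\<integral>p. f (fst p) * g (snd p) \<partial>lborel) = integral\<^sup>L (lborel \<Otimes>\<^sub>M lborel) (\<lambda>(x, y). f x * g y)"
    by (simp add: lborel_prod case_prod_unfold)
  also have "\<dots> = (\<integral>x. \<integral>y. f x * g y \<partial>lborel \<partial>lborel)"
    using lborel_pair.integral_fst[OF i] by simp
  finally show ?thesis by simp
qed

text \<open>Fubini: integrating over the base point first leaves the correlation at the difference
  of the two shifts. Derivatives then only ever fall on the kernels \<open>g\<close> and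
  \<open>h\<close>, while \<open>u\<close> and \<open>v\<close> stay merely square
  integrable.\<close>

lemma conv_inner:
  fixes g h u v :: "'a::euclidean_space \<Rightarrow> real"
  assumes g: "bounded_compact_support g" and h: "bounded_compact_support h"
    and u: "u \<in> L2 lborel" and v: "v \<in> L2 lborel"
  shows "L2_inner lborel (conv g u) (conv h v)
    = (\<integral>p. g (fst p) * h (snd p) * correlation u v (fst p - snd p) \<partial>lborel)"
proof -
  note [measurable] = bounded_compact_supportD(1)[OF g] bounded_compact_supportD(1)[OF h]
  have [measurable]: "u \<in> borel_measurable borel" "v \<in> borel_measurable borel"
    using u v by (auto simp: L2_def)
  define F where "F p x = (g (fst p) * u (x - fst p)) * (h (snd p) * v (x - snd p))" for p :: "'a \<times> 'a" and x :: 'a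
  define C where "C = L2_norm lborel u * L2_norm lborel v"
  have gh: "bounded_compact_support (\<lambda>p. g (fst p) * h (snd p))"
    by (rule bounded_compact_support_times[OF g h])
  have uv: "integrable lborel (\<lambda>x. u (x - s) * v (x - t))" for s t
    by (rule L2_mult_integrable[OF L2_translate(1)[OF u] L2_translate(1)[OF v]])
  have Fm: "(\<lambda>(p, x). F p x) \<in> borel_measurable ((borel \<Otimes>\<^sub>M borel) \<Otimes>\<^sub>M borel)"
    unfolding F_def by measurable
  have Fm': "(\<lambda>(p, x). F p x) \<in> borel_measurable (lborel \<Otimes>\<^sub>M lborel)"
    using Fm unfolding borel_prod by (simp add: borel_prod lborel_prod)
  have int: "integrable (lborel \<Otimes>\<^sub>M lborel) (\<lambda>(p, x). F p x)"
  proof (rule lborel_pair.Fubini_integrable[OF Fm'])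
    show "AE p in lborel. integrable lborel (\<lambda>x. case (p, x) of (p, x) \<Rightarrow> F p x)"
      using integrable_mult_right[OF uv] by (simp add: F_def mult_ac)
    have Fm2: "(\<lambda>p. \<integral>x. norm (F p x) \<partial>lborel) \<in> borel_measurable borel"
    proof (rule lborel.borel_measurable_lebesgue_integral)
      have "(\<lambda>(p, x). norm (F p x)) \<in> borel_measurable (borel \<Otimes>\<^sub>M borel)"
        using Fm unfolding borel_prod by (simp add: case_prod_unfold)
      then show "(\<lambda>(p, x). norm (F p x)) \<in> borel_measurable (borel \<Otimes>\<^sub>M lborel)"
        by (simp cong: measurable_cong_sets sets_pair_measure_cong)
    qed
    have le: "(\<integral>x. norm (F p x) \<partial>lborel) \<le> C * \<bar>g (fst p) * h (snd p)\<bar>" for p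
    proof -
      have eq: "(\<integral>x. norm (F p x) \<partial>lborel) = \<bar>g (fst p) * h (snd p)\<bar> * (\<integral>x. \<bar>u (x - fst p)\<bar> * \<bar>v (x - snd p)\<bar> \<partial>lborel)"
        by (simp add: F_def abs_mult mult_ac flip: integral_mult_right_zero)
      have "(\<integral>x. \<bar>u (x - fst p)\<bar> * \<bar>v (x - snd p)\<bar> \<partial>lborel) \<le> C"
        unfolding C_def
        using L2_Cauchy_Schwarz[OF L2_abs(1)[OF L2_translate(1)[OF u, of "fst p"]] L2_abs(1)[OF L2_translate(1)[OF v, of "snd p"]]]
        by (simp add: L2_inner_def L2_abs(2) L2_translate(2) u v)
      then show ?thesis unfolding eq by (simp add: mult.commute[of C] mult_left_mono)
    qed
    have le2: "norm (\<integral>x. norm (F p x) \<partial>lborel) \<le> norm (C * \<bar>g (fst p) * h (snd p)\<bar>)" for p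
      using order_trans[OF le[of p] abs_ge_self] by simp
    have "integrable lborel (\<lambda>p. C * \<bar>g (fst p) * h (snd p)\<bar>)"
      using bounded_compact_supportD(2)[OF gh] by (intro integrable_mult_right integrable_abs)
    then have "integrable lborel (\<lambda>p. \<integral>x. norm (F p x) \<partial>lborel)"
      by (rule Bochner_Integration.integrable_bound)
        (use Fm2 le2 in \<open>simp_all\<close>)
    then show "integrable lborel (\<lambda>p. \<integral>x. norm (case (p, x) of (p, x) \<Rightarrow> F p x) \<partial>lborel)" by simp
  qed
  have refl_u: "(\<lambda>s. u (x - s)) \<in> L2 lborel" and refl_v: "(\<lambda>s. v (x - s)) \<in> L2 lborel" for x
    using u v lborel_integral_affine(2)[of "-1" "\<lambda>y. (u y)\<^sup>2"] lborel_integral_affine(2)[of "-1" "\<lambda>y. (v y)\<^sup>2"]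
    by (auto simp: L2_def)
  have "L2_inner lborel (conv g u) (conv h v) = (\<integral>x. (\<integral>p. F p x \<partial>lborel) \<partial>lborel)"
    unfolding L2_inner_def F_def conv_def
    by (intro Bochner_Integration.integral_cong refl integral_pair_product[symmetric] L2_mult_integrable
        bounded_compact_supportD(3)[OF g] bounded_compact_supportD(3)[OF h] refl_u refl_v)
  also have "\<dots> = (\<integral>p. (\<integral>x. F p x \<partial>lborel) \<partial>lborel)"
    by (rule lborel_pair.Fubini_integral[OF int])
  also have "\<dots> = (\<integral>p. g (fst p) * h (snd p) * correlation u v (fst p - snd p) \<partial>lborel)"
    by (simp add: F_def mult_ac correlation_shift[OF u v, symmetric] flip: integral_mult_right_zero)
  finally show ?thesis .
qed

lemma test_R_laplace: "f \<in> test_R \<Longrightarrow> bounded_compact_support (laplace_test f)"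
proof -
  assume f: "f \<in> test_R"
  have b: "bounded_compact_support (iter_deriv [b, b] f)" if "b \<in> Basis" for b
    by (intro test_R_bounded_compact_support test_R_iter_deriv f) (use that in auto)
  have "bounded_compact_support (\<lambda>x. - (\<Sum>b\<in>S. iter_deriv [b, b] f x))" if "S \<subseteq> Basis" for S
  proof -
    have "finite S" using that finite_Basis finite_subset by blast
    then have "(\<lambda>x. \<Sum>b\<in>S. iter_deriv [b, b] f x) \<in> test_R"
      using that
    proof (induction S)
      case empty
      have "(\<lambda>x. 0 * f x + 0 * f x) \<in> test_R" by (rule test_R_lincomb[OF f f])
      then show ?case by simp
    next
      case (insert b S)
      then show ?case
        using test_R_lincomb[OF test_R_iter_deriv[OF f, of "[b, b]"], of "\<lambda>x. \<Sum>b\<in>S. iter_deriv [b, b] f x" 1 1]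
        by simp
    qed
    then show ?thesis
      using bounded_compact_support_mult[OF test_R_bounded_compact_support, of _ "\<lambda>_. -1" 1] by simp
  qed
  then show ?thesis unfolding laplace_test_def[abs_def] by blast
qed

text \<open>The weak equation is tested against \<open>\<lambda>y. \<eta> (x - y)\<close>. The
  Laplacian has even order, so the reflection leaves no sign.\<close>

lemma conv_laplace:
  assumes \<eta>: "\<eta> \<in> test_R" and g: "laplace_graph u v"
  shows "conv \<eta> v x = conv (laplace_test \<eta>) u x"
proof -
  have uv: "u \<in> borel_measurable borel" "v \<in> borel_measurable borel"
    using g by (auto simp: laplace_graph_def L2_def)
  have "conv \<eta> v x = L2_inner lborel v (\<lambda>y. \<eta> (x - y))"
    unfolding conv_commute[OF test_R_measurable[OF \<eta>] uv(2)] by (simp add: L2_inner_def)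
  also have "\<dots> = L2_inner lborel u (laplace_test (\<lambda>y. \<eta> (x - y)))"
    using g test_R_reflect[OF \<eta>, of x] by (simp add: laplace_graph_def)
  also have "laplace_test (\<lambda>y. \<eta> (x - y)) = (\<lambda>y. laplace_test \<eta> (x - y))"
    unfolding laplace_test_def[abs_def] by (intro ext arg_cong[where f = uminus] sum.cong refl)
      (simp add: iter_deriv_reflect(1)[OF \<eta>, of "[b, b]" for b] del: iter_deriv.simps)
  also have "L2_inner lborel u (\<lambda>y. laplace_test \<eta> (x - y)) = conv (laplace_test \<eta>) u x"
    unfolding conv_commute[OF bounded_compact_supportD(1)[OF test_R_laplace[OF \<eta>]] uv(1)] by (simp add: L2_inner_def)
  finally show ?thesis .
qed

text \<open>The correlation only depends on \<open>s - t\<close>, so it is constant in the direction \<open>(b, b)\<close> in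
  which the integration by parts takes place.\<close>

lemma integral_by_parts_diagonal:
  fixes \<eta> \<xi> :: "real^'n \<Rightarrow> real"
  assumes \<eta>: "\<eta> \<in> test_R" and \<xi>: "\<xi> \<in> test_R" and b: "b \<in> Basis"
    and P: "P \<in> borel_measurable borel" "\<And>r. \<bar>P r\<bar> \<le> C"
  shows "(\<integral>p. \<eta> (fst p) * iter_deriv [b] \<xi> (snd p) * P (fst p - snd p) \<partial>lborel)
    = - (\<integral>p. iter_deriv [b] \<eta> (fst p) * \<xi> (snd p) * P (fst p - snd p) \<partial>lborel)"
proof -
  have d: "iter_deriv [b] \<eta> \<in> test_R" "iter_deriv [b] \<xi> \<in> test_R"
    using b by (auto intro!: test_R_iter_deriv \<eta> \<xi> simp del: iter_deriv.simps)
  have Pm: "(\<lambda>p. P (fst p - snd p)) \<in> borel_measurable borel"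
    using P(1) by (intro measurable_compose[OF _ P(1)]) (auto intro!: borel_measurable_continuous_onI continuous_intros)
  have bc: "bounded_compact_support (\<lambda>p. \<phi> (fst p) * \<psi> (snd p) * P (fst p - snd p))"
    if "\<phi> \<in> test_R" "\<psi> \<in> test_R" for \<phi> \<psi> :: "real^'n \<Rightarrow> real"
    by (rule bounded_compact_support_mult[OF bounded_compact_support_times[OF that[THEN test_R_bounded_compact_support]] Pm P(2)])
  let ?A = "\<lambda>p. \<eta> (fst p) * iter_deriv [b] \<xi> (snd p) * P (fst p - snd p)"
  let ?B = "\<lambda>p. iter_deriv [b] \<eta> (fst p) * \<xi> (snd p) * P (fst p - snd p)"
  note A = bc[OF \<eta> d(2)] and B = bc[OF d(1) \<xi>]
  obtain a1 a2 where a: "\<And>p. \<bar>?A p\<bar> \<le> a1" "\<And>p. \<bar>?B p\<bar> \<le> a2"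
    using A B unfolding bounded_compact_support_def by blast
  have "(\<integral>p. ?B p + ?A p \<partial>lborel) = 0"
  proof (rule integral_directional_derivative_zero[where b = "(b, b)", OF _ bc[OF \<eta> \<xi>]])
    show "(\<lambda>p. ?B p + ?A p) \<in> borel_measurable borel"
      using bounded_compact_supportD(1)[OF A] bounded_compact_supportD(1)[OF B] by measurable
    show "\<bar>?B p + ?A p\<bar> \<le> a2 + a1" for p using a[of p] by linarith
    fix p :: "(real^'n) \<times> (real^'n)" and t
    obtain x y where p: "p = (x, y)" by (cases p)
    show "((\<lambda>t. \<eta> (fst (p + t *\<^sub>R (b, b))) * \<xi> (snd (p + t *\<^sub>R (b, b))) * P (fst (p + t *\<^sub>R (b, b)) - snd (p + t *\<^sub>R (b, b))))
      has_real_derivative (?B (p + t *\<^sub>R (b, b)) + ?A (p + t *\<^sub>R (b, b)))) (at t)"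
      unfolding p
      using DERIV_cmult_right[OF DERIV_mult[OF test_R_directional[OF \<eta> b, of x t] test_R_directional[OF \<xi> b, of y t]], of "P (x - y)"]
      by (simp add: algebra_simps del: iter_deriv.simps)
  qed
  then show ?thesis
    using bounded_compact_supportD(2)[OF A] bounded_compact_supportD(2)[OF B] by simp
qed

text \<open>Integration by parts turns the pairing into the Dirichlet form of
  \<open>conv \<eta> u\<close>: a sum of squared norms of convolutions with the partial derivatives
  of \<open>\<eta>\<close>.\<close>

lemma mollified_laplace_nonneg:
  fixes u :: "real^'n \<Rightarrow> real"
  assumes \<eta>: "\<eta> \<in> test_R" and u: "u \<in> L2 lborel"
  shows "L2_inner lborel (conv \<eta> u) (conv (laplace_test \<eta>) u) \<ge> 0"
proof -
  let ?P = "correlation u u"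
  note P = correlation_measurable[OF u u] correlation_bounded[OF u u]
  have Pm: "(\<lambda>p. ?P (fst p - snd p)) \<in> borel_measurable borel"
    by (intro measurable_compose[OF _ P(1)]) (auto intro!: borel_measurable_continuous_onI continuous_intros)
  have d: "iter_deriv [b] \<eta> \<in> test_R" "iter_deriv [b, b] \<eta> \<in> test_R" if "b \<in> Basis" for b
    using that by (auto intro!: test_R_iter_deriv \<eta> simp del: iter_deriv.simps)
  have i: "integrable lborel (\<lambda>p. \<eta> (fst p) * iter_deriv [b, b] \<eta> (snd p) * ?P (fst p - snd p))" if "b \<in> Basis" for b
    by (rule bounded_compact_supportD(2)[OF bounded_compact_support_mult[OF bounded_compact_support_times Pm P(2)]])
      (auto intro!: test_R_bounded_compact_support \<eta> d that simp del: iter_deriv.simps)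
  have "L2_inner lborel (conv \<eta> u) (conv (laplace_test \<eta>) u)
      = (\<integral>p. \<eta> (fst p) * laplace_test \<eta> (snd p) * ?P (fst p - snd p) \<partial>lborel)"
    by (rule conv_inner[OF test_R_bounded_compact_support[OF \<eta>] test_R_laplace[OF \<eta>] u u])
  also have "\<dots> = (\<integral>p. - (\<Sum>b\<in>Basis. \<eta> (fst p) * iter_deriv [b, b] \<eta> (snd p) * ?P (fst p - snd p)) \<partial>lborel)"
    by (simp add: laplace_test_def sum_distrib_left sum_distrib_right del: iter_deriv.simps)
  also have "\<dots> = - (\<Sum>b\<in>Basis. \<integral>p. \<eta> (fst p) * iter_deriv [b, b] \<eta> (snd p) * ?P (fst p - snd p) \<partial>lborel)"
    using i by (simp del: iter_deriv.simps)
  also have "\<dots> = (\<Sum>b\<in>Basis. L2_inner lborel (conv (iter_deriv [b] \<eta>) u) (conv (iter_deriv [b] \<eta>) u))"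
    unfolding sum_negf[symmetric]
  proof (rule sum.cong[OF refl])
    fix b :: "real^'n" assume b: "b \<in> Basis"
    have "iter_deriv [b, b] \<eta> = iter_deriv [b] (iter_deriv [b] \<eta>)" by simp
    then show "- (\<integral>p. \<eta> (fst p) * iter_deriv [b, b] \<eta> (snd p) * ?P (fst p - snd p) \<partial>lborel)
      = L2_inner lborel (conv (iter_deriv [b] \<eta>) u) (conv (iter_deriv [b] \<eta>) u)"
      using integral_by_parts_diagonal[OF \<eta> d(1)[OF b] b P]
        conv_inner[OF test_R_bounded_compact_support[OF d(1)[OF b]] test_R_bounded_compact_support[OF d(1)[OF b]] u u]
      by (simp del: iter_deriv.simps)
  qed
  also have "\<dots> \<ge> 0" by (intro sum_nonneg L2_inner_self_nonneg)
  finally show ?thesis .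
qed

lemma mollifier_exists:
  assumes "\<epsilon> > 0"
  obtains \<eta> :: "real^'n::finite \<Rightarrow> real" where "\<eta> \<in> test_R" "\<And>x. \<eta> x \<ge> 0"
    "\<And>x. norm x > \<epsilon> \<Longrightarrow> \<eta> x = 0" "(\<integral>x. \<eta> x \<partial>lborel) = 1"
proof -
  obtain \<eta> :: "real^'n \<Rightarrow> real" where \<eta>: "\<eta> \<in> test_R" "\<And>x. \<eta> x \<ge> 0" "\<And>x. norm x > \<epsilon> \<Longrightarrow> \<eta> x = 0" "\<eta> 0 > 0"
    using bump_exists[OF assms] by blast
  define I where "I = (\<integral>x. \<eta> x \<partial>lborel)"
  have i: "integrable lborel \<eta>" using \<eta>(1) test_R_bounded_compact_support bounded_compact_supportD by blast
  have "I \<noteq> 0"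
  proof
    assume "I = 0"
    then have "AE x in lborel. \<eta> x = 0"
      using integral_nonneg_eq_0_iff_AE[OF i] \<eta>(2) by (simp add: I_def)
    moreover have "open {x. \<eta> x \<noteq> 0}"
      using open_Collect_neq[OF test_R_continuous[OF \<eta>(1)], of "\<lambda>_. 0"] by simp
    ultimately obtain r where r: "r > 0" "ball 0 r \<subseteq> {x. \<eta> x \<noteq> 0}"
      using \<eta>(4) by (metis (mono_tags, lifting) less_irrefl mem_Collect_eq open_contains_ball)
    have "{x. \<eta> x \<noteq> 0} \<in> null_sets lborel"
      using \<open>AE x in lborel. \<eta> x = 0\<close> test_R_measurable[OF \<eta>(1)] by (subst (asm) AE_iff_null) auto
    then have "{x. \<eta> x \<noteq> 0} \<in> null_sets lebesgue" by (rule null_sets_completionI)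
    then have "negligible (ball (0::real^'n) r)"
      using r(2) by (meson negligible_iff_null_sets negligible_subset)
    then show False using r(1) by (simp add: negligible_convex_interior)
  qed
  then have "I > 0" using \<eta>(2) by (simp add: I_def order_less_le)
  have "(\<lambda>x. inverse I * \<eta> x) \<in> test_R" using test_R_lincomb[OF \<eta>(1) \<eta>(1), of "inverse I" 0] by simp
  moreover have "(\<integral>x. inverse I * \<eta> x \<partial>lborel) = 1" using \<open>I \<noteq> 0\<close> by (simp flip: I_def)
  ultimately show ?thesis using \<eta> \<open>I > 0\<close> by (intro that[of "\<lambda>x. inverse I * \<eta> x"]) auto
qed

text \<open>The mollified pairing is nonnegative and equals an average of
  \<open>correlation u v\<close> over arguments near 0. There the correlation is close to its value
  at 0, which is \<open>L2_inner lborel u v\<close>, because translations are continuous in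
  L2.\<close>

lemma laplace_graph_nonneg:
  fixes u :: "real^'n \<Rightarrow> real"
  assumes g: "laplace_graph u v"
  shows "L2_inner lborel u v \<ge> 0"
proof -
  have u: "u \<in> L2 lborel" and v: "v \<in> L2 lborel" using g by (auto simp: laplace_graph_def)
  have "- e \<le> L2_inner lborel u v" if e: "e > 0" for e
  proof -
    let ?P = "correlation u v" and ?c = "L2_inner lborel u v"
    note P = correlation_measurable[OF u v] correlation_bounded[OF u v]
    define e' where "e' = e / (L2_norm lborel v + 1)"
    have v1: "L2_norm lborel v + 1 > 0" using L2_norm_nonneg[of lborel v] by linarith
    have e': "e' > 0" using e v1 by (simp add: e'_def)
    from L2_translation_continuous[OF u e'] obtain d where d: "d > 0"
      and dd: "\<And>r. norm r < d \<Longrightarrow> L2_norm lborel (\<lambda>x. u (x - r) - u x) < e'" by blast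
    have close: "?P r \<le> ?c + e" if "norm r < d" for r
    proof -
      have du: "(\<lambda>x. u (x - r) - u x) \<in> L2 lborel" by (intro L2_diff L2_translate u)
      have "?P r - ?c = L2_inner lborel (\<lambda>x. u (x - r) - u x) v"
        using L2_inner_lincomb_right[OF L2_translate(1)[OF u, of r] u v, of 1 "-1"]
        by (simp add: correlation_def L2_inner_def mult.commute)
      also have "\<dots> \<le> L2_norm lborel (\<lambda>x. u (x - r) - u x) * L2_norm lborel v"
        using L2_Cauchy_Schwarz[OF du v] by linarith
      also have "\<dots> \<le> e' * (L2_norm lborel v + 1)"
        using dd[OF that] e' by (intro mult_mono) (auto simp: L2_norm_nonneg)
      also have "\<dots> = e" using v1 by (simp add: e'_def)
      finally show ?thesis by simp
    qed
    \<comment> \<open>Two points of norm at most \<open>d / 3\<close> differ by less than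
      \<open>d\<close>, which is the range covered by \<open>close\<close>.\<close>
    obtain \<eta> :: "real^'n \<Rightarrow> real" where \<eta>: "\<eta> \<in> test_R" "\<And>x. \<eta> x \<ge> 0"
      "\<And>x. norm x > d / 3 \<Longrightarrow> \<eta> x = 0" "(\<integral>x. \<eta> x \<partial>lborel) = 1"
      using mollifier_exists[of "d / 3"] d by auto
    note bc = test_R_bounded_compact_support[OF \<eta>(1)]
    have Pm: "(\<lambda>p. ?P (fst p - snd p)) \<in> borel_measurable borel"
      by (intro measurable_compose[OF _ P(1)]) (auto intro!: borel_measurable_continuous_onI continuous_intros)
    have "0 \<le> L2_inner lborel (conv \<eta> u) (conv \<eta> v)"
      using mollified_laplace_nonneg[OF \<eta>(1) u] conv_laplace[OF \<eta>(1) g] by (simp add: L2_inner_def)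
    also have "\<dots> = (\<integral>p. \<eta> (fst p) * \<eta> (snd p) * ?P (fst p - snd p) \<partial>lborel)"
      by (rule conv_inner[OF bc bc u v])
    also have "\<dots> \<le> (\<integral>p. (\<eta> (fst p) * \<eta> (snd p)) * (?c + e) \<partial>lborel)"
    proof (rule integral_mono)
      show "integrable lborel (\<lambda>p. \<eta> (fst p) * \<eta> (snd p) * ?P (fst p - snd p))"
        by (rule bounded_compact_supportD(2)[OF bounded_compact_support_mult[OF bounded_compact_support_times[OF bc bc] Pm P(2)]])
      show "integrable lborel (\<lambda>p. (\<eta> (fst p) * \<eta> (snd p)) * (?c + e))"
        by (intro integrable_mult_left bounded_compact_supportD(2)[OF bounded_compact_support_times[OF bc bc]])
      fix p :: "(real^'n) \<times> (real^'n)"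
      show "\<eta> (fst p) * \<eta> (snd p) * ?P (fst p - snd p) \<le> (\<eta> (fst p) * \<eta> (snd p)) * (?c + e)"
      proof (cases "norm (fst p) > d / 3 \<or> norm (snd p) > d / 3")
        case False
        then have "norm (fst p - snd p) < d" using d norm_triangle_ineq4[of "fst p" "snd p"] by linarith
        then show ?thesis by (intro mult_left_mono close mult_nonneg_nonneg \<eta>(2))
      qed (use \<eta>(3) in auto)
    qed
    also have "\<dots> = ?c + e"
      using integral_pair_product[OF bounded_compact_supportD(2)[OF bc] bounded_compact_supportD(2)[OF bc]] \<eta>(4) by simp
    finally show ?thesis by simp
  qed
  then show ?thesis by (metis add.inverse_inverse field_le_epsilon add_0 diff_ge_0_iff_ge neg_le_iff_le le_add_same_cancel1 minus_le_iff neg_0_le_iff_le)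
qed

text \<open>Pairing the equation with \<open>u\<close> gives m^2 |u|^2 \<le> \<langle>h, u\<rangle>
  \<le> |h| |u|, hence |u| \<le> |h| / m^2.\<close>

lemma laplace_resolvent_bound:
  fixes u :: "real^'n \<Rightarrow> real"
  assumes m: "m > 0" and g: "laplace_graph u v" and h: "h \<in> L2 lborel"
    and eq: "AE x in lborel. v x + m\<^sup>2 * u x = h x"
  shows "L2_inner lborel h u \<le> (L2_norm lborel h)\<^sup>2 / m\<^sup>2"
proof -
  have u: "u \<in> L2 lborel" and v: "v \<in> L2 lborel" using g by (auto simp: laplace_graph_def)
  define n where "n = L2_norm lborel u"
  define N where "N = L2_norm lborel h"
  have n: "n \<ge> 0" "N \<ge> 0" by (simp_all add: n_def N_def L2_norm_nonneg)
  have "L2_inner lborel h u = (\<integral>x. (v x + m\<^sup>2 * u x) * u x \<partial>lborel)"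
    unfolding L2_inner_def using eq u v h by (intro integral_cong_AE) (auto simp: L2_def)
  also have "\<dots> = L2_inner lborel u (\<lambda>x. 1 * v x + m\<^sup>2 * u x)"
    by (simp add: L2_inner_def mult.commute)
  also have "\<dots> = L2_inner lborel u v + m\<^sup>2 * n\<^sup>2"
    by (subst L2_inner_lincomb_right[OF v u u]) (simp add: n_def L2_norm_sq)
  finally have "m\<^sup>2 * n\<^sup>2 \<le> L2_inner lborel h u" using laplace_graph_nonneg[OF g] by simp
  moreover have le: "L2_inner lborel h u \<le> N * n"
    using L2_Cauchy_Schwarz[OF h u] by (simp add: n_def N_def)
  ultimately have "m\<^sup>2 * n * n \<le> N * n" by (simp add: power2_eq_square)
  then have "m\<^sup>2 * n \<le> N" using n by (cases "n = 0") (auto simp: order_less_le)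
  then have "n \<le> N / m\<^sup>2" using m by (simp add: pos_le_divide_eq mult.commute)
  then have "N * n \<le> N * (N / m\<^sup>2)" using n by (intro mult_left_mono)
  then show ?thesis using le by (simp add: N_def power2_eq_square)
qed

section \<open>The Riemannian measure in the stereographic chart\<close>

text \<open>The reciprocal \<open>1 - x\<^sub>d\<close> of the conformal factor of the stereographic projection, in the chart.\<close>

definition conf :: "real^'n::finite \<Rightarrow> real" where
  "conf y = 2 / (1 + (norm y)\<^sup>2)"

lemma conf_pos: "conf y > 0"
  by (simp add: conf_def add_pos_nonneg)

lemma stereo_inv_conf: "stereo_inv y = (conf y *\<^sub>R y, 1 - conf y)"
proof -
  have "1 + (norm y)\<^sup>2 \<noteq> 0" by (smt (verit) zero_le_power2)
  then show ?thesis by (simp add: stereo_inv_def conf_def field_simps)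
qed

lemma conf_has_derivative:
  "(conf has_derivative (\<lambda>h. - (conf y)\<^sup>2 * (y \<bullet> h))) (at y)"
proof -
  have c: "1 + y \<bullet> y \<noteq> 0" by (smt (verit) inner_ge_zero)
  have e: "conf = (\<lambda>y. 2 * inverse (1 + y \<bullet> y))"
    by (simp add: conf_def fun_eq_iff power2_norm_eq_inner divide_inverse)
  have "((\<lambda>y. 2 * inverse (1 + y \<bullet> y)) has_derivative
      (\<lambda>h. 2 * - (inverse (1 + y \<bullet> y) * (0 + (y \<bullet> h + h \<bullet> y)) * inverse (1 + y \<bullet> y)))) (at y)"
    by (intro has_derivative_mult_right Deriv.has_derivative_inverse c has_derivative_add has_derivative_const
        has_derivative_inner has_derivative_ident)
  moreover have eq: "2 * - (inverse (1 + y \<bullet> y) * (0 + (y \<bullet> h + h \<bullet> y)) * inverse (1 + y \<bullet> y))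
      = - (conf y)\<^sup>2 * (y \<bullet> h)" for h
    by (simp add: e inner_commute[of h y] power2_eq_square)
  ultimately show ?thesis by (simp only: eq e[symmetric])
qed

lemma stereo_inv_has_derivative:
  "(stereo_inv has_derivative
     (\<lambda>h. (conf y *\<^sub>R h - ((conf y)\<^sup>2 * (y \<bullet> h)) *\<^sub>R y, (conf y)\<^sup>2 * (y \<bullet> h)))) (at y)"
proof -
  have "((\<lambda>y. (conf y *\<^sub>R y, 1 - conf y)) has_derivative
     (\<lambda>h. (conf y *\<^sub>R h + (- (conf y)\<^sup>2 * (y \<bullet> h)) *\<^sub>R y, 0 - (- (conf y)\<^sup>2 * (y \<bullet> h))))) (at y)"
    by (intro has_derivative_Pair has_derivative_scaleR has_derivative_diff has_derivative_const
        has_derivative_ident conf_has_derivative)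
  then show ?thesis unfolding stereo_inv_conf[abs_def] by simp
qed

text \<open>Conformality of the stereographic chart. The terms besides
  \<open>(conf y)\<^sup>2 * (h \<bullet> k)\<close> carry the factor
  \<open>conf y * (1 + y \<bullet> y) - 2\<close>, which is 0.\<close>

lemma sphere_gram_eq: "sphere_gram y = (\<chi> i j. if i = j then (conf y)\<^sup>2 else 0)"
proof -
  have fd: "frechet_derivative stereo_inv (at y) =
      (\<lambda>h. (conf y *\<^sub>R h - ((conf y)\<^sup>2 * (y \<bullet> h)) *\<^sub>R y, (conf y)\<^sup>2 * (y \<bullet> h)))"
    by (rule frechet_derivative_at[OF stereo_inv_has_derivative, symmetric])
  have c: "conf y * (1 + y \<bullet> y) = 2"
  proof -
    have "1 + y \<bullet> y \<noteq> 0" by (smt (verit) inner_ge_zero)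
    then show ?thesis unfolding conf_def power2_norm_eq_inner times_divide_eq_left
      by (rule nonzero_mult_div_cancel_right)
  qed
  have "(conf y *\<^sub>R h - ((conf y)\<^sup>2 * (y \<bullet> h)) *\<^sub>R y, (conf y)\<^sup>2 * (y \<bullet> h)) \<bullet>
      (conf y *\<^sub>R k - ((conf y)\<^sup>2 * (y \<bullet> k)) *\<^sub>R y, (conf y)\<^sup>2 * (y \<bullet> k)) = (conf y)\<^sup>2 * (h \<bullet> k)" for h k
  proof -
    have "(conf y *\<^sub>R h - ((conf y)\<^sup>2 * (y \<bullet> h)) *\<^sub>R y, (conf y)\<^sup>2 * (y \<bullet> h)) \<bullet>
      (conf y *\<^sub>R k - ((conf y)\<^sup>2 * (y \<bullet> k)) *\<^sub>R y, (conf y)\<^sup>2 * (y \<bullet> k))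
      = (conf y)\<^sup>2 * (h \<bullet> k) + (conf y) ^ 3 * (y \<bullet> h) * (y \<bullet> k) * (conf y * (1 + y \<bullet> y) - 2)"
      by (simp add: inner_diff_left inner_diff_right inner_commute[of h y] inner_commute[of k y] power2_eq_square power3_eq_cube algebra_simps)
    then show ?thesis by (simp add: c)
  qed
  then show ?thesis
    unfolding sphere_gram_def fd by (simp add: vec_eq_iff inner_axis_axis)
qed

lemma sqrt_det_sphere_gram: "sqrt (det (sphere_gram y)) = conf y ^ CARD('n)" for y :: "real^'n::finite"
proof -
  have "det (sphere_gram y) = (\<Prod>i\<in>(UNIV::'n set). (conf y)\<^sup>2)"
    unfolding sphere_gram_eq by (subst det_diagonal) auto
  also have "\<dots> = ((conf y)\<^sup>2) ^ CARD('n)" by simp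
  also have "\<dots> = (conf y ^ CARD('n))\<^sup>2" by (metis power_mult mult.commute)
  finally show ?thesis using conf_pos[of y] by (simp add: less_imp_le)
qed

lemma measurable_stereo_inv [measurable]: "stereo_inv \<in> borel_measurable borel"
  by (intro borel_measurable_continuous_onI continuous_at_imp_continuous_on ballI
      has_derivative_continuous[OF stereo_inv_has_derivative])

lemma measurable_conf [measurable]: "conf \<in> borel_measurable borel"
  unfolding conf_def[abs_def] by measurable

lemma sphere_measure_eq:
  "sphere_measure = distr (density lborel (\<lambda>y::real^'n. ennreal (conf y ^ CARD('n)))) borel (stereo_inv :: _ \<Rightarrow> 'n::finite amb)"
  by (simp add: sphere_measure_def sqrt_det_sphere_gram)

lemma sets_sphere_measure [measurable_cong, simp]: "sets sphere_measure = sets borel"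
  and space_sphere_measure [simp]: "space sphere_measure = UNIV"
  by (simp_all add: sphere_measure_def)

lemma borel_measurable_sphere [simp]: "borel_measurable sphere_measure = borel_measurable borel"
  by (rule measurable_cong_sets) simp_all

lemma sphere_integral:
  fixes F :: "'n::finite amb \<Rightarrow> real"
  assumes [measurable]: "F \<in> borel_measurable borel"
  shows "(\<integral>x. F x \<partial>sphere_measure) = (\<integral>y. conf y ^ CARD('n) * F (stereo_inv y) \<partial>lborel)"
    and "integrable sphere_measure F \<longleftrightarrow> integrable lborel (\<lambda>y. conf y ^ CARD('n) * F (stereo_inv y))"
  unfolding sphere_measure_eq
  by (subst integral_distr integrable_distr_eq; (subst integral_density integrable_density)?;
      simp add: conf_pos less_imp_le)+

text \<open>The squared norm of \<open>y\<close> dominates the square of every coordinate, so the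
  integrand is at most a constant times a product of Cauchy densities. This makes the measure of the
  sphere finite.\<close>

lemma integrable_conf: "integrable lborel (\<lambda>y::real^'n::finite. conf y ^ CARD('n))"
proof (rule Bochner_Integration.integrable_bound)
  have "integrable lborel (\<lambda>x. inverse (1 + x\<^sup>2) :: real)"
    using integrable_inverse_1_plus_square by (simp add: set_integrable_def)
  then have "integrable lborel (\<lambda>x::real^'n. \<Prod>i\<in>UNIV. inverse (1 + (x $ i)\<^sup>2))"
    by (intro integrable_prod_coordinates)
  then show "integrable lborel (\<lambda>x::real^'n. 2 ^ CARD('n) * (\<Prod>i\<in>UNIV. inverse (1 + (x $ i)\<^sup>2)))"
    by (rule integrable_mult_right)
  have "norm (conf y ^ CARD('n)) \<le> norm (2 ^ CARD('n) * (\<Prod>i\<in>UNIV. inverse (1 + (y $ i)\<^sup>2)))" for y :: "real^'n"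
  proof -
    have "conf y ^ CARD('n) = (\<Prod>i\<in>(UNIV::'n set). conf y)" by simp
    also have "\<dots> \<le> (\<Prod>i\<in>(UNIV::'n set). 2 * inverse (1 + (y $ i)\<^sup>2))"
    proof (rule prod_mono, intro conjI)
      fix i
      have "\<bar>y $ i\<bar> \<le> norm y" by (rule component_le_norm_cart)
      then have "(y $ i)\<^sup>2 \<le> (norm y)\<^sup>2" using abs_le_square_iff[of "y $ i" "norm y"] by simp
      then have "2 / (1 + (norm y)\<^sup>2) \<le> 2 / (1 + (y $ i)\<^sup>2)"
        by (intro divide_left_mono mult_pos_pos add_pos_nonneg) auto
      then show "conf y \<le> 2 * inverse (1 + (y $ i)\<^sup>2)" by (simp add: conf_def divide_inverse)
    qed (simp add: conf_pos less_imp_le)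
    finally show ?thesis using conf_pos[of y]
      by (auto simp: prod.distrib abs_mult abs_prod intro!: order_trans[OF _ abs_ge_self])
  qed
  then show "AE y in lborel. norm (conf y ^ CARD('n)) \<le> norm (2 ^ CARD('n) * (\<Prod>i\<in>UNIV. inverse (1 + ((y::real^'n) $ i)\<^sup>2)))"
    by (intro AE_I2)
qed measurable

lemma finite_sphere_measure: "finite_measure sphere_measure"
proof
  have "integrable sphere_measure (\<lambda>_::'a amb. 1 :: real)"
    using integrable_conf by (subst sphere_integral(2)) auto
  then have "emeasure sphere_measure (space (sphere_measure :: 'a amb measure)) < \<infinity>"
    by (simp add: integrable_iff_bounded)
  then show "emeasure sphere_measure (space (sphere_measure :: 'a amb measure)) \<noteq> \<infinity>" by simp
qed

lemma (in finite_measure) L2_integrable: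
  assumes "f \<in> L2 M" shows "integrable M f"
  using L2_mult_integrable[OF assms, of "\<lambda>_. 1"] by (simp add: L2_def)

lemma (in finite_measure) L2_bounded:
  assumes "f \<in> borel_measurable M" "\<And>x. \<bar>f x\<bar> \<le> B" shows "f \<in> L2 M"
proof -
  have "integrable M (\<lambda>x. (f x)\<^sup>2)"
  proof (rule integrable_const_bound[where B = "B\<^sup>2"])
    have "\<bar>f x\<bar> \<le> \<bar>B\<bar>" for x using assms(2)[of x] by linarith
    then show "AE x in M. norm ((f x)\<^sup>2) \<le> B\<^sup>2" by (simp add: abs_le_square_iff)
  qed (use assms in measurable)
  then show ?thesis using assms by (simp add: L2_def)
qed

section \<open>The unitary operators\<close>

definition to_sphere :: "nat \<Rightarrow> (real^'n \<Rightarrow> real) \<Rightarrow> 'n::finite amb \<Rightarrow> real" where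
  "to_sphere k f = U_alpha (U_beta k f)"

definition from_sphere :: "nat \<Rightarrow> ('n::finite amb \<Rightarrow> real) \<Rightarrow> real^'n \<Rightarrow> real" where
  "from_sphere k g = U_beta_inv k (U_alpha_inv g)"

lemma U_lincomb: "to_sphere k (\<lambda>x. s * f x + t * g x) = (\<lambda>x. s * to_sphere k f x + t * to_sphere k g x)"
  by (rule ext) (simp add: to_sphere_def U_alpha_def U_beta_def distrib_left mult.left_commute)

lemma U_inv_scale: "from_sphere k (\<lambda>x. s * f x) = (\<lambda>x. s * from_sphere k f x)"
  by (rule ext) (simp add: from_sphere_def U_alpha_inv_def U_beta_inv_def)

lemma measurable_U:
  assumes [measurable]: "f \<in> borel_measurable borel"
  shows "to_sphere k f \<in> borel_measurable borel"
proof -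
  have [measurable]: "Sph \<in> sets (borel :: 'a amb measure)"
    by (simp add: Sph_def borel_closed)
  have "Measurable.pred borel (\<lambda>x::'a amb. x \<in> Sph - {north})" by measurable
  moreover have "(\<lambda>x::'a amb. inverse (1 - snd x) powr (real CARD('a) / 2) * U_beta k f (stereo x)) \<in> borel_measurable borel"
    unfolding U_beta_def stereo_def borel_prod[symmetric] by measurable
  ultimately show ?thesis unfolding to_sphere_def U_alpha_def[abs_def] by measurable
qed

lemma U_stereo_inv: "to_sphere k f (stereo_inv y) = conf y powr (- (real CARD('n) / 2)) * U_beta k f y"
  for f :: "real^'n::finite \<Rightarrow> real"
proof -
  have "snd (stereo_inv y) = 1 - conf y" by (simp add: stereo_inv_conf)
  moreover have "inverse (conf y) powr (real CARD('n) / 2) = conf y powr (- (real CARD('n) / 2))"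
    using conf_pos[of y] by (simp only: powr_minus inverse_powr less_imp_le)
  moreover have "1 - (1 - conf y) = conf y" by simp
  ultimately show ?thesis using stereo_inv_in_Sph[of y]
    unfolding to_sphere_def U_alpha_def by (simp only: stereo_stereo_inv if_True)
qed

lemma U_alpha_inv_conf: "U_alpha_inv A y = conf y powr (real CARD('n) / 2) * A (stereo_inv y)"
  for A :: "'n::finite amb \<Rightarrow> real"
  by (simp add: U_alpha_inv_def stereo_inv_conf)

lemma powr_half: "x > 0 \<Longrightarrow> x powr (real N / 2) * x powr (real N / 2) = x ^ N"
  by (simp only: powr_add[symmetric] powr_realpow[symmetric]) simp

lemma inverse_powr_half: "real k powr (real N / 2) * inverse (real k) powr (real N / 2) = 1" if "k \<ge> 1"
proof -
  have "inverse (real k) powr (real N / 2) = inverse (real k powr (real N / 2))"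
    by (rule inverse_powr)
  moreover have "real k powr (real N / 2) \<noteq> 0" using that by simp
  ultimately show ?thesis by simp
qed

lemma conf_powr_half: "conf y powr (real N / 2) * conf y powr (- (real N / 2)) = 1"
proof -
  have "conf y powr (real N / 2) \<noteq> 0" using conf_pos[of y] by simp
  then show ?thesis by (simp add: powr_minus)
qed

lemma conf_powr:
  fixes y :: "real^'n::finite"
  shows "conf y ^ CARD('n) * conf y powr (- (real CARD('n) / 2)) = conf y powr (real CARD('n) / 2)"
  unfolding powr_half[OF conf_pos, symmetric] mult.assoc conf_powr_half by simp

lemma U_beta_integral:
  fixes f g :: "real^'n::finite \<Rightarrow> real"
  assumes k: "k \<ge> 1" and [measurable]: "f \<in> borel_measurable borel" "g \<in> borel_measurable borel"
  shows "(\<integral>y. g y * U_beta k f y \<partial>lborel) = (\<integral>y. U_beta_inv k g y * f y \<partial>lborel)"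
    and "integrable lborel (\<lambda>y. g y * U_beta k f y) \<longleftrightarrow> integrable lborel (\<lambda>y. U_beta_inv k g y * f y)"
proof -
  have k0: "real k > 0" using k by simp
  have m: "(\<lambda>y. U_beta_inv k g y * f y) \<in> borel_measurable borel"
    unfolding U_beta_inv_def by measurable
  have c: "real k ^ CARD('n) * inverse (real k) powr (real CARD('n) / 2) = real k powr (real CARD('n) / 2)"
    unfolding powr_half[OF k0, symmetric] mult.assoc inverse_powr_half[OF k] by simp
  have e: "real k ^ CARD('n) * (U_beta_inv k g (0 + real k *\<^sub>R y) * f (0 + real k *\<^sub>R y)) = g y * U_beta k f y" for y
  proof -
    have "real k ^ CARD('n) * (U_beta_inv k g (0 + real k *\<^sub>R y) * f (0 + real k *\<^sub>R y))
      = (real k ^ CARD('n) * inverse (real k) powr (real CARD('n) / 2)) * (g y * f (real k *\<^sub>R y))"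
      using k0 by (simp add: U_beta_inv_def)
    then show ?thesis by (simp only: c) (simp add: U_beta_def)
  qed
  note * = lborel_integral_affine[OF _ m, of "real k" 0]
  show "(\<integral>y. g y * U_beta k f y \<partial>lborel) = (\<integral>y. U_beta_inv k g y * f y \<partial>lborel)"
    using *(1) k0 unfolding e[symmetric] by simp
  show "integrable lborel (\<lambda>y. g y * U_beta k f y) \<longleftrightarrow> integrable lborel (\<lambda>y. U_beta_inv k g y * f y)"
    using *(2) k0 unfolding e[symmetric] by simp
qed

lemma measurable_U_inv:
  assumes [measurable]: "A \<in> borel_measurable borel"
  shows "from_sphere k A \<in> borel_measurable borel" "U_alpha_inv A \<in> borel_measurable borel"
proof -
  show [measurable]: "U_alpha_inv A \<in> borel_measurable borel"
    unfolding U_alpha_inv_conf[abs_def] by measurable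
  show "from_sphere k A \<in> borel_measurable borel" unfolding from_sphere_def U_beta_inv_def[abs_def] by measurable
qed

text \<open>Change of variables along the chart and the dilation. Integrability is stated as an
  equivalence, so that inserting \<open>to_sphere k f\<close> for \<open>A\<close>, or
  \<open>from_sphere k A\<close> for \<open>f\<close>, yields the isometry property in both
  directions.\<close>

lemma U_adjoint:
  fixes f :: "real^'n::finite \<Rightarrow> real"
  assumes k: "k \<ge> 1" and [measurable]: "f \<in> borel_measurable borel" "A \<in> borel_measurable borel"
  shows "L2_inner sphere_measure A (to_sphere k f) = L2_inner lborel (from_sphere k A) f"
    and "integrable sphere_measure (\<lambda>x. A x * to_sphere k f x) \<longleftrightarrow> integrable lborel (\<lambda>y. from_sphere k A y * f y)"
proof -
  have m: "(\<lambda>x. A x * to_sphere k f x) \<in> borel_measurable borel"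
    using measurable_U[of f k] by measurable
  have e: "conf y ^ CARD('n) * (A (stereo_inv y) * to_sphere k f (stereo_inv y)) = U_alpha_inv A y * U_beta k f y" for y
    unfolding U_stereo_inv U_alpha_inv_conf conf_powr[symmetric] by (simp only: mult_ac)
  show "L2_inner sphere_measure A (to_sphere k f) = L2_inner lborel (from_sphere k A) f"
    unfolding L2_inner_def sphere_integral(1)[OF m] e from_sphere_def
    by (intro U_beta_integral k measurable_U_inv) measurable
  show "integrable sphere_measure (\<lambda>x. A x * to_sphere k f x) \<longleftrightarrow> integrable lborel (\<lambda>y. from_sphere k A y * f y)"
    unfolding sphere_integral(2)[OF m] e from_sphere_def
    by (intro U_beta_integral k measurable_U_inv) measurable
qed

lemma U_inv_U:
  fixes f :: "real^'n::finite \<Rightarrow> real"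
  assumes k: "k \<ge> 1" shows "from_sphere k (to_sphere k f) = f"
proof
  fix y :: "real^'n"
  let ?c = "conf (inverse (real k) *\<^sub>R y)" and ?r = "real CARD('n) / 2"
  have "from_sphere k (to_sphere k f) y = (real k powr ?r * inverse (real k) powr ?r) * (?c powr ?r * ?c powr - ?r)
      * f (real k *\<^sub>R inverse (real k) *\<^sub>R y)"
    by (simp only: from_sphere_def U_beta_inv_def U_alpha_inv_conf U_stereo_inv U_beta_def mult_ac)
  then show "from_sphere k (to_sphere k f) y = f y"
    unfolding inverse_powr_half[OF k] conf_powr_half using k by simp
qed

text \<open>Restricted to the range of the chart, because \<open>to_sphere\<close> is 0 at the pole
  and off the sphere. Integrals over the sphere are computed in the chart and see no other
  points.\<close>

lemma U_U_inv:
  fixes A :: "'n::finite amb \<Rightarrow> real"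
  assumes k: "k \<ge> 1" shows "to_sphere k (from_sphere k A) (stereo_inv y) = A (stereo_inv y)"
proof -
  let ?y = "inverse (real k) *\<^sub>R real k *\<^sub>R y" and ?r = "real CARD('n) / 2"
  have y: "?y = y" using k by simp
  have "to_sphere k (from_sphere k A) (stereo_inv y)
      = (real k powr ?r * inverse (real k) powr ?r) * (conf ?y powr ?r * conf y powr - ?r) * A (stereo_inv ?y)"
    by (simp only: from_sphere_def U_beta_inv_def U_alpha_inv_conf U_stereo_inv U_beta_def mult_ac)
  then show ?thesis unfolding y inverse_powr_half[OF k] conf_powr_half by simp
qed

lemma U_L2:
  fixes f :: "real^'n::finite \<Rightarrow> real"
  assumes k: "k \<ge> 1" and f: "f \<in> L2 lborel"
  shows "to_sphere k f \<in> L2 sphere_measure" "L2_norm sphere_measure (to_sphere k f) = L2_norm lborel f"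
proof -
  have [measurable]: "f \<in> borel_measurable borel" using f by (simp add: L2_def)
  note m = measurable_U[of f k]
  show "to_sphere k f \<in> L2 sphere_measure"
    using f U_adjoint(2)[OF k _ m] m by (simp add: L2_def power2_eq_square U_inv_U[OF k])
  show "L2_norm sphere_measure (to_sphere k f) = L2_norm lborel f"
    using U_adjoint(1)[OF k _ m] by (simp add: L2_norm_def U_inv_U[OF k])
qed

lemma U_inv_L2:
  fixes A :: "'n::finite amb \<Rightarrow> real"
  assumes k: "k \<ge> 1" and A: "A \<in> L2 sphere_measure"
  shows "from_sphere k A \<in> L2 lborel" "L2_norm lborel (from_sphere k A) = L2_norm sphere_measure A"
proof -
  have Am [measurable]: "A \<in> borel_measurable borel" using A by (simp add: L2_def)
  note m = measurable_U_inv(1)[OF Am, of k]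
  have [measurable]: "to_sphere k (from_sphere k A) \<in> borel_measurable borel" by (rule measurable_U[OF m])
  have i: "integrable sphere_measure (\<lambda>x. A x * to_sphere k (from_sphere k A) x) \<longleftrightarrow> integrable sphere_measure (\<lambda>x. A x * A x)"
    by (simp add: sphere_integral(2) U_U_inv[OF k])
  have e: "L2_inner sphere_measure A (to_sphere k (from_sphere k A)) = L2_inner sphere_measure A A"
    by (simp add: L2_inner_def sphere_integral(1) U_U_inv[OF k])
  show "from_sphere k A \<in> L2 lborel"
    using A U_adjoint(2)[OF k m Am] i m by (simp add: L2_def power2_eq_square)
  show "L2_norm lborel (from_sphere k A) = L2_norm sphere_measure A"
    using U_adjoint(1)[OF k m Am] e by (simp add: L2_norm_def)
qed

section \<open>Smooth kernels and test functions on the sphere\<close>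

lemma sgn_Sph: "x \<in> Sph \<Longrightarrow> sgn x = x"
  by (simp add: Sph_def sgn_div_norm)

lemma Sph_nonzero: "x \<in> Sph \<Longrightarrow> x \<noteq> 0"
  by (auto simp: Sph_def)

lemma zero_notin_Sph: "0 \<notin> Sph" by (simp add: Sph_def)

lemma compact_Sph: "compact Sph" by (simp add: Sph_def)

lemma borel_Sph [measurable, simp]: "Sph \<in> sets borel"
  by (simp add: Sph_def borel_closed)

text \<open>Serves for the slices of a kernel, where \<open>j\<close> embeds one factor into the
  product. Since \<open>j\<close> maps basis vectors to basis vectors, an iterated derivative of the
  slice is again one of \<open>F\<close>.\<close>

lemma iter_deriv_affine:
  fixes F :: "'a::euclidean_space \<Rightarrow> real" and j :: "'b::euclidean_space \<Rightarrow> 'a"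
  assumes F: "smooth_on S F" and j: "bounded_linear j" "j ` Basis \<subseteq> Basis"
    and T: "open T" "\<And>y. y \<in> T \<Longrightarrow> c + j y \<in> S" and L: "set L \<subseteq> Basis" and y: "y \<in> T"
  shows "iter_deriv L (\<lambda>y. F (c + j y)) y = iter_deriv (map j L) F (c + j y)"
    and "iter_deriv L (\<lambda>y. F (c + j y)) differentiable (at y)"
proof -
  have D: "((\<lambda>y. iter_deriv (map j L) F (c + j y)) has_derivative
      (\<lambda>h. frechet_derivative (iter_deriv (map j L) F) (at (c + j y)) (j h))) (at y)"
    if "set L \<subseteq> Basis" "y \<in> T" for L y
  proof -
    have "iter_deriv (map j L) F differentiable (at (c + j y))"
    proof -
      have "set (map j L) \<subseteq> Basis" using j(2) that(1) by auto
      then show ?thesis using F T(2)[OF that(2)] unfolding smooth_on_def by blast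
    qed
    then have "(iter_deriv (map j L) F has_derivative frechet_derivative (iter_deriv (map j L) F) (at (c + j y))) (at (c + j y))"
      by (simp add: frechet_derivative_works)
    moreover have "((\<lambda>y. c + j y) has_derivative j) (at y)"
      using has_derivative_add[OF has_derivative_const bounded_linear_imp_has_derivative[OF j(1)]] by simp
    ultimately show ?thesis
      using diff_chain_at[of "\<lambda>y. c + j y" j y "iter_deriv (map j L) F"] by (simp add: o_def)
  qed
  have D': "(iter_deriv L (\<lambda>y. F (c + j y)) has_derivative
      (\<lambda>h. frechet_derivative (iter_deriv (map j L) F) (at (c + j y)) (j h))) (at y)"
    if "set L \<subseteq> Basis" "y \<in> T" and "\<And>y. y \<in> T \<Longrightarrow> iter_deriv L (\<lambda>y. F (c + j y)) y = iter_deriv (map j L) F (c + j y)" for L y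
    by (rule has_derivative_transform_within_open[OF D[OF that(1,2)] T(1) that(2)]) (simp add: that(3))
  have eq: "iter_deriv L (\<lambda>y. F (c + j y)) y = iter_deriv (map j L) F (c + j y)"
    if "set L \<subseteq> Basis" "y \<in> T" for L y
    using that
  proof (induction L arbitrary: y)
    case (Cons v L)
    have "(iter_deriv L (\<lambda>y. F (c + j y)) has_derivative
        (\<lambda>h. frechet_derivative (iter_deriv (map j L) F) (at (c + j y)) (j h))) (at y)"
      using Cons by (intro D') auto
    from frechet_derivative_at[OF this, symmetric] show ?case by simp
  qed simp
  show "iter_deriv L (\<lambda>y. F (c + j y)) y = iter_deriv (map j L) F (c + j y)" by (rule eq[OF L y])
  show "iter_deriv L (\<lambda>y. F (c + j y)) differentiable (at y)"
    using D'[OF L y eq[OF L]] by (auto simp: differentiable_def)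
qed

lemma smooth_kernel_slices:
  fixes a :: "'n::finite amb \<Rightarrow> 'n amb \<Rightarrow> real"
  assumes a: "smooth_kernel a" and x: "x \<in> Sph"
  shows "a x \<in> test_S" "(\<lambda>y. a y x) \<in> test_S"
proof -
  let ?F = "\<lambda>(x, y). a (sgn x) (sgn y)"
  have F: "smooth_on ((- {0}) \<times> (- {0})) ?F" and z: "\<And>x y. x \<notin> Sph \<or> y \<notin> Sph \<Longrightarrow> a x y = 0"
    using a by (auto simp: smooth_kernel_def)
  have P: "bounded_linear (Pair (0::'n amb))" "bounded_linear (\<lambda>y::'n amb. (y, 0::'n amb))"
    by (intro bounded_linear_Pair bounded_linear_zero bounded_linear_ident)+
  have "smooth_on (- {0}) (\<lambda>y. ?F ((x, 0) + Pair 0 y))"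
    unfolding smooth_on_def using Sph_nonzero[OF x]
    by (intro allI impI; elim conjE; intro iter_deriv_affine(2)[OF F P(1), where T = "- {0}"])
      (auto simp: Basis_prod_def)
  then show "a x \<in> test_S" using z by (simp add: test_S_def sgn_Sph[OF x])
  have "smooth_on (- {0}) (\<lambda>y. ?F ((0, x) + (y, 0)))"
    unfolding smooth_on_def using Sph_nonzero[OF x]
    by (intro allI impI; elim conjE; intro iter_deriv_affine(2)[OF F P(2), where T = "- {0}"])
      (auto simp: Basis_prod_def)
  then show "(\<lambda>y. a y x) \<in> test_S" using z by (simp add: test_S_def sgn_Sph[OF x])
qed

lemma test_S_zero: "f \<in> test_S \<Longrightarrow> x \<notin> Sph \<Longrightarrow> f x = 0"
  unfolding test_S_def by blast

lemma continuous_on_smooth: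
  assumes "smooth_on S f" shows "continuous_on S f"
  using assms unfolding smooth_on_def
  by (intro continuous_at_imp_continuous_on ballI differentiable_imp_continuous_within)
    (auto dest: spec[of _ "[]"])

text \<open>Continuity is required only on \<open>K\<close>: a function on the sphere, extended by
  0, may jump in the ambient space.\<close>

lemma compact_supported_continuous:
  fixes f :: "'a::euclidean_space \<Rightarrow> real"
  assumes "compact K" "continuous_on K f" "\<And>x. x \<notin> K \<Longrightarrow> f x = 0"
  shows "f \<in> borel_measurable borel" and "\<exists>B\<ge>0. \<forall>x. \<bar>f x\<bar> \<le> B"
proof -
  have "(\<lambda>x. indicator K x *\<^sub>R f x) \<in> borel_measurable borel"
    using assms by (intro borel_measurable_continuous_on_indicator) (auto intro: borel_compact)
  also have "(\<lambda>x. indicator K x *\<^sub>R f x) = f" using assms(3) by (auto simp: indicator_def fun_eq_iff)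
  finally show "f \<in> borel_measurable borel" .
  have "compact (f ` K)" using assms by (intro compact_continuous_image)
  then obtain B where B: "\<And>y. y \<in> f ` K \<Longrightarrow> \<bar>y\<bar> \<le> B" using compact_imp_bounded bounded_real by metis
  have "\<bar>f x\<bar> \<le> max B 0" for x using B[of "f x"] assms(3)[of x] by (cases "x \<in> K") auto
  then show "\<exists>B\<ge>0. \<forall>x. \<bar>f x\<bar> \<le> B" by (intro exI[of _ "max B 0"]) auto
qed

lemma test_S_borel_bounded:
  fixes g :: "'n::finite amb \<Rightarrow> real"
  assumes "g \<in> test_S"
  shows "g \<in> borel_measurable borel" "\<exists>B\<ge>0. \<forall>x. \<bar>g x\<bar> \<le> B"
proof -
  have "continuous_on Sph (\<lambda>x. g (sgn x))"
    using assms zero_notin_Sph by (intro continuous_on_subset[OF continuous_on_smooth[of "- {0}"]]) (auto simp: test_S_def)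
  then have c: "continuous_on Sph g"
    by (rule continuous_on_eq) (simp add: sgn_Sph)
  have z: "x \<notin> Sph \<Longrightarrow> g x = 0" for x using assms unfolding test_S_def by blast
  note * = compact_supported_continuous[OF compact_Sph c z]
  show "g \<in> borel_measurable borel" "\<exists>B\<ge>0. \<forall>x. \<bar>g x\<bar> \<le> B" using * by auto
qed

lemma test_S_L2: "g \<in> test_S \<Longrightarrow> g \<in> L2 sphere_measure"
  using finite_measure.L2_bounded[OF finite_sphere_measure] test_S_borel_bounded by (metis borel_measurable_sphere)

lemma smooth_kernel_borel_bounded:
  fixes a :: "'n::finite amb \<Rightarrow> 'n amb \<Rightarrow> real"
  assumes a: "smooth_kernel a"
  shows "(\<lambda>(x, y). a x y) \<in> borel_measurable (borel \<Otimes>\<^sub>M borel)" "\<exists>B\<ge>0. \<forall>x y. \<bar>a x y\<bar> \<le> B"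
proof -
  have "continuous_on (Sph \<times> Sph) (\<lambda>(x, y). a (sgn x) (sgn y))"
    using a zero_notin_Sph by (intro continuous_on_subset[OF continuous_on_smooth[of "(- {0}) \<times> (- {0})"]])
      (auto simp: smooth_kernel_def)
  then have c: "continuous_on (Sph \<times> Sph) (\<lambda>(x, y). a x y)"
    by (rule continuous_on_eq) (auto simp: sgn_Sph)
  have z0: "\<And>x y. x \<notin> Sph \<or> y \<notin> Sph \<Longrightarrow> a x y = 0" using a by (auto simp: smooth_kernel_def)
  have z: "(\<lambda>(x, y). a x y) p = 0" if "p \<notin> Sph \<times> Sph" for p
    using that z0[of "fst p" "snd p"] by (auto simp: case_prod_unfold mem_Times_iff)
  note * = compact_supported_continuous[OF compact_Times[OF compact_Sph compact_Sph] c z]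
  show "(\<lambda>(x, y). a x y) \<in> borel_measurable (borel \<Otimes>\<^sub>M borel)" using *(1) by (simp add: borel_prod)
  show "\<exists>B\<ge>0. \<forall>x y. \<bar>a x y\<bar> \<le> B" using *(2) by auto
qed

text \<open>The slices of the kernel are test functions, so \<open>restrict\<close> does not
  interfere; off the sphere the kernel, and with it the integral, is 0.\<close>

lemma L2_op_eq:
  assumes a: "smooth_kernel a"
  shows "L2_op a u x = (\<integral>y. u y * a x y \<partial>sphere_measure)"
    and "L2_op (adjoint_kernel a) u x = (\<integral>y. u y * a y x \<partial>sphere_measure)"
proof -
  have z: "\<And>x y. x \<notin> Sph \<or> y \<notin> Sph \<Longrightarrow> a x y = 0" using a by (auto simp: smooth_kernel_def)
  show "L2_op a u x = (\<integral>y. u y * a x y \<partial>sphere_measure)"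
    using smooth_kernel_slices[OF a, of x] z[of x]
    by (simp add: L2_op_def smoothing_op_def L2_to_distrib_def L2_inner_def)
  show "L2_op (adjoint_kernel a) u x = (\<integral>y. u y * a y x \<partial>sphere_measure)"
    using smooth_kernel_slices[OF a, of x] z[of _ x]
    by (simp add: L2_op_def smoothing_op_def L2_to_distrib_def L2_inner_def adjoint_kernel_def[abs_def])
qed

lemma L2_op_scale:
  assumes "smooth_kernel a" shows "L2_op a (\<lambda>x. t * u x) = (\<lambda>x. t * L2_op a u x)"
  by (rule ext) (simp add: L2_op_eq[OF assms] mult.assoc)

lemma L2_op_L2:
  fixes a :: "'n::finite amb \<Rightarrow> 'n amb \<Rightarrow> real"
  assumes a: "smooth_kernel a" and u: "u \<in> L2 sphere_measure"
  shows "L2_op a u \<in> L2 sphere_measure"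
proof -
  interpret finite_measure "sphere_measure :: 'n amb measure" by (rule finite_sphere_measure)
  have [measurable]: "u \<in> borel_measurable borel" using u by (simp add: L2_def)
  note [measurable] = smooth_kernel_borel_bounded(1)[OF a]
  obtain B where B: "B \<ge> 0" "\<And>x y. \<bar>a x y\<bar> \<le> B" using smooth_kernel_borel_bounded(2)[OF a] by blast
  have "(\<lambda>(x, y). u y * a x y) \<in> borel_measurable (borel \<Otimes>\<^sub>M borel)" by measurable
  then have "(\<lambda>(x, y). u y * a x y) \<in> borel_measurable (borel \<Otimes>\<^sub>M sphere_measure)"
    by (simp cong: measurable_cong_sets sets_pair_measure_cong)
  then have "(\<lambda>x. \<integral>y. u y * a x y \<partial>sphere_measure) \<in> borel_measurable borel"
    by (rule borel_measurable_lebesgue_integral)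
  then have m: "L2_op a u \<in> borel_measurable borel"
    unfolding L2_op_eq(1)[OF a, abs_def] .
  have i: "integrable sphere_measure (\<lambda>y. B * \<bar>u y\<bar>)" using L2_integrable[OF u] by auto
  have "\<bar>L2_op a u x\<bar> \<le> (\<integral>y. B * \<bar>u y\<bar> \<partial>sphere_measure)" for x
    unfolding L2_op_eq(1)[OF a]
  proof (rule order_trans[OF integral_abs_bound])
    have ax [measurable]: "a x \<in> borel_measurable borel"
      using measurable_compose[OF measurable_Pair1' smooth_kernel_borel_bounded(1)[OF a], of x] by simp
    have le: "\<bar>u y * a x y\<bar> \<le> B * \<bar>u y\<bar>" for y
      unfolding abs_mult using mult_right_mono[OF B(2)[of x y] abs_ge_zero[of "u y"]] by (simp add: mult.commute)
    show "(\<integral>y. \<bar>u y * a x y\<bar> \<partial>sphere_measure) \<le> (\<integral>y. B * \<bar>u y\<bar> \<partial>sphere_measure)"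
      by (rule integral_mono'[OF i le]) (simp add: B(1))
  qed
  with m show ?thesis by (intro L2_bounded) simp_all
qed

text \<open>Fubini, justified by the bound of the kernel and by the finite measure of the sphere,
  which makes \<open>u\<close> and \<open>h\<close> integrable.\<close>

lemma L2_op_adjoint:
  fixes a :: "'n::finite amb \<Rightarrow> 'n amb \<Rightarrow> real"
  assumes a: "smooth_kernel a" and u: "u \<in> L2 sphere_measure" and h: "h \<in> L2 sphere_measure"
  shows "L2_inner sphere_measure u (L2_op (adjoint_kernel a) h) = L2_inner sphere_measure (L2_op a u) h"
proof -
  let ?S = "sphere_measure :: 'n amb measure"
  interpret S: finite_measure ?S by (rule finite_sphere_measure)
  interpret pair_sigma_finite ?S ?S ..
  have [measurable]: "u \<in> borel_measurable borel" "h \<in> borel_measurable borel" using u h by (simp_all add: L2_def)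
  note [measurable] = smooth_kernel_borel_bounded(1)[OF a]
  obtain B where B: "B \<ge> 0" "\<And>x y. \<bar>a x y\<bar> \<le> B" using smooth_kernel_borel_bounded(2)[OF a] by blast
  define F where "F x y = u x * (h y * a y x)" for x y
  have am: "(\<lambda>(x, y). a y x) \<in> borel_measurable (borel \<Otimes>\<^sub>M borel)"
    using measurable_compose[OF measurable_pair_swap' smooth_kernel_borel_bounded(1)[OF a]]
    by (simp add: case_prod_unfold)
  have Fm0: "(\<lambda>(x, y). F x y) \<in> borel_measurable (borel \<Otimes>\<^sub>M borel)"
    unfolding F_def case_prod_unfold using am[unfolded case_prod_unfold] by measurable
  then have Fm: "(\<lambda>(x, y). F x y) \<in> borel_measurable (?S \<Otimes>\<^sub>M ?S)"
    by (simp cong: measurable_cong_sets sets_pair_measure_cong)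
  have le: "\<bar>F x y\<bar> \<le> B * \<bar>u x\<bar> * \<bar>h y\<bar>" for x y
  proof -
    have "\<bar>F x y\<bar> = \<bar>a y x\<bar> * (\<bar>u x\<bar> * \<bar>h y\<bar>)" by (simp add: F_def abs_mult)
    also have "\<dots> \<le> B * (\<bar>u x\<bar> * \<bar>h y\<bar>)" by (intro mult_right_mono B) simp
    finally show ?thesis by (simp add: mult.assoc)
  qed
  have ih: "integrable ?S (\<lambda>y. c * \<bar>h y\<bar>)" for c using S.L2_integrable[OF h] by auto
  have Fs: "(\<lambda>y. F x y) \<in> borel_measurable borel" for x
    using measurable_compose[OF measurable_Pair1' Fm0, of x] by simp
  have int: "integrable (?S \<Otimes>\<^sub>M ?S) (\<lambda>(x, y). F x y)"
  proof (rule Fubini_integrable[OF Fm])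
    have ix: "integrable ?S (\<lambda>y. F x y)" for x
      by (rule Bochner_Integration.integrable_bound[OF ih[of "B * \<bar>u x\<bar>"]])
        (use Fs le B in \<open>auto simp: abs_mult\<close>)
    then show "AE x in ?S. integrable ?S (\<lambda>y. case (x, y) of (x, y) \<Rightarrow> F x y)" by simp
    have "integrable ?S (\<lambda>x. B * (\<integral>y. \<bar>h y\<bar> \<partial>?S) * \<bar>u x\<bar>)"
      using S.L2_integrable[OF u] by auto
    then have "integrable ?S (\<lambda>x. \<integral>y. norm (F x y) \<partial>?S)"
    proof (rule Bochner_Integration.integrable_bound)
      have "(\<lambda>(x, y). norm (F x y)) \<in> borel_measurable (?S \<Otimes>\<^sub>M ?S)"
        using Fm by (simp add: case_prod_unfold)
      then show "(\<lambda>x. \<integral>y. norm (F x y) \<partial>?S) \<in> borel_measurable ?S"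
        by (rule S.borel_measurable_lebesgue_integral)
      have "norm (\<integral>y. norm (F x y) \<partial>?S) \<le> norm (B * (\<integral>y. \<bar>h y\<bar> \<partial>?S) * \<bar>u x\<bar>)" for x
      proof -
        have "(\<integral>y. norm (F x y) \<partial>?S) \<le> (\<integral>y. B * \<bar>u x\<bar> * \<bar>h y\<bar> \<partial>?S)"
          by (rule integral_mono'[OF ih]) (use le B(1) in simp_all)
        then have "(\<integral>y. norm (F x y) \<partial>?S) \<le> B * (\<integral>y. \<bar>h y\<bar> \<partial>?S) * \<bar>u x\<bar>" by (simp add: mult_ac)
        then show ?thesis by (auto intro: order_trans[OF _ abs_ge_self])
      qed
      then show "AE x in ?S. norm (\<integral>y. norm (F x y) \<partial>?S) \<le> norm (B * (\<integral>y. \<bar>h y\<bar> \<partial>?S) * \<bar>u x\<bar>)" by simp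
    qed
    then show "integrable ?S (\<lambda>x. \<integral>y. norm (case (x, y) of (x, y) \<Rightarrow> F x y) \<partial>?S)" by simp
  qed
  have "L2_inner ?S u (L2_op (adjoint_kernel a) h) = (\<integral>x. (\<integral>y. F x y \<partial>?S) \<partial>?S)"
    by (simp add: L2_inner_def L2_op_eq[OF a] F_def)
  also have "\<dots> = (\<integral>y. (\<integral>x. F x y \<partial>?S) \<partial>?S)" by (rule Fubini_integral[OF int, symmetric])
  also have "\<dots> = L2_inner ?S (L2_op a u) h"
    by (simp add: L2_inner_def L2_op_eq[OF a] F_def mult.left_commute[of _ "h _"] mult.commute[of _ "h _"])
  finally show ?thesis .
qed

section \<open>The covariance\<close>

text \<open>Separates the right-hand sides for which the choice in \<open>laplace_resolvent\<close>
  picks an actual solution from those for which it is arbitrary.\<close>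

definition solvable :: "real \<Rightarrow> (real^'n::finite \<Rightarrow> real) \<Rightarrow> bool" where
  "solvable m h \<longleftrightarrow> (\<exists>u v. laplace_graph u v \<and> (AE x in lborel. v x + m\<^sup>2 * u x = h x))"

lemma laplace_graph_scale:
  assumes "laplace_graph u v" shows "laplace_graph (\<lambda>x. s * u x) (\<lambda>x. s * v x)"
  using assms by (auto simp: laplace_graph_def L2_scale) (simp add: L2_inner_def mult.assoc)

lemma solvable_scale:
  assumes "solvable m h" shows "solvable m (\<lambda>x. s * h x)"
proof -
  obtain u v where uv: "laplace_graph u v" "AE x in lborel. v x + m\<^sup>2 * u x = h x"
    using assms by (auto simp: solvable_def)
  have "AE x in lborel. s * v x + m\<^sup>2 * (s * u x) = s * h x"
    using uv(2) by eventually_elim (simp flip: distrib_left add: mult.left_commute)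
  then show ?thesis using laplace_graph_scale[OF uv(1)] unfolding solvable_def by blast
qed

lemma L2_inner_C_S_le:
  fixes A :: "'n::finite amb \<Rightarrow> real"
  assumes m: "m > 0" and k: "k \<ge> 1" and A: "A \<in> L2 sphere_measure" and s: "solvable m (from_sphere k A)"
  shows "C_S m k A \<in> L2 sphere_measure"
    and "L2_inner sphere_measure A (C_S m k A) \<le> (L2_norm sphere_measure A)\<^sup>2 / m\<^sup>2"
proof -
  define w where "w = laplace_resolvent m (from_sphere k A)"
  have C: "C_S m k A = to_sphere k w" by (simp add: C_S_def to_sphere_def w_def from_sphere_def)
  have "\<exists>v. laplace_graph w v \<and> (AE x in lborel. v x + m\<^sup>2 * w x = from_sphere k A x)"
    using s unfolding w_def laplace_resolvent_def solvable_def by (rule someI_ex)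
  then obtain v where v: "laplace_graph w v" "AE x in lborel. v x + m\<^sup>2 * w x = from_sphere k A x" by blast
  then have w: "w \<in> L2 lborel" by (simp add: laplace_graph_def)
  show "C_S m k A \<in> L2 sphere_measure" unfolding C by (rule U_L2(1)[OF k w])
  have "L2_inner sphere_measure A (C_S m k A) = L2_inner lborel (from_sphere k A) w"
    unfolding C using A w by (intro U_adjoint(1)[OF k]) (auto simp: L2_def)
  also have "\<dots> \<le> (L2_norm lborel (from_sphere k A))\<^sup>2 / m\<^sup>2"
    by (rule laplace_resolvent_bound[OF m v(1) U_inv_L2(1)[OF k A] v(2)])
  finally show "L2_inner sphere_measure A (C_S m k A) \<le> (L2_norm sphere_measure A)\<^sup>2 / m\<^sup>2"
    by (simp add: U_inv_L2(2)[OF k A])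
qed

text \<open>Without a solution the predicate in the choice is false for \<open>A\<close> and for all
  its nonzero multiples, so the choice returns the same function for each of them.\<close>

lemma C_S_not_solvable:
  assumes "\<not> solvable m (from_sphere k A)" "t \<noteq> 0"
  shows "C_S m k (\<lambda>x. t * A x) = C_S m k A"
proof -
  have n: "\<not> solvable m (from_sphere k (\<lambda>x. t * A x))"
  proof -
    have "(\<lambda>x. inverse t * (t * from_sphere k A x)) = from_sphere k A" using assms(2) by (simp add: fun_eq_iff)
    then show ?thesis
      using assms(1) solvable_scale[of m "\<lambda>x. t * from_sphere k A x" "inverse t"] by (auto simp: U_inv_scale)
  qed
  have e: "laplace_resolvent m h = (SOME u. False)" if "\<not> solvable m h" for h :: "real^'n::finite \<Rightarrow> real"
  proof -
    have "(\<lambda>u. \<exists>v. laplace_graph u v \<and> (AE x in lborel. v x + m\<^sup>2 * u x = h x)) = (\<lambda>u. False)"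
      using that by (auto simp: solvable_def fun_eq_iff)
    then show ?thesis by (simp add: laplace_resolvent_def)
  qed
  show ?thesis using n assms(1) by (simp add: C_S_def e flip: from_sphere_def)
qed

text \<open>Neither the existence of the resolvent nor \<open>C_tilde m a k \<phi> \<in> test_S\<close> is established. If
  one of them fails, the covariance form takes a junk value: \<open>undefined\<close>, or a value which is
  linear instead of quadratic in the scaling parameter \<open>t\<close>.\<close>

lemma C_tilde_form_cases:
  fixes u :: "'n::finite amb \<Rightarrow> real"
  assumes m: "m > 0" and k: "k \<ge> 1" and a: "smooth_kernel (a k)" and u: "u \<in> L2 sphere_measure"
    and B: "L2_norm sphere_measure (L2_op (a k) u) \<le> b"
  defines "\<phi> t \<equiv> L2_to_distrib (\<lambda>x. t * u x)"
  defines "q t \<equiv> \<phi> t (C_tilde m a k (\<phi> t))"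
  shows "(\<forall>t. q t = undefined \<or> q t \<le> t\<^sup>2 * (b\<^sup>2 / m\<^sup>2)) \<or> (\<exists>c. \<forall>t. t \<noteq> 0 \<longrightarrow> q t = undefined \<or> q t = t * c)"
proof -
  let ?S = "sphere_measure :: 'n amb measure"
  define A where "A = L2_op (a k) u"
  have A: "A \<in> L2 ?S" unfolding A_def by (rule L2_op_L2[OF a u])
  have Ct: "C_tilde m a k (\<phi> t) = L2_op (adjoint_kernel (a k)) (C_S m k (\<lambda>x. t * A x))" for t
    unfolding C_tilde_def \<phi>_def L2_op_def[symmetric] by (simp add: A_def L2_op_scale[OF a])
  \<comment> \<open>\<open>undefined\<close> is the value of \<open>restrict\<close> at an argument
    outside \<open>test_S\<close>.\<close>
  have q: "q t = undefined \<or> q t = L2_inner ?S (\<lambda>x. t * u x) (L2_op (adjoint_kernel (a k)) (C_S m k (\<lambda>x. t * A x)))" for t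
    unfolding q_def Ct by (simp add: \<phi>_def L2_to_distrib_def)
  show ?thesis
  proof (cases "solvable m (from_sphere k A)")
    case True
    have "q t = undefined \<or> q t \<le> t\<^sup>2 * (b\<^sup>2 / m\<^sup>2)" for t
    proof -
      have s: "solvable m (from_sphere k (\<lambda>x. t * A x))" using solvable_scale[OF True, of t] by (simp add: U_inv_scale)
      have tA: "(\<lambda>x. t * A x) \<in> L2 ?S" by (rule L2_scale[OF A])
      note C = L2_inner_C_S_le[OF m k tA s]
      have "L2_inner ?S (\<lambda>x. t * u x) (L2_op (adjoint_kernel (a k)) (C_S m k (\<lambda>x. t * A x)))
        = L2_inner ?S (\<lambda>x. t * A x) (C_S m k (\<lambda>x. t * A x))"
        using L2_op_adjoint[OF a L2_scale[OF u] C(1)] by (simp add: L2_op_scale[OF a] A_def)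
      also have "\<dots> \<le> (\<bar>t\<bar> * L2_norm ?S A)\<^sup>2 / m\<^sup>2" using C(2) by (simp add: L2_norm_scale)
      also have "\<dots> \<le> (\<bar>t\<bar> * b)\<^sup>2 / m\<^sup>2"
        using B L2_norm_nonneg[of ?S A] by (intro divide_right_mono power_mono mult_left_mono) (auto simp: A_def)
      finally show ?thesis using q[of t] by (auto simp: power_mult_distrib)
    qed
    then show ?thesis by blast
  next
    case False
    define c where "c = L2_inner ?S u (L2_op (adjoint_kernel (a k)) (C_S m k A))"
    have "q t = undefined \<or> q t = t * c" if "t \<noteq> 0" for t
      using q[of t] unfolding C_S_not_solvable[OF False that] c_def by (simp add: L2_inner_def mult.assoc)
    then show ?thesis by blast
  qed
qed

section \<open>Second moments\<close>

lemma continuous_map_borel_measurable: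
  assumes "continuous_map T euclideanreal \<phi>" "space M = topspace T" "sets M = sigma_sets (topspace T) {U. openin T U}"
  shows "\<phi> \<in> borel_measurable M"
proof (rule borel_measurableI)
  fix S :: "real set" assume "open S"
  then have "openin T {x \<in> topspace T. \<phi> x \<in> S}"
    using assms(1) by (auto simp: continuous_map_def)
  moreover have "\<phi> -` S \<inter> space M = {x \<in> topspace T. \<phi> x \<in> S}" using assms(2) by auto
  ultimately show "\<phi> -` S \<inter> space M \<in> sets M"
    unfolding assms(3) by (auto intro: sigma_sets.Basic)
qed

text \<open>By the half-angle formula the expression is the square of 2 sin(t x / 2) / t, where
  sin(t x / 2) / t is a difference quotient at 0. Through Fatou's lemma it recovers the second
  moment from the real part of the characteristic function.\<close>

lemma cos_second_difference_limit:
  fixes x :: real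
  assumes "\<And>n. t n \<noteq> 0" "t \<longlonglongrightarrow> 0"
  shows "(\<lambda>n. 2 * (1 - cos (t n * x)) / (t n)\<^sup>2) \<longlonglongrightarrow> x\<^sup>2"
proof -
  have "((\<lambda>s. sin (s * (x / 2))) has_real_derivative x / 2) (at 0)"
    by (auto intro!: derivative_eq_intros)
  then have "((\<lambda>h. sin (h * (x / 2)) / h) \<longlongrightarrow> x / 2) (at 0)"
    by (simp add: has_field_derivative_iff)
  then have "(\<lambda>n. sin (t n * (x / 2)) / t n) \<longlonglongrightarrow> x / 2"
    by (rule filterlim_compose) (use assms in \<open>auto simp: filterlim_at\<close>)
  then have "(\<lambda>n. 4 * (sin (t n * (x / 2)) / t n)\<^sup>2) \<longlonglongrightarrow> 4 * (x / 2)\<^sup>2"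
    by (intro tendsto_mult tendsto_power tendsto_const)
  moreover have "4 * (sin (t n * (x / 2)) / t n)\<^sup>2 = 2 * (1 - cos (t n * x)) / (t n)\<^sup>2" for n
  proof -
    have "cos (2 * (t n * (x / 2))) = 1 - 2 * (sin (t n * (x / 2)))\<^sup>2" by (rule cos_double_sin)
    then show ?thesis by (simp add: power_divide)
  qed
  ultimately have "(\<lambda>n. 2 * (1 - cos (t n * x)) / (t n)\<^sup>2) \<longlonglongrightarrow> 4 * (x / 2)\<^sup>2" by (simp only:)
  then show ?thesis by (simp add: power_divide)
qed

text \<open>The junk value \<open>w\<close> and the linear alternative are harmless: \<open>q\<close> is even, and \<open>exp (- q t / 2)\<close>
  tends to 1 as \<open>t\<close> tends to 0, so that \<open>q t \<le> t\<^sup>2 * Q\<close> for small \<open>t\<close> in all cases.\<close>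

lemma second_moment_le:
  fixes X :: "'a \<Rightarrow> real"
  assumes "prob_space M" and X [measurable]: "X \<in> borel_measurable M"
    and ch: "\<And>t. (\<integral>g. exp (\<i> * complex_of_real (t * X g)) \<partial>M) = complex_of_real (exp (- (1/2) * q t))"
    and q: "(\<forall>t. q t = w \<or> q t \<le> t\<^sup>2 * Q) \<or> (\<exists>c. \<forall>t. t \<noteq> 0 \<longrightarrow> q t = w \<or> q t = t * c)"
    and Q: "Q \<ge> 0"
  shows "X \<in> L2 M" "(L2_norm M X)\<^sup>2 \<le> Q"
proof -
  interpret prob_space M by fact
  have cos: "(\<integral>g. cos (t * X g) \<partial>M) = exp (- (1/2) * q t)" for t
  proof -
    have i: "integrable M (\<lambda>g. exp (\<i> * complex_of_real (t * X g)))"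
      by (rule integrable_const_bound[where B = 1]) auto
    have "(\<integral>g. Re (exp (\<i> * complex_of_real (t * X g))) \<partial>M) = exp (- (1/2) * q t)"
      unfolding integral_Re[OF i] ch by (simp only: Re_complex_of_real)
    then show ?thesis by (simp add: Re_exp)
  qed
  have even: "q (- t) = q t" for t using cos[of t] cos[of "- t"] by simp
  define t where "t n = inverse (real (Suc n))" for n
  have t: "t n > 0" for n by (simp add: t_def)
  have t0: "t \<longlonglongrightarrow> 0" unfolding t_def by (rule LIMSEQ_inverse_real_of_nat)
  have c0: "(\<integral>g. cos (0 * X g) \<partial>M) = 1" by (simp add: prob_space)
  have "(\<lambda>n. \<integral>g. cos (t n * X g) \<partial>M) \<longlonglongrightarrow> (\<integral>g. cos (0 * X g) \<partial>M)"
  proof (rule integral_dominated_convergence[where w = "\<lambda>_. 1"])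
    show "AE g in M. (\<lambda>n. cos (t n * X g)) \<longlonglongrightarrow> cos (0 * X g)"
      by (intro AE_I2 tendsto_intros t0)
  qed auto
  then have lim: "(\<lambda>n. exp (- (1/2) * q (t n))) \<longlonglongrightarrow> 1"
    unfolding c0 cos .
  have "\<forall>\<^sub>F n in sequentially. w = 0 \<or> q (t n) \<noteq> w"
  proof (cases "w = 0")
    case False
    have "\<forall>\<^sub>F n in sequentially. exp (- (1/2) * q (t n)) \<noteq> exp (- (1/2) * w)"
      by (rule tendsto_imp_eventually_ne[OF lim]) (use False in simp)
    then show ?thesis by eventually_elim auto
  qed simp
  then have qle: "\<forall>\<^sub>F n in sequentially. q (t n) \<le> (t n)\<^sup>2 * Q"
  proof eventually_elim
    case (elim n)
    from q show ?case
    proof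
      assume "\<forall>t. q t = w \<or> q t \<le> t\<^sup>2 * Q"
      then show ?thesis using elim Q by (metis mult_nonneg_nonneg zero_le_power2)
    next
      assume "\<exists>c. \<forall>t. t \<noteq> 0 \<longrightarrow> q t = w \<or> q t = t * c"
      then obtain c where c: "\<And>t. t \<noteq> 0 \<Longrightarrow> q t = w \<or> q t = t * c" by blast
      \<comment> \<open>By evenness the value at \<open>- t n\<close> is the same, so unless it is
        the junk value it equals both \<open>t n * c\<close> and its negative.\<close>
      have "q (t n) = w \<or> q (t n) = t n * c" "q (t n) = w \<or> q (t n) = - (t n * c)"
        using c[of "t n"] c[of "- t n"] t[of n] even[of "t n"] by auto
      then have "q (t n) = 0" using elim by auto
      then show ?thesis using Q by simp
    qed
  qed
  have nn: "(\<integral>\<^sup>+g. ennreal ((X g)\<^sup>2) \<partial>M) \<le> ennreal Q"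
  proof -
    define h where "h n g = 2 * (1 - cos (t n * X g)) / (t n)\<^sup>2" for n g
    have hm [measurable]: "h n \<in> borel_measurable M" for n unfolding h_def by measurable
    have h0: "h n g \<ge> 0" for n g by (simp add: h_def)
    have "(\<lambda>n. ennreal (h n g)) \<longlonglongrightarrow> ennreal ((X g)\<^sup>2)" for g
      unfolding h_def using t t0
      by (intro tendsto_ennrealI cos_second_difference_limit) (auto simp: less_imp_neq[symmetric])
    then have "(\<integral>\<^sup>+g. ennreal ((X g)\<^sup>2) \<partial>M) = (\<integral>\<^sup>+g. liminf (\<lambda>n. ennreal (h n g)) \<partial>M)"
      by (intro nn_integral_cong lim_imp_Liminf[symmetric]) simp_all
    also have "\<dots> \<le> liminf (\<lambda>n. \<integral>\<^sup>+g. ennreal (h n g) \<partial>M)"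
      by (rule nn_integral_liminf) simp
    also have "\<dots> \<le> liminf (\<lambda>n. ennreal Q)"
    proof (rule Liminf_mono)
      show "\<forall>\<^sub>F n in sequentially. (\<integral>\<^sup>+g. ennreal (h n g) \<partial>M) \<le> ennreal Q"
        using qle
      proof eventually_elim
        case (elim n)
        have ic: "integrable M (\<lambda>g. cos (t n * X g))"
          by (rule integrable_const_bound[where B = 1]) auto
        have ih: "integrable M (h n)" unfolding h_def using ic by auto
        have "(\<integral>\<^sup>+g. ennreal (h n g) \<partial>M) = ennreal (\<integral>g. h n g \<partial>M)"
          by (rule nn_integral_eq_integral[OF ih]) (simp add: h0)
        also have "(\<integral>g. h n g \<partial>M) = 2 * (1 - exp (- (1/2) * q (t n))) / (t n)\<^sup>2"
          unfolding h_def using ic cos[of "t n"] by (simp add: prob_space)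
        also have "\<dots> \<le> q (t n) / (t n)\<^sup>2"
        proof (rule divide_right_mono)
          show "2 * (1 - exp (- (1/2) * q (t n))) \<le> q (t n)"
            using exp_ge_add_one_self[of "- (1/2) * q (t n)"] by simp
        qed simp
        also have "\<dots> \<le> Q" using elim t[of n] by (simp add: pos_divide_le_eq mult.commute)
        finally show ?case by (simp add: ennreal_leI)
      qed
    qed
    also have "\<dots> = ennreal Q" by (simp add: Liminf_const)
    finally show ?thesis .
  qed
  have "integrable M (\<lambda>g. (X g)\<^sup>2)"
    using nn by (intro integrableI_bounded) (auto simp: order_le_less_trans)
  then show "X \<in> L2 M" by (simp add: L2_def)
  have "ennreal (\<integral>g. (X g)\<^sup>2 \<partial>M) = (\<integral>\<^sup>+g. ennreal ((X g)\<^sup>2) \<partial>M)"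
    by (rule nn_integral_eq_integral[symmetric]) (use \<open>integrable M (\<lambda>g. (X g)\<^sup>2)\<close> in auto)
  then have "(\<integral>g. (X g)\<^sup>2 \<partial>M) \<le> Q" using nn Q by (metis ennreal_le_iff)
  then show "(L2_norm M X)\<^sup>2 \<le> Q" by (simp add: L2_norm_eq)
qed

section \<open>Passage to the normalized densities\<close>

lemma normalized_density_bound:
  assumes "prob_space M" and d: "is_density M r" and c: "c > 0" "ennreal c \<le> eL1_norm M r"
    and C: "eL2_norm M r \<le> ennreal C" "C \<ge> 0"
  shows "prob_space (normalized_density M r)"
    and "X \<in> L2 M \<Longrightarrow> integrable (normalized_density M r) X"
    and "X \<in> L2 M \<Longrightarrow> (\<integral>g. \<bar>X g\<bar> \<partial>normalized_density M r) \<le> C / c * L2_norm M X"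
proof -
  interpret prob_space M by fact
  have r: "integrable M r" "AE g in M. 0 \<le> r g" using d by (auto simp: is_density_def)
  have [measurable]: "r \<in> borel_measurable M" using r by auto
  define I where "I = (\<integral>g. \<bar>r g\<bar> \<partial>M)"
  have eI: "eL1_norm M r = ennreal I"
    unfolding eL1_norm_def I_def by (intro nn_integral_eq_integral) (use r in auto)
  have I: "I \<ge> c" using c eI by (metis ennreal_le_iff2 not_le order.trans less_imp_le)
  have I0: "I > 0" using I c by simp
  have N: "normalized_density M r = density M (\<lambda>g. ennreal (r g / I))"
    unfolding normalized_density_def eI using I0
    by (simp add: inverse_ennreal ennreal_mult'[symmetric] divide_inverse mult.commute)
  have rI: "AE g in M. 0 \<le> r g / I" using r(2) I0 by (auto elim!: eventually_mono)
  have Ir: "I = (\<integral>g. r g \<partial>M)" unfolding I_def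
    by (rule integral_cong_AE) (use r(2) in \<open>auto elim!: eventually_mono\<close>)
  have "emeasure (density M (\<lambda>g. ennreal (r g / I))) (space M) = (\<integral>\<^sup>+g. ennreal (r g / I) \<partial>M)"
    by (subst emeasure_density) (auto intro!: nn_integral_cong)
  also have "\<dots> = ennreal (\<integral>g. r g / I \<partial>M)" by (rule nn_integral_eq_integral) (use r rI in auto)
  also have "\<dots> = 1" using I0 by (simp flip: Ir)
  finally show "prob_space (normalized_density M r)" unfolding N by (intro prob_spaceI) simp
  have rL: "r \<in> L2 M" "L2_norm M r \<le> C"
  proof -
    \<comment> \<open>The extended norm is infinite outside of L2, so its finite bound puts
      \<open>r\<close> into L2.\<close>
    show rL: "r \<in> L2 M" using C by (auto simp: eL2_norm_def top_unique split: if_splits)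
    show "L2_norm M r \<le> C" using C rL by (simp add: eL2_norm_def)
  qed
  assume X: "X \<in> L2 M"
  have [measurable]: "X \<in> borel_measurable M" using X by (simp add: L2_def)
  show "integrable (normalized_density M r) X"
    unfolding N using L2_mult_integrable[OF rL(1) X] rI
    by (subst integrable_density) (auto simp: )
  have "(\<integral>g. \<bar>X g\<bar> \<partial>normalized_density M r) = (\<integral>g. r g / I * \<bar>X g\<bar> \<partial>M)"
    unfolding N using rI by (subst integral_density) auto
  also have "\<dots> = L2_inner M r (\<lambda>g. \<bar>X g\<bar>) / I" by (simp add: L2_inner_def)
  also have "\<dots> \<le> C * L2_norm M X / I"
  proof (rule divide_right_mono)
    have aX: "(\<lambda>g. \<bar>X g\<bar>) \<in> L2 M" "L2_norm M (\<lambda>g. \<bar>X g\<bar>) = L2_norm M X"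
      using X by (auto simp: L2_def L2_norm_eq)
    show "L2_inner M r (\<lambda>g. \<bar>X g\<bar>) \<le> C * L2_norm M X"
      using L2_Cauchy_Schwarz[OF rL(1) aX(1)] mult_right_mono[OF rL(2) L2_norm_nonneg[of M X]] aX(2) by simp
  qed (use I0 in simp)
  also have "\<dots> \<le> C * L2_norm M X / c"
    using I c C L2_norm_nonneg[of M X] by (intro divide_left_mono) (auto intro!: mult_nonneg_nonneg mult_pos_pos)
  finally show "(\<integral>g. \<bar>X g\<bar> \<partial>normalized_density M r) \<le> C / c * L2_norm M X" by simp
qed

section \<open>The bound of the interacting field\<close>

lemma linear_functional_L2_to_distrib:
  assumes u: "u \<in> L2 sphere_measure"
  shows "linear_functional_on test_S (L2_to_distrib u)"
  unfolding linear_functional_on_def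
proof (intro ballI allI)
  fix f g :: "'a amb \<Rightarrow> real" and s t assume fg: "f \<in> test_S" "g \<in> test_S"
  show "L2_to_distrib u (\<lambda>x. s * f x + t * g x) = s * L2_to_distrib u f + t * L2_to_distrib u g"
    using test_S_lincomb[OF fg, of s t] fg L2_inner_lincomb_right[OF test_S_L2 test_S_L2 u, of f g s t]
    by (simp add: L2_to_distrib_def)
qed

text \<open>The functional is continuous even for the supremum norm on the sphere, with the L1 norm
  of \<open>u\<close> as constant. Hence neighbourhoods given by derivatives of order 0 are
  enough.\<close>

lemma L2_to_distrib_in_distrib_S:
  fixes u :: "'n::finite amb \<Rightarrow> real"
  assumes u: "u \<in> L2 sphere_measure"
  shows "L2_to_distrib u \<in> distrib_S"
proof -
  let ?\<phi> = "L2_to_distrib u" and ?S = "sphere_measure :: 'n amb measure"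
  interpret finite_measure ?S by (rule finite_sphere_measure)
  define I where "I = (\<integral>x. \<bar>u x\<bar> \<partial>?S)"
  have I0: "I \<ge> 0" unfolding I_def by (rule Bochner_Integration.integral_nonneg) simp
  have ui: "integrable ?S u" by (rule L2_integrable[OF u])
  have lin: "?\<phi> (\<lambda>x. f x + v x) = ?\<phi> f + ?\<phi> v" if "f \<in> test_S" "v \<in> test_S" for f v
    using linear_functional_L2_to_distrib[OF u, unfolded linear_functional_on_def, rule_format, OF that, of 1 1]
    by simp
  have small: "\<bar>?\<phi> v\<bar> \<le> d * I" if v: "v \<in> test_S" and d: "\<And>x. x \<in> Sph \<Longrightarrow> \<bar>v x\<bar> < d" and "d > 0" for v d
  proof -
    have vd: "\<bar>v x\<bar> \<le> d" for x
      using d[of x] test_S_zero[OF v, of x] \<open>d > 0\<close> by (cases "x \<in> Sph") auto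
    have "\<bar>?\<phi> v\<bar> = \<bar>\<integral>x. u x * v x \<partial>?S\<bar>" using v by (simp add: L2_to_distrib_def L2_inner_def)
    also have "\<dots> \<le> (\<integral>x. \<bar>u x * v x\<bar> \<partial>?S)" by (rule integral_abs_bound)
    also have "\<dots> \<le> (\<integral>x. d * \<bar>u x\<bar> \<partial>?S)"
    proof (rule integral_mono')
      show "integrable ?S (\<lambda>x. d * \<bar>u x\<bar>)" using ui by auto
      show "\<bar>u x * v x\<bar> \<le> d * \<bar>u x\<bar>" for x
        unfolding abs_mult using mult_right_mono[OF vd[of x] abs_ge_zero[of "u x"]] by (simp add: mult.commute)
    qed (use \<open>d > 0\<close> in simp)
    finally show ?thesis by (simp add: I_def)
  qed
  have "continuous_map test_S_topology euclideanreal ?\<phi>"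
    unfolding continuous_map_def topspace_test_S_topology
  proof (intro conjI allI impI)
    fix W :: "real set" assume W: "openin euclideanreal W"
    show "openin test_S_topology {f \<in> test_S. ?\<phi> f \<in> W}"
      unfolding openin_test_S_topology
    proof (intro conjI ballI)
      fix f assume "f \<in> {f \<in> test_S. ?\<phi> f \<in> W}"
      then have f: "f \<in> test_S" "?\<phi> f \<in> W" by auto
      obtain e where e: "e > 0" "\<And>y. dist y (?\<phi> f) < e \<Longrightarrow> y \<in> W"
        using W f(2) by (auto simp: open_dist)
      let ?V = "{v \<in> test_S. \<bar>?\<phi> v\<bar> < e}"
      have "nbhd0_S ?V"
        unfolding nbhd0_S_def
      proof (intro exI[of _ "0::nat"] exI[of _ "e / (I + 1)"] conjI subsetI)
        show "e / (I + 1) > 0" using e I0 by simp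
        fix v :: "'n amb \<Rightarrow> real" assume "v \<in> {f \<in> test_S. \<forall>L x. set L \<subseteq> Basis \<and> length L \<le> 0 \<and> x \<in> Sph \<longrightarrow>
          \<bar>iter_deriv L (\<lambda>x. f (sgn x)) x\<bar> < e / (I + 1)}"
        then have v: "v \<in> test_S" and vd: "\<And>x. x \<in> Sph \<Longrightarrow> \<bar>v x\<bar> < e / (I + 1)"
          by (auto simp: sgn_Sph)
        have "\<bar>?\<phi> v\<bar> \<le> e / (I + 1) * I" using small[OF v vd] e I0 by simp
        also have "\<dots> < e" using e I0 by (simp add: field_simps)
        finally show "v \<in> ?V" using v by simp
      qed
      moreover have "(\<lambda>x. f x + v x) \<in> {f \<in> test_S. ?\<phi> f \<in> W}" if "v \<in> ?V" for v
      proof -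
        have v: "v \<in> test_S" "\<bar>?\<phi> v\<bar> < e" using that by simp_all
        have "?\<phi> (\<lambda>x. f x + v x) \<in> W"
          unfolding lin[OF f(1) v(1)] by (rule e(2)) (use v(2) in \<open>simp add: dist_real_def\<close>)
        then show ?thesis using test_S_lincomb[OF f(1) v(1), of 1 1] by simp
      qed
      ultimately show "\<exists>V. V \<subseteq> test_S \<and> nbhd0_S V \<and> (\<forall>v\<in>V. (\<lambda>x. f x + v x) \<in> {f \<in> test_S. ?\<phi> f \<in> W})"
        by (intro exI[of _ ?V]) auto
    qed auto
  qed auto
  then show ?thesis
    using linear_functional_L2_to_distrib[OF u] by (simp add: distrib_S_def L2_to_distrib_def)
qed

text \<open>Along the multiples \<open>t * u\<close> of a fixed \<open>u\<close> the characteristic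
  functional is the characteristic function of the single random variable \<open>?X\<close>, and its
  behaviour near t = 0 bounds the second moment.\<close>

lemma gaussian_field_bound:
  fixes u :: "'n::finite amb \<Rightarrow> real"
  assumes m: "m > 0" and k: "k \<ge> 1" and a: "smooth_kernel (a k)"
    and M: "gaussian_measure_S (C_tilde m a k) M"
    and u: "u \<in> L2 sphere_measure" and b: "L2_norm sphere_measure (L2_op (a k) u) \<le> b"
  shows "(\<lambda>g. L2_inner sphere_measure g u) \<in> L2 M"
    and "L2_norm M (\<lambda>g. L2_inner sphere_measure g u) \<le> b / m"
proof -
  let ?X = "\<lambda>g. L2_inner sphere_measure g u"
  have sp: "space M = test_S" "prob_space M"
    and rad: "space M = topspace test_S_topology" "sets M = sigma_sets (topspace test_S_topology) {U. openin test_S_topology U}"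
    using M by (auto simp: gaussian_measure_S_def radon_prob_def topspace_test_S_topology)
  have eq: "L2_to_distrib (\<lambda>x. t * u x) g = t * ?X g" if "g \<in> space M" for g t
    using that sp by (simp add: L2_to_distrib_def L2_inner_commute[of _ _ g] L2_inner_scale_right)
  have "continuous_map test_S_topology euclideanreal (L2_to_distrib (\<lambda>x. 1 * u x))"
    using L2_to_distrib_in_distrib_S[OF L2_scale[OF u, of 1]] unfolding distrib_S_def by blast
  from continuous_map_borel_measurable[OF this rad]
  have L1: "L2_to_distrib (\<lambda>x. 1 * u x) \<in> borel_measurable M" .
  have e1: "?X g = L2_to_distrib (\<lambda>x. 1 * u x) g" if "g \<in> space M" for g
    by (rule trans[OF _ eq[OF that, of 1, symmetric]]) simp
  have Xm: "?X \<in> borel_measurable M" by (rule iffD2[OF measurable_cong L1]) (rule e1)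
  define q where "q t = L2_to_distrib (\<lambda>x. t * u x) (C_tilde m a k (L2_to_distrib (\<lambda>x. t * u x)))" for t
  have ch: "(\<integral>g. exp (\<i> * complex_of_real (t * ?X g)) \<partial>M) = complex_of_real (exp (- (1/2) * q t))" for t
  proof -
    have "(\<integral>g. exp (\<i> * complex_of_real (t * ?X g)) \<partial>M)
        = (\<integral>g. exp (\<i> * complex_of_real (L2_to_distrib (\<lambda>x. t * u x) g)) \<partial>M)"
      by (rule Bochner_Integration.integral_cong) (simp_all add: eq)
    then show ?thesis
      using M L2_to_distrib_in_distrib_S[OF L2_scale[OF u, of t]]
      by (simp add: gaussian_measure_S_def q_def)
  qed
  note * = second_moment_le[OF sp(2) Xm ch C_tilde_form_cases[where a = a, OF m k a u b, folded q_def]]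
  show "?X \<in> L2 M" by (rule *) simp
  have b0: "b \<ge> 0" using b L2_norm_nonneg[of sphere_measure "L2_op (a k) u"] by linarith
  have "(L2_norm M ?X)\<^sup>2 \<le> b\<^sup>2 / m\<^sup>2" by (rule *) simp
  then have "(L2_norm M ?X)\<^sup>2 \<le> (b / m)\<^sup>2" by (simp add: power_divide)
  then show "L2_norm M ?X \<le> b / m" using power2_le_imp_le[of _ "b / m"] b0 m by simp
qed

lemma interacting_field_bound:
  fixes a :: "nat \<Rightarrow> 'n::finite amb \<Rightarrow> 'n amb \<Rightarrow> real"
  assumes m: "m > 0" and a: "isometry_invariant_mollifiers a"
    and M: "\<And>k. k \<ge> 1 \<Longrightarrow> gaussian_measure_S (C_tilde m a k) (M k)"
    and d: "\<And>k. k \<ge> 1 \<Longrightarrow> is_density (M k) (\<rho> k)"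
    and inf: "(INF k\<in>{1..}. eL1_norm (M k) (\<rho> k)) > 0"
    and sup: "(SUP k\<in>{1..}. eL2_norm (M k) (\<rho> k)) < \<infinity>"
  shows "\<exists>K\<ge>0. \<forall>k\<ge>1. prob_space (normalized_density (M k) (\<rho> k)) \<and> (\<forall>f\<in>L2 lborel.
    integrable (normalized_density (M k) (\<rho> k)) (\<lambda>g. L2_inner sphere_measure g (to_sphere k f)) \<and>
    (\<integral>g. \<bar>L2_inner sphere_measure g (to_sphere k f)\<bar> \<partial>normalized_density (M k) (\<rho> k)) \<le> K * L2_norm lborel f)"
proof -
  let ?S = "sphere_measure :: 'n amb measure"
  have sk: "smooth_kernel (a k)" if "k \<ge> 1" for k
    using a that unfolding isometry_invariant_mollifiers_def by blast
  obtain B where "\<And>k f. k \<ge> 1 \<Longrightarrow> f \<in> L2 ?S \<Longrightarrow> L2_norm ?S (L2_op (a k) f) \<le> B * L2_norm ?S f"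
    using a unfolding isometry_invariant_mollifiers_def by blast
  \<comment> \<open>\<open>\<bar>B\<bar>\<close> makes the final constant nonnegative: the sign of
    \<open>B\<close> is not part of the definition of the mollifiers.\<close>
  then have B: "L2_norm ?S (L2_op (a k) f) \<le> \<bar>B\<bar> * L2_norm ?S f" if "k \<ge> 1" "f \<in> L2 ?S" for k f
    using that L2_norm_nonneg[of ?S f] by (meson abs_ge_self mult_right_mono order_trans)
  obtain c' where c': "0 < c'" "c' < (INF k\<in>{1..}. eL1_norm (M k) (\<rho> k))" using dense[OF inf] by blast
  then obtain c where c: "c' = ennreal c" "c \<ge> 0" by (cases c') auto
  have c0: "c > 0" using c c' by (cases "c = 0") auto
  have cL: "ennreal c \<le> eL1_norm (M k) (\<rho> k)" if "k \<ge> 1" for k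
    using c' c that by (meson INF_lower atLeast_iff less_le_trans order.strict_implies_order)
  obtain C where C: "(SUP k\<in>{1..}. eL2_norm (M k) (\<rho> k)) = ennreal C" "C \<ge> 0"
    using sup unfolding infinity_ennreal_def less_top_ennreal by blast
  have CL: "eL2_norm (M k) (\<rho> k) \<le> ennreal C" if "k \<ge> 1" for k
    using that unfolding C(1)[symmetric] by (intro SUP_upper) simp
  have P: "prob_space (M k)" if "k \<ge> 1" for k
    using M[OF that] by (simp add: gaussian_measure_S_def radon_prob_def)
  note N = normalized_density_bound[OF P d c0 cL CL C(2)]
  have G: "(\<lambda>g. L2_inner ?S g (to_sphere k f)) \<in> L2 (M k)"
    "L2_norm (M k) (\<lambda>g. L2_inner ?S g (to_sphere k f)) \<le> \<bar>B\<bar> * L2_norm lborel f / m"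
    if k: "k \<ge> 1" and f: "f \<in> L2 lborel" for k f
    using gaussian_field_bound[where a = a, OF m k sk[OF k] M[OF k] U_L2(1)[OF k f] B[OF k U_L2(1)[OF k f]]]
    by (simp_all add: U_L2(2)[OF k f])
  show ?thesis
  proof (intro exI[of _ "C / c * (\<bar>B\<bar> / m)"] conjI allI impI ballI)
    show "C / c * (\<bar>B\<bar> / m) \<ge> 0" using C c0 m by simp
    fix k :: nat and f :: "real^'n \<Rightarrow> real" assume k: "k \<ge> 1" and f: "f \<in> L2 lborel"
    show "integrable (normalized_density (M k) (\<rho> k)) (\<lambda>g. L2_inner ?S g (to_sphere k f))"
      by (rule N(2)) (use k G[OF k f] in auto)
    have "(\<integral>g. \<bar>L2_inner ?S g (to_sphere k f)\<bar> \<partial>normalized_density (M k) (\<rho> k))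
        \<le> C / c * L2_norm (M k) (\<lambda>g. L2_inner ?S g (to_sphere k f))"
      by (rule N(3)) (use k G[OF k f] in auto)
    also have "\<dots> \<le> C / c * (\<bar>B\<bar> * L2_norm lborel f / m)"
      using C c0 G(2)[OF k f] by (intro mult_left_mono) auto
    finally show "(\<integral>g. \<bar>L2_inner ?S g (to_sphere k f)\<bar> \<partial>normalized_density (M k) (\<rho> k)) \<le> C / c * (\<bar>B\<bar> / m) * L2_norm lborel f"
      by simp
  next
    fix k :: nat assume "k \<ge> 1"
    then show "prob_space (normalized_density (M k) (\<rho> k))" by (intro N(1)) auto
  qed
qed

section \<open>Weak limits of sequences of random variables\<close>

text \<open>If \<open>t\<close> is in the Cantor set, then \<open>3 ^ n * t\<close> is an even integer plus a remainder in
  \<open>[0, 1/3]\<close> or \<open>[2/3, 1]\<close>, according to the next ternary digit; the truncated cosine tells these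
  intervals apart and is continuous on the whole line.\<close>

definition cantor_digit :: "nat \<Rightarrow> real \<Rightarrow> real" where
  "cantor_digit n t = max 0 (min 1 (1/2 - cos (pi * (3 ^ n * t))))"

text \<open>The point of the Cantor set whose ternary digits, all 0 or 2, are given by
  \<open>b\<close>.\<close>

definition cantor_encode :: "(nat \<Rightarrow> bool) \<Rightarrow> real" where
  "cantor_encode b = (\<Sum>n. 2 * of_bool (b n) / 3 ^ Suc n)"

lemma cantor_summable: "summable (\<lambda>n. 2 * of_bool (b n) / 3 ^ Suc n :: real)"
proof (rule summable_comparison_test')
  show "summable (\<lambda>n. (1 / 3) ^ n :: real)" by (rule summable_geometric) simp
  show "norm (2 * of_bool (b n) / 3 ^ Suc n :: real) \<le> (1 / 3) ^ n" for n
    by (simp add: power_one_over field_simps)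
qed

lemma cantor_encode_bounds: "0 \<le> cantor_encode b" "cantor_encode b \<le> 1"
proof -
  show "0 \<le> cantor_encode b" unfolding cantor_encode_def
    by (intro suminf_nonneg cantor_summable) auto
  have "(\<lambda>n. (2 / 3) * (1 / 3) ^ n :: real) sums ((2 / 3) * (1 / (1 - 1 / 3)))"
    by (intro sums_mult geometric_sums) simp
  then have s: "(\<lambda>n. (2 / 3) * (1 / 3) ^ n :: real) sums 1" by simp
  have "cantor_encode b \<le> (\<Sum>n. (2 / 3) * (1 / 3) ^ n :: real)" unfolding cantor_encode_def
    by (intro suminf_le cantor_summable sums_summable[OF s]) (simp add: power_one_over)
  then show "cantor_encode b \<le> 1" using sums_unique[OF s] by simp
qed

lemma cantor_encode_shift:
  "3 ^ n * cantor_encode b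
     = 2 * (\<Sum>i<n. of_bool (b i) * 3 ^ (n - Suc i)) + cantor_encode (\<lambda>i. b (i + n))"
proof -
  have "cantor_encode b = (\<Sum>i. 2 * of_bool (b (i + n)) / 3 ^ Suc (i + n)) + (\<Sum>i<n. 2 * of_bool (b i) / 3 ^ Suc i)"
    unfolding cantor_encode_def by (rule suminf_split_initial_segment[OF cantor_summable])
  also have "(\<Sum>i. 2 * of_bool (b (i + n)) / 3 ^ Suc (i + n) :: real)
      = (\<Sum>i. (1 / 3 ^ n) * (2 * of_bool (b (i + n)) / 3 ^ Suc i))"
    by (simp add: power_add mult_ac)
  also have "\<dots> = (1 / 3 ^ n) * cantor_encode (\<lambda>i. b (i + n))"
    unfolding cantor_encode_def by (intro suminf_mult cantor_summable)
  finally have "3 ^ n * cantor_encode b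
     = cantor_encode (\<lambda>i. b (i + n)) + (\<Sum>i<n. 3 ^ n * (2 * of_bool (b i) / 3 ^ Suc i))"
    by (simp add: distrib_left sum_distrib_left)
  also have "(\<Sum>i<n. 3 ^ n * (2 * of_bool (b i) / 3 ^ Suc i)) = (\<Sum>i<n. 2 * (of_bool (b i) * 3 ^ (n - Suc i)) :: real)"
  proof (rule sum.cong)
    fix i assume "i \<in> {..<n}"
    then have "(3::real) ^ n = 3 ^ (n - Suc i) * 3 ^ Suc i"
      by (metis add.commute le_add_diff_inverse lessThan_iff power_add Suc_leI)
    then show "3 ^ n * (2 * of_bool (b i) / 3 ^ Suc i) = 2 * (of_bool (b i) * 3 ^ (n - Suc i) :: real)"
      by simp
  qed simp
  finally show ?thesis unfolding sum_distrib_left by (simp only: add.commute)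
qed

text \<open>For the remainder r, cos(pi r) is at most -1/2 on [2/3, 1] and at least 1/2 on [0, 1/3],
  so truncating 1/2 - cos(pi r) to [0, 1] yields exactly 1 or 0.\<close>

lemma cantor_digit_encode: "cantor_digit n (cantor_encode b) = of_bool (b n)"
proof -
  define r where "r = cantor_encode (\<lambda>i. b (i + n))"
  define N where "N = (\<Sum>i<n. of_bool (b i) * 3 ^ (n - Suc i) :: nat)"
  have "3 ^ n * cantor_encode b = 2 * real N + r"
    unfolding cantor_encode_shift[of n b] r_def N_def by simp
  then have "cos (pi * (3 ^ n * cantor_encode b)) = cos (pi * r + 2 * real N * pi)"
    by (simp add: algebra_simps)
  also have "\<dots> = cos (pi * r)"
    using cos.plus_of_nat[of "pi * r" N] by (simp add: mult_ac)
  finally have c: "cos (pi * (3 ^ n * cantor_encode b)) = cos (pi * r)" .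
  define r' where "r' = cantor_encode (\<lambda>i. b (i + Suc n))"
  have "3 * r = 2 * of_bool (b n) + r'"
    using cantor_encode_shift[of 1 "\<lambda>i. b (i + n)"] by (simp add: r_def r'_def)
  moreover have "0 \<le> r'" "r' \<le> 1" by (simp_all add: r'_def cantor_encode_bounds)
  ultimately have r: "b n \<Longrightarrow> 2 / 3 \<le> r \<and> r \<le> 1" "\<not> b n \<Longrightarrow> 0 \<le> r \<and> r \<le> 1 / 3"
    by auto
  show ?thesis
  proof (cases "b n")
    case True
    have "cos (pi * r) \<le> cos (2 * pi / 3)"
      using r(1)[OF True] mult_left_mono[of "2/3" r pi] mult_left_mono[of r 1 pi]
      by (intro cos_monotone_0_pi_le) auto
    then show ?thesis using True c by (simp add: cantor_digit_def cos_120)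
  next
    case False
    have "cos (pi / 3) \<le> cos (pi * r)"
      using r(2)[OF False] mult_left_mono[of r "1/3" pi]
      by (intro cos_monotone_0_pi_le) auto
    then show ?thesis using False c by (simp add: cantor_digit_def cos_60)
  qed
qed

text \<open>Coordinate \<open>j\<close> of Schoenberg's curve: the Cantor digits numbered
  \<open>prod_encode (j, i)\<close> are read as the binary expansion of one number.\<close>

definition cube_decode :: "nat \<Rightarrow> real \<Rightarrow> real" where
  "cube_decode j t = (\<Sum>i. cantor_digit (prod_encode (j, i)) t / 2 ^ Suc i)"

text \<open>A Borel right inverse of the curve on sequences in [0, 1). The parity of the floor is
  the binary digit of the selected coordinate.\<close>

definition cube_encode :: "(nat \<Rightarrow> real) \<Rightarrow> real" where
  "cube_encode x = cantor_encode (\<lambda>n. odd \<lfloor>2 ^ Suc (snd (prod_decode n)) * x (fst (prod_decode n))\<rfloor>)"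

text \<open>The partial sums are the dyadic truncations floor(2^n x) / 2^n.\<close>

lemma binary_digits_sums:
  fixes x :: real
  assumes "0 \<le> x" "x < 1"
  shows "(\<lambda>i. of_bool (odd \<lfloor>2 ^ Suc i * x\<rfloor>) / 2 ^ Suc i) sums x"
proof -
  have part: "(\<Sum>i<n. of_bool (odd \<lfloor>2 ^ Suc i * x\<rfloor>) / 2 ^ Suc i) = (of_int \<lfloor>2 ^ n * x\<rfloor> / 2 ^ n :: real)" for n
  proof (induction n)
    case 0
    have "\<lfloor>x\<rfloor> = 0" using assms by linarith
    then show ?case by simp
  next
    case (Suc n)
    define k where "k = \<lfloor>2 ^ n * x\<rfloor>"
    define l where "l = \<lfloor>2 ^ Suc n * x\<rfloor>"
    have "l = 2 * k \<or> l = 2 * k + 1" unfolding k_def l_def power_Suc mult.assoc by linarith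
    then have "l = 2 * k + of_bool (odd l)" by auto
    then have "of_int l = 2 * of_int k + (of_bool (odd l) :: real)"
      by (metis of_int_add of_int_mult of_int_numeral of_int_of_bool)
    then have "of_int l / 2 ^ Suc n = (of_int k / 2 ^ n + of_bool (odd l) / 2 ^ Suc n :: real)"
      by (simp add: field_simps)
    then show ?case using Suc by (simp add: k_def l_def)
  qed
  have "(\<lambda>n. of_int \<lfloor>2 ^ n * x\<rfloor> / 2 ^ n) \<longlonglongrightarrow> x"
  proof (rule tendsto_sandwich)
    have "(\<lambda>n. x - (1 / 2) ^ n) \<longlonglongrightarrow> x - 0" by (intro tendsto_intros LIMSEQ_power_zero) simp
    then show "(\<lambda>n. x - (1 / 2) ^ n) \<longlonglongrightarrow> x" by simp
    have fl: "x - (1 / 2) ^ n \<le> of_int \<lfloor>2 ^ n * x\<rfloor> / 2 ^ n" "of_int \<lfloor>2 ^ n * x\<rfloor> / 2 ^ n \<le> x" for n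
    proof -
      have "2 ^ n * x - 1 \<le> of_int \<lfloor>2 ^ n * x\<rfloor>" "of_int \<lfloor>2 ^ n * x\<rfloor> \<le> 2 ^ n * x" by linarith+
      then have "(2 ^ n * x - 1) / 2 ^ n \<le> of_int \<lfloor>2 ^ n * x\<rfloor> / 2 ^ n" "of_int \<lfloor>2 ^ n * x\<rfloor> / 2 ^ n \<le> (2 ^ n * x) / 2 ^ n"
        by (intro divide_right_mono; simp)+
      then show "x - (1 / 2) ^ n \<le> of_int \<lfloor>2 ^ n * x\<rfloor> / 2 ^ n" "of_int \<lfloor>2 ^ n * x\<rfloor> / 2 ^ n \<le> x"
        by (simp_all add: diff_divide_distrib power_one_over)
    qed
    then show "\<forall>\<^sub>F n in sequentially. x - (1 / 2) ^ n \<le> of_int \<lfloor>2 ^ n * x\<rfloor> / 2 ^ n"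
      "\<forall>\<^sub>F n in sequentially. of_int \<lfloor>2 ^ n * x\<rfloor> / 2 ^ n \<le> x" by auto
  qed simp
  then show ?thesis unfolding sums_def part .
qed

lemma cube_decode_encode:
  assumes "0 \<le> x j" "x j < 1" shows "cube_decode j (cube_encode x) = x j"
proof -
  have "cube_decode j (cube_encode x) = (\<Sum>i. of_bool (odd \<lfloor>2 ^ Suc i * x j\<rfloor>) / 2 ^ Suc i)"
    by (simp add: cube_decode_def cube_encode_def cantor_digit_encode)
  then show ?thesis using sums_unique[OF binary_digits_sums[OF assms]] by simp
qed

lemma cantor_digit_bounds: "0 \<le> cantor_digit n t" "cantor_digit n t \<le> 1"
  by (auto simp: cantor_digit_def)

lemma half_power_sums: "(\<lambda>i. 1 / 2 ^ Suc i :: real) sums 1"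
  using sums_mult[OF geometric_sums[of "1/2 :: real"], of "1/2"] by (simp add: power_one_over)

lemma cube_decode_summable: "summable (\<lambda>i. cantor_digit (f i) t / 2 ^ Suc i)"
  by (rule summable_comparison_test'[OF sums_summable[OF half_power_sums]])
    (simp add: cantor_digit_bounds divide_right_mono)

lemma cube_decode_bounds: "0 \<le> cube_decode j t" "cube_decode j t \<le> 1"
proof -
  show "0 \<le> cube_decode j t" unfolding cube_decode_def
    by (intro suminf_nonneg cube_decode_summable) (simp add: cantor_digit_bounds)
  have "cube_decode j t \<le> (\<Sum>i. 1 / 2 ^ Suc i)" unfolding cube_decode_def
    by (intro suminf_le cube_decode_summable sums_summable[OF half_power_sums])
      (simp add: cantor_digit_bounds divide_right_mono)
  then show "cube_decode j t \<le> 1" using sums_unique[OF half_power_sums] by simp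
qed

lemma continuous_on_cube_decode: "continuous_on UNIV (cube_decode j)"
proof -
  let ?g = "\<lambda>i t. cantor_digit (prod_encode (j, i)) t / 2 ^ Suc i"
  have "uniform_limit UNIV (\<lambda>n t. \<Sum>i<n. ?g i t) (\<lambda>t. \<Sum>i. ?g i t) sequentially"
    by (rule Weierstrass_m_test[where M = "\<lambda>i. 1 / 2 ^ Suc i"])
      (simp_all add: cantor_digit_bounds divide_right_mono sums_summable[OF half_power_sums] del: power_Suc)
  then show ?thesis unfolding cube_decode_def
    by (rule uniform_limit_theorem[rotated])
      (auto simp: cantor_digit_def intro!: always_eventually continuous_intros)
qed

lemma cube_encode_bounds: "0 \<le> cube_encode x" "cube_encode x \<le> 1"
  by (simp_all add: cube_encode_def cantor_encode_bounds)

lemma measurable_cube_encode: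
  assumes [measurable]: "\<And>j. X j \<in> borel_measurable M"
  shows "(\<lambda>\<omega>. cube_encode (\<lambda>j. X j \<omega>)) \<in> borel_measurable M"
  unfolding cube_encode_def cantor_encode_def of_bool_def by measurable

text \<open>The values are squeezed into (0, 1) by \<open>\<theta>\<close>, and a whole sequence of
  them is encoded as one number \<open>E k x\<close>. The laws of the codes live on [0, 1], so
  Helly's theorem gives a weak limit. Decoding is continuous on the line and exact on the codes, so
  the limit holds for functions of finitely many coordinates once the points that decode to 0 or 1,
  which stand for infinite values, are known to be null. This is where the moment bound
  \<open>b\<close> enters.\<close>

lemma weak_limit_sequence:
  fixes P :: "nat \<Rightarrow> 'a measure" and Y :: "nat \<Rightarrow> nat \<Rightarrow> 'a \<Rightarrow> real"
  assumes P: "\<And>k. prob_space (P k)" and Y: "\<And>k n. integrable (P k) (Y k n)"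
    and b: "\<And>k n. (\<integral>x. \<bar>Y k n x\<bar> \<partial>P k) \<le> b n"
  obtains r :: "nat \<Rightarrow> nat" and \<nu> :: "real measure" and Z :: "nat \<Rightarrow> real \<Rightarrow> real" and \<Gamma> :: "real set"
  where "strict_mono r" "real_distribution \<nu>" "\<Gamma> \<in> sets borel" "measure \<nu> \<Gamma> = 1"
    "\<And>n. Z n \<in> borel_measurable borel" "\<And>n. continuous_on \<Gamma> (Z n)"
    "\<And>H B J c. (\<And>x. isCont H x) \<Longrightarrow> (\<And>x. \<bar>H x :: real\<bar> \<le> B) \<Longrightarrow> finite J \<Longrightarrow>
       (\<lambda>j. \<integral>x. H (\<Sum>n\<in>J. c n * Y (r j) n x) \<partial>P (r j)) \<longlonglongrightarrow> (\<integral>t. H (\<Sum>n\<in>J. c n * Z n t) \<partial>\<nu>)"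
proof -
  have Ym [measurable]: "Y k n \<in> borel_measurable (P k)" for k n using Y by auto
  define \<theta> where "\<theta> y = 1/2 + arctan y / pi" for y :: real
  have \<theta>: "0 < \<theta> y" "\<theta> y < 1" for y
    using arctan_lbound[of y] arctan_ubound[of y] by (simp_all add: \<theta>_def field_simps)
  have \<theta>tan: "tan (pi * (\<theta> y - 1/2)) = y" for y by (simp add: \<theta>_def tan_arctan)
  have \<theta>m [measurable]: "\<theta> \<in> borel_measurable borel" unfolding \<theta>_def by measurable
  define E where "E k x = cube_encode (\<lambda>n. \<theta> (Y k n x))" for k x
  have Em [measurable]: "E k \<in> borel_measurable (P k)" for k
    unfolding E_def by (intro measurable_cube_encode) measurable
  have dec: "cube_decode n (E k x) = \<theta> (Y k n x)" for k n x
    unfolding E_def using \<theta> by (intro cube_decode_encode) (auto simp: less_imp_le)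
  define \<mu> where "\<mu> k = distr (P k) borel (E k)" for k
  have \<mu>: "real_distribution (\<mu> k)" for k
    unfolding \<mu>_def using prob_space.real_distribution_distr[OF P Em] .
  \<comment> \<open>The interval is half-open because \<open>tight\<close> asks for one of this
    form; the codes lie in [0, 1].\<close>
  have "measure (\<mu> k) {-1<..1} = 1" for k
  proof -
    interpret prob_space "P k" by (rule P)
    have "-1 < E k x \<and> E k x \<le> 1" for x
      using cube_encode_bounds[of "\<lambda>n. \<theta> (Y k n x)"] unfolding E_def by linarith
    then have "E k -` {-1<..1} \<inter> space (P k) = space (P k)"
      by auto
    then show ?thesis by (simp add: \<mu>_def measure_distr prob_space)
  qed
  then have "tight \<mu>" unfolding tight_def using \<mu>
    by (intro conjI allI impI exI[of _ "-1"] exI[of _ "1::real"]) simp_all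
  from tight_imp_convergent_subsubsequence[OF this strict_mono_id]
  obtain r \<nu> where r: "strict_mono r" and \<nu>: "real_distribution \<nu>" and "weak_conv_m (\<mu> \<circ> id \<circ> r) \<nu>"
    by blast
  then have wc: "weak_conv_m (\<lambda>j. \<mu> (r j)) \<nu>" by (simp add: o_def)
  interpret \<nu>: real_distribution \<nu> by (rule \<nu>)
  have \<mu>r: "real_distribution (\<mu> (r j))" for j by (rule \<mu>)
  have gcont: "isCont (cube_decode n) t" for n t
    using continuous_on_cube_decode by (simp add: continuous_on_eq_continuous_at)
  have gm [measurable]: "cube_decode n \<in> borel_measurable borel" for n
    by (rule borel_measurable_continuous_onI[OF continuous_on_cube_decode])
  \<comment> \<open>\<open>\<theta>\<close> is inverted after decoding. Decoded values 0 and 1 would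
    have to be sent to infinity; \<open>\<Gamma>\<close> leaves them out.\<close>
  define Z where "Z n t = tan (pi * (cube_decode n t - 1/2))" for n t
  have sc: "cos (pi * (x - 1/2)) = sin (pi * x)" "sin (pi * (x - 1/2)) = - cos (pi * x)" for x :: real
    by (simp_all add: right_diff_distrib cos_diff sin_diff)
  have Zm [measurable]: "Z n \<in> borel_measurable borel" for n
    unfolding Z_def tan_def by measurable
  define \<Gamma> where "\<Gamma> = {t. \<forall>n. cube_decode n t \<noteq> 0 \<and> cube_decode n t \<noteq> 1}"
  have \<Gamma>m [measurable]: "\<Gamma> \<in> sets borel" unfolding \<Gamma>_def by measurable
  have Zcont: "isCont (Z n) t" if "cube_decode n t \<noteq> 0" "cube_decode n t \<noteq> 1" for n t
  proof -
    have "0 < cube_decode n t" "cube_decode n t < 1"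
      using that cube_decode_bounds[of n t] by auto
    then have "sin (pi * cube_decode n t) > 0" by (intro sin_gt_zero) auto
    then show ?thesis unfolding Z_def
      by (intro isCont_tan' continuous_intros gcont) (simp add: sc)
  qed
  have bad: "emeasure \<nu> {t. cube_decode n t = 0 \<or> cube_decode n t = 1} = 0" for n
  proof -
    let ?bad = "{t. cube_decode n t = 0 \<or> cube_decode n t = 1}"
    have bm [measurable]: "?bad \<in> sets borel" by measurable
    have "real N * measure \<nu> ?bad \<le> b n" if N: "N > 0" for N :: nat
    proof -
      \<comment> \<open>A continuous minorant, bounded by \<open>N\<close>, of the modulus of the
        cotangent, which is that of \<open>Z n\<close>: the summand \<open>1 / real N\<close> keeps
        the denominator away from 0. On the bad set \<open>w\<close> equals \<open>N\<close>, so its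
        mean, which is at most \<open>b n\<close>, limits the measure of this set to
        \<open>b n / N\<close>.\<close>
      define w where "w t = \<bar>cos (pi * cube_decode n t)\<bar> / (sin (pi * cube_decode n t) + 1 / real N)" for t
      have sn: "sin (pi * cube_decode n t) \<ge> 0" for t
        using cube_decode_bounds[of n t] mult_left_mono[of "cube_decode n t" 1 pi] by (intro sin_ge_zero) auto
      have sp: "sin (pi * cube_decode n t) + 1 / real N > 0" for t
        using sn[of t] N by (intro add_nonneg_pos) auto
      have wm [measurable]: "w \<in> borel_measurable borel" unfolding w_def by measurable
      have wc': "isCont w t" for t
        unfolding w_def using sp[of t] by (intro continuous_intros gcont) auto
      have w0: "0 \<le> w t" for t unfolding w_def using sp[of t] by simp
      have wN: "w t \<le> real N" for t
      proof -
        have "w t \<le> 1 / (1 / real N)"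
          unfolding w_def using N sn[of t] by (intro frac_le) auto
        then show ?thesis by simp
      qed
      have "(\<lambda>j. integral\<^sup>L (\<mu> (r j)) w) \<longlonglongrightarrow> integral\<^sup>L \<nu> w"
        by (rule weak_conv_imp_integral_bdd_continuous_conv[OF \<mu>r \<nu> wc wc', where B = "real N"])
          (use w0 wN in auto)
      moreover have "integral\<^sup>L (\<mu> k) w \<le> b n" for k
      proof -
        interpret Pk: prob_space "P k" by (rule P)
        have wY: "w (E k x) \<le> \<bar>Y k n x\<bar>" for x
        proof -
          have s: "sin (pi * \<theta> (Y k n x)) > 0" using \<theta>[of "Y k n x"] by (intro sin_gt_zero) auto
          have "w (E k x) \<le> \<bar>cos (pi * \<theta> (Y k n x))\<bar> / sin (pi * \<theta> (Y k n x))"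
            unfolding w_def dec using s N by (intro divide_left_mono) (auto intro!: mult_pos_pos add_pos_pos)
          also have "\<dots> = \<bar>tan (pi * (\<theta> (Y k n x) - 1/2))\<bar>"
            using s by (simp add: tan_def sc abs_divide)
          finally show ?thesis by (simp only: \<theta>tan)
        qed
        have "integral\<^sup>L (\<mu> k) w = (\<integral>x. w (E k x) \<partial>P k)"
          unfolding \<mu>_def by (rule integral_distr) measurable
        also have "\<dots> \<le> (\<integral>x. \<bar>Y k n x\<bar> \<partial>P k)"
          using w0 wN by (intro integral_mono wY integrable_abs Y Pk.integrable_const_bound[where B = "real N"]) auto
        finally show ?thesis using b[of k n] by linarith
      qed
      ultimately have wb: "integral\<^sup>L \<nu> w \<le> b n" by (intro LIMSEQ_le_const2) auto
      have wi: "integrable \<nu> w"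
        using w0 wN by (intro \<nu>.integrable_const_bound[where B = "real N"]) auto
      have "real N * measure \<nu> ?bad = (\<integral>t. real N * indicator ?bad t \<partial>\<nu>)" by simp
      also have "\<dots> \<le> integral\<^sup>L \<nu> w"
      proof (rule integral_mono[OF _ wi])
        show "integrable \<nu> (\<lambda>t. real N * indicator ?bad t)"
          by (intro integrable_mult_right integrable_real_indicator) (auto simp: \<nu>.emeasure_eq_measure)
        show "real N * indicator ?bad t \<le> w t" for t
          using w0[of t] N by (auto simp: indicator_def w_def)
      qed
      finally show ?thesis using wb by linarith
    qed
    note Nb = this
    have "measure \<nu> ?bad = 0"
    proof (rule ccontr)
      assume "measure \<nu> ?bad \<noteq> 0"
      then have pos: "measure \<nu> ?bad > 0" by (simp add: zero_less_measure_iff)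
      obtain N :: nat where "real N > b n / measure \<nu> ?bad + 1" using reals_Archimedean2 by blast
      moreover have "b n \<ge> 0" using Nb[of 1] by (auto intro: order_trans[OF measure_nonneg])
      then have "b n / measure \<nu> ?bad \<ge> 0" using pos by simp
      ultimately have "N > 0" "real N > b n / measure \<nu> ?bad" by auto
      then show False using Nb[of N] pos by (simp add: field_simps)
    qed
    then show ?thesis by (simp add: \<nu>.emeasure_eq_measure)
  qed
  have nul: "emeasure \<nu> (- \<Gamma>) = 0"
  proof -
    have "- \<Gamma> = (\<Union>n. {t. cube_decode n t = 0 \<or> cube_decode n t = 1})" by (auto simp: \<Gamma>_def)
    moreover have "(\<Union>n. {t. cube_decode n t = 0 \<or> cube_decode n t = 1}) \<in> null_sets \<nu>"
      by (intro null_sets_UN) (use bad in \<open>auto intro!: null_setsI\<close>)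
    ultimately show ?thesis by auto
  qed
  have "measure \<nu> \<Gamma> = 1"
    using \<nu>.prob_compl[of \<Gamma>] nul by (simp add: \<nu>.emeasure_eq_measure Compl_eq_Diff_UNIV)
  have g1: "measure \<nu> \<Gamma> = 1" by fact
  have Zc: "continuous_on \<Gamma> (Z n)" for n
    by (intro continuous_at_imp_continuous_on ballI Zcont) (auto simp: \<Gamma>_def)
  have lim: "(\<lambda>j. \<integral>x. H (\<Sum>n\<in>J. c n * Y (r j) n x) \<partial>P (r j)) \<longlonglongrightarrow> (\<integral>t. H (\<Sum>n\<in>J. c n * Z n t) \<partial>\<nu>)"
    if H: "\<And>x. isCont H x" "\<And>x. \<bar>H x :: real\<bar> \<le> B" and J: "finite J" for H B J c
  proof -
    have Hm [measurable]: "H \<in> borel_measurable borel"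
      using H(1) by (intro borel_measurable_continuous_onI continuous_at_imp_continuous_on) auto
    let ?f = "\<lambda>t. H (\<Sum>n\<in>J. c n * Z n t)"
    have "isCont ?f t" if "t \<in> \<Gamma>" for t
    proof -
      have "isCont (\<lambda>t. \<Sum>n\<in>J. c n * Z n t) t"
        using that by (intro continuous_intros Zcont) (auto simp: \<Gamma>_def)
      then show ?thesis by (rule isCont_o2) (rule H(1))
    qed
    then have "emeasure \<nu> {t. \<not> isCont ?f t} \<le> emeasure \<nu> (- \<Gamma>)" by (intro emeasure_mono) auto
    then have z: "emeasure \<nu> {t. \<not> isCont ?f t} = 0" using nul by simp
    have "(\<lambda>j. integral\<^sup>L (\<mu> (r j)) ?f) \<longlonglongrightarrow> integral\<^sup>L \<nu> ?f"
      by (rule weak_conv_imp_bdd_ae_continuous_conv[OF \<mu>r \<nu> wc z, where B = B]) (use H in auto)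
    moreover have "integral\<^sup>L (\<mu> (r j)) ?f = (\<integral>x. H (\<Sum>n\<in>J. c n * Y (r j) n x) \<partial>P (r j))" for j
    proof -
      have "?f \<in> borel_measurable borel" by measurable
      then show ?thesis unfolding \<mu>_def by (subst integral_distr) (auto simp: Z_def dec \<theta>tan)
    qed
    ultimately show ?thesis by simp
  qed
  show ?thesis by (rule that[OF r \<nu> \<Gamma>m g1 Zm Zc lim])
qed

section \<open>Representation by iterated integration\<close>

text \<open>Subtracting \<open>of_bool (x < 0)\<close> makes this vanish for \<open>x\<close> off
  the interval between 0 and \<open>y\<close>, at the price of a sign for negative \<open>y\<close>.
  Products of such factors are then square integrable.\<close>

definition step :: "real \<Rightarrow> real \<Rightarrow> real" where
  "step y x = of_bool (x < y) - of_bool (x < 0)"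

definition corner :: "real^'n::finite \<Rightarrow> real^'n \<Rightarrow> real" where
  "corner y x = (\<Prod>i\<in>UNIV. step (y $ i) (x $ i))"

lemma abs_step_le: "\<bar>step y x\<bar> \<le> 1"
  by (auto simp: step_def)

lemma measurable_step [measurable (raw)]:
  assumes [measurable]: "f \<in> borel_measurable M" "g \<in> borel_measurable M"
  shows "(\<lambda>x. step (f x) (g x)) \<in> borel_measurable M"
  unfolding step_def of_bool_def by measurable

text \<open>The subtracted term of \<open>step\<close> contributes the integral of the derivative
  over the whole line, which is 0; the other term gives the integral from \<open>x\<close> to
  infinity.\<close>

lemma integral_derivative_step:
  fixes \<phi> :: "real \<Rightarrow> real"
  assumes der: "\<And>t. (\<phi> has_real_derivative \<phi>' t) (at t)" and cont: "continuous_on UNIV \<phi>'"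
    and z: "\<And>t. \<bar>t\<bar> > R \<Longrightarrow> \<phi> t = 0"
  shows "(\<integral>t. \<phi>' t * step t x \<partial>lborel) = - \<phi> x"
proof -
  define R' where "R' = max R \<bar>x\<bar> + 1"
  have R': "R' > R" "\<bar>x\<bar> < R'" by (auto simp: R'_def)
  have z': "\<phi>' t = 0" if "\<bar>t\<bar> > R" for t
  proof -
    have "((\<lambda>_. 0) has_real_derivative \<phi>' t) (at t)"
    proof (rule has_field_derivative_transform_within_open[OF der])
      show "open (- {-R..R})" by (simp add: open_Compl)
      show "t \<in> - {-R..R}" using that by auto
      show "\<phi> s = 0" if "s \<in> - {-R..R}" for s using that by (intro z) auto
    qed
    then show ?thesis using DERIV_unique DERIV_const by blast
  qed
  have FTC: "has_bochner_integral lborel (\<lambda>t. \<phi>' t * indicator {a..b} t) (\<phi> b - \<phi> a)" if "a \<le> b" for a b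
    by (rule has_bochner_integral_FTC_Icc_real[OF that der]) (use cont in \<open>simp add: continuous_on_eq_continuous_at\<close>)
  have "has_bochner_integral lborel (\<lambda>t. \<phi>' t * indicator {x..R'} t - of_bool (x < 0) * (\<phi>' t * indicator {-R'..R'} t))
      ((\<phi> R' - \<phi> x) - of_bool (x < 0) * (\<phi> R' - \<phi> (- R')))"
    using R' by (intro has_bochner_integral_diff has_bochner_integral_mult_right FTC) auto
  moreover have "\<phi> R' = 0" "\<phi> (- R') = 0" using R' by (auto intro!: z)
  ultimately have i: "(\<integral>t. \<phi>' t * indicator {x..R'} t - of_bool (x < 0) * (\<phi>' t * indicator {-R'..R'} t) \<partial>lborel) = - \<phi> x"
    by (simp add: has_bochner_integral_iff)
  have [measurable]: "\<phi>' \<in> borel_measurable borel" by (rule borel_measurable_continuous_onI[OF cont])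
  have "(\<integral>t. \<phi>' t * step t x \<partial>lborel)
      = (\<integral>t. \<phi>' t * indicator {x..R'} t - of_bool (x < 0) * (\<phi>' t * indicator {-R'..R'} t) \<partial>lborel)"
  proof (rule integral_cong_AE)
    \<comment> \<open>At \<open>t = x\<close> the closed interval and the strict inequality in
      \<open>step\<close> disagree.\<close>
    have "AE t in lborel. t \<noteq> x" by (rule AE_lborel_singleton)
    then show "AE t in lborel. \<phi>' t * step t x
        = \<phi>' t * indicator {x..R'} t - of_bool (x < 0) * (\<phi>' t * indicator {-R'..R'} t)"
    proof eventually_elim
      case (elim t)
      show ?case
      proof (cases "\<bar>t\<bar> > R")
        case False
        then have "t \<in> {-R'..R'}" using R' by auto
        then show ?thesis using elim by (auto simp: step_def indicator_def algebra_simps)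
      qed (simp add: z')
    qed
  qed measurable
  then show ?thesis using i by simp
qed

definition replace :: "'n set \<Rightarrow> real^'n \<Rightarrow> ('n \<Rightarrow> real) \<Rightarrow> real^'n" where
  "replace I x y = (\<chi> j. if j \<in> I then y j else x $ j)"

lemma measurable_replace:
  fixes x :: "real^'n::finite"
  shows "replace I x \<in> (\<Pi>\<^sub>M i\<in>I. lborel) \<rightarrow>\<^sub>M borel"
proof -
  have "replace I x y = (\<Sum>i\<in>UNIV. (if i \<in> I then y i else x $ i) *\<^sub>R axis i (1::real))" for y
    by (simp add: replace_def vec_eq_iff axis_def if_distrib[of "\<lambda>x. _ * x"] cong: if_cong)
  moreover have "(\<lambda>y. \<Sum>i\<in>UNIV. (if i \<in> I then y i else x $ i) *\<^sub>R axis i (1::real)) \<in> (\<Pi>\<^sub>M i\<in>I. lborel) \<rightarrow>\<^sub>M borel"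
  proof (intro borel_measurable_sum borel_measurable_scaleR borel_measurable_const)
    show "(\<lambda>y. if i \<in> I then y i else x $ i) \<in> (\<Pi>\<^sub>M i\<in>I. lborel) \<rightarrow>\<^sub>M borel" for i
      by (cases "i \<in> I") auto
  qed
  ultimately show ?thesis by (simp cong: measurable_cong)
qed

lemma test_R_supp_cube:
  fixes f :: "real^'n::finite \<Rightarrow> real"
  assumes "f \<in> test_R" obtains R where "R > 0" "\<And>x i. \<bar>x $ i\<bar> > R \<Longrightarrow> f x = 0"
proof -
  have "bounded (supp f)" using assms by (auto simp: test_R_def compact_imp_bounded)
  then obtain R where R: "R > 0" "\<And>x. x \<in> supp f \<Longrightarrow> norm x \<le> R" by (auto simp: bounded_pos)
  show ?thesis
  proof (rule that[OF R(1)])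
    fix x :: "real^'n" and i assume "\<bar>x $ i\<bar> > R"
    then have "norm x > R" using component_le_norm_cart[of x i] by linarith
    then show "f x = 0" using R(2)[of x] not_in_supp by force
  qed
qed

text \<open>Induction on the coordinates that are integrated, while \<open>replace\<close> keeps the
  others at \<open>x\<close>. The inner integral over the new coordinate undoes one derivative and
  gives one sign.\<close>

lemma iterated_integral_representation:
  fixes f :: "real^'n::finite \<Rightarrow> real"
  assumes f: "f \<in> test_R" and "distinct is"
  shows "f x = (- 1) ^ length is * (\<integral>y. iter_deriv (map (\<lambda>i. axis i 1) is) f (replace (set is) x y) *
    (\<Prod>i\<in>set is. step (y i) (x $ i)) \<partial>(\<Pi>\<^sub>M i\<in>set is. lborel))"
  using assms(2)
proof (induction "is")
  case Nil
  have "replace {} x y = x" for y by (simp add: replace_def)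
  then show ?case by (simp add: PiM_empty lebesgue_integral_count_space_finite)
next
  case (Cons i "is")
  interpret product_sigma_finite "\<lambda>_::'n. lborel :: real measure" by standard
  let ?I = "set is" and ?L = "map (\<lambda>i. axis i (1::real)) is"
  let ?a = "axis i (1::real)"
  define F where "F = iter_deriv ?L f"
  define F' where "F' = iter_deriv (?a # ?L) f"
  have ax: "axis j (1::real) \<in> Basis" for j :: 'n by (simp add: axis_in_Basis_iff)
  have F: "F \<in> test_R" unfolding F_def using ax by (intro test_R_iter_deriv f) auto
  have F': "F' \<in> test_R" unfolding F'_def using ax by (intro test_R_iter_deriv f) auto
  have FF': "F' = iter_deriv [?a] F" by (simp add: F'_def F_def)
  have i: "i \<notin> ?I" using Cons.prems by simp
  define G where "G y = F' (replace (insert i ?I) x y) * (\<Prod>j\<in>insert i ?I. step (y j) (x $ j))" for y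
  obtain R where R: "R > 0" "\<And>x i. \<bar>x $ i\<bar> > R \<Longrightarrow> F x = 0" by (rule test_R_supp_cube[OF F]) blast
  obtain R' where R': "R' > 0" "\<And>x i. \<bar>x $ i\<bar> > R' \<Longrightarrow> F' x = 0" by (rule test_R_supp_cube[OF F']) blast
  obtain B where B: "B \<ge> 0" "\<And>x. \<bar>F' x\<bar> \<le> B" by (rule test_R_bounded[OF F']) blast
  note [measurable] = test_R_measurable[OF F'] measurable_replace[of "insert i ?I" x]
  have Gm: "G \<in> borel_measurable (\<Pi>\<^sub>M i\<in>insert i ?I. lborel)"
    unfolding G_def by measurable
  have Gi: "integrable (\<Pi>\<^sub>M i\<in>insert i ?I. lborel) G"
  proof (rule Bochner_Integration.integrable_bound)
    show "integrable (\<Pi>\<^sub>M i\<in>insert i ?I. lborel) (\<lambda>y. B * (\<Prod>j\<in>insert i ?I. indicator {-R'..R'} (y j) :: real))"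
      by (intro integrable_mult_right product_integrable_prod integrable_real_indicator) (auto simp: emeasure_lborel_Icc_eq)
    have "norm (G y) \<le> norm (B * (\<Prod>j\<in>insert i ?I. indicator {-R'..R'} (y j) :: real))" for y
    proof (cases "\<exists>j\<in>insert i ?I. \<bar>y j\<bar> > R'")
      case True
      then obtain j where "j \<in> insert i ?I" "\<bar>replace (insert i ?I) x y $ j\<bar> > R'" by (auto simp: replace_def)
      then have "F' (replace (insert i ?I) x y) = 0" by (intro R'(2))
      then show ?thesis by (simp add: G_def)
    next
      case False
      then have "(\<Prod>j\<in>insert i ?I. indicator {-R'..R'} (y j) :: real) = 1"
        by (intro prod.neutral) (auto simp: indicator_def abs_le_iff not_less)
      moreover have "\<bar>\<Prod>j\<in>insert i ?I. step (y j) (x $ j)\<bar> \<le> 1"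
        unfolding abs_prod by (intro prod_le_1) (auto simp: abs_step_le)
      then have "\<bar>G y\<bar> \<le> B * 1" unfolding G_def abs_mult using B by (intro mult_mono) auto
      ultimately show ?thesis using B by simp
    qed
    then show "AE y in \<Pi>\<^sub>M i\<in>insert i ?I. lborel. norm (G y) \<le> norm (B * (\<Prod>j\<in>insert i ?I. indicator {-R'..R'} (y j) :: real))"
      by simp
  qed (rule Gm)
  have inner: "(\<integral>t. G (y(i := t)) \<partial>lborel) = - (F (replace ?I x y) * (\<Prod>j\<in>?I. step (y j) (x $ j)))" for y
  proof -
    define z where "z = replace ?I x y"
    \<comment> \<open>The point \<open>z\<close> with coordinate \<open>i\<close> set to 0, so that
      \<open>t\<close> itself is the coordinate on the line through it.\<close>
    define z0 where "z0 = z - z $ i *\<^sub>R ?a"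
    have zi: "z $ i = x $ i" using i by (simp add: z_def replace_def)
    have z0c: "(z0 + t *\<^sub>R ?a) $ j = (if j = i then t else z $ j)" for t j
      by (simp add: z0_def axis_def)
    have rep: "replace (insert i ?I) x (y(i := t)) = z0 + t *\<^sub>R ?a" for t
      using i by (simp only: vec_eq_iff z0c) (auto simp: z_def replace_def)
    have pr: "(\<Prod>j\<in>insert i ?I. step ((y(i := t)) j) (x $ j)) = step t (x $ i) * (\<Prod>j\<in>?I. step (y j) (x $ j))" for t
      using i by (subst prod.insert) (auto intro!: prod.cong)
    have "(\<integral>t. F' (z0 + t *\<^sub>R ?a) * step t (x $ i) \<partial>lborel) = - F (z0 + x $ i *\<^sub>R ?a)"
    proof (rule integral_derivative_step[where \<phi> = "\<lambda>t. F (z0 + t *\<^sub>R ?a)" and R = R])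
      show "((\<lambda>t. F (z0 + t *\<^sub>R ?a)) has_real_derivative F' (z0 + t *\<^sub>R ?a)) (at t)" for t
        unfolding FF' by (rule test_R_directional[OF F ax])
      show "continuous_on UNIV (\<lambda>t. F' (z0 + t *\<^sub>R ?a))"
        by (intro continuous_on_compose2[OF test_R_continuous[OF F']] continuous_intros) auto
      show "F (z0 + t *\<^sub>R ?a) = 0" if "\<bar>t\<bar> > R" for t
      proof (rule R(2)[of _ i])
        show "\<bar>(z0 + t *\<^sub>R ?a) $ i\<bar> > R" unfolding z0c using that by simp
      qed
    qed
    moreover have "z0 + x $ i *\<^sub>R ?a = z" by (simp add: z0_def zi)
    ultimately have "(\<integral>t. F' (z0 + t *\<^sub>R ?a) * step t (x $ i) \<partial>lborel) = - F z" by simp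
    moreover have "G (y(i := t)) = F' (z0 + t *\<^sub>R ?a) * step t (x $ i) * (\<Prod>j\<in>?I. step (y j) (x $ j))" for t
      by (simp only: G_def rep pr mult.assoc)
    ultimately show ?thesis by (simp add: z_def)
  qed
  have "(\<integral>y. G y \<partial>(\<Pi>\<^sub>M i\<in>insert i ?I. lborel)) = (\<integral>y. (\<integral>t. G (y(i := t)) \<partial>lborel) \<partial>(\<Pi>\<^sub>M i\<in>?I. lborel))"
    by (rule product_integral_insert[OF _ i Gi]) simp
  also have "\<dots> = - (\<integral>y. F (replace ?I x y) * (\<Prod>j\<in>?I. step (y j) (x $ j)) \<partial>(\<Pi>\<^sub>M i\<in>?I. lborel))"
    unfolding inner by simp
  finally show ?case using Cons by (simp add: G_def F'_def F_def)
qed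

text \<open>The iterated representation holds for every list of distinct coordinates, so any
  enumeration will do.\<close>

definition axes :: "(real^'n::finite) list" where
  "axes = map (\<lambda>i. axis i 1) (SOME is. set is = UNIV \<and> distinct is)"

definition mixed :: "(real^'n::finite \<Rightarrow> real) \<Rightarrow> real^'n \<Rightarrow> real" where
  "mixed f y = (- 1) ^ CARD('n) * iter_deriv axes f y"

lemma axes_Basis: "set axes \<subseteq> Basis" by (auto simp: axes_def axis_in_Basis_iff)

lemma mixed_test_R: assumes "f \<in> test_R" shows "mixed f \<in> test_R"
  using test_R_lincomb[OF test_R_iter_deriv[OF assms axes_Basis] test_R_iter_deriv[OF assms axes_Basis], of "(- 1) ^ CARD('a)" 0]
  by (simp add: mixed_def[abs_def])

lemma mixed_representation:
  fixes f :: "real^'n::finite \<Rightarrow> real"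
  assumes f: "f \<in> test_R"
  shows "f x = (\<integral>y. mixed f y * corner y x \<partial>lborel)"
proof -
  define L where "L = (SOME is. set is = (UNIV :: 'n set) \<and> distinct is)"
  have "\<exists>is. set is = (UNIV :: 'n set) \<and> distinct is" by (rule finite_distinct_list) simp
  then have L: "set L = UNIV" "distinct L" unfolding L_def by (metis (mono_tags, lifting) someI_ex)+
  have len: "length L = CARD('n)" using L distinct_card[of L] by simp
  have rep: "replace UNIV x y = (\<chi> i. y i)" for y by (simp add: replace_def)
  have [measurable]: "mixed f \<in> borel_measurable borel" by (rule test_R_measurable[OF mixed_test_R[OF f]])
  have cm: "(\<lambda>y. mixed f y * corner y x) \<in> borel_measurable borel"
    unfolding corner_def by measurable
  have "(\<integral>y. mixed f y * corner y x \<partial>lborel)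
      = (\<integral>y. mixed f (\<chi> i. y i) * corner (\<chi> i. y i) x \<partial>(\<Pi>\<^sub>M i\<in>UNIV. lborel))"
    by (subst lborel_vec_eq_PiM[symmetric], subst integral_distr[OF measurable_vec_lambda_PiM cm]) simp
  also have "\<dots> = f x"
    by (subst iterated_integral_representation[OF f L(2), of x])
      (simp add: L(1) len rep mixed_def axes_def corner_def mult.assoc flip: L_def)
  finally show ?thesis ..
qed

section \<open>The functions \<open>corner y\<close>\<close>

definition cube :: "real \<Rightarrow> (real^'n::finite) set" where
  "cube R = cbox (\<chi> i. - R) (\<chi> i. R)"

lemma mem_cube: "x \<in> cube R \<longleftrightarrow> (\<forall>i. \<bar>x $ i\<bar> \<le> R)"
  by (auto simp: cube_def mem_box_cart abs_le_iff) (metis minus_le_iff)+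

lemma cube_sets: "cube R \<in> lmeasurable" "cube R \<in> sets borel"
  by (simp_all add: cube_def)

lemma abs_corner_le: "\<bar>corner y x\<bar> \<le> 1"
  unfolding corner_def abs_prod by (intro prod_le_1) (auto simp: abs_step_le)

lemma corner_zero:
  assumes "y \<in> cube R" "x \<notin> cube R" shows "corner y x = 0"
proof -
  obtain i where i: "\<bar>x $ i\<bar> > R" using assms(2) by (auto simp: mem_cube not_le)
  have "\<bar>y $ i\<bar> \<le> R" using assms(1) by (simp add: mem_cube)
  then have "step (y $ i) (x $ i) = 0" using i by (auto simp: step_def)
  then show ?thesis by (auto simp: corner_def)
qed

lemma mem_own_cube: "\<exists>R. y \<in> cube R"
  using component_le_norm_cart[of y] by (auto simp: mem_cube)

lemma corner_measurable: "corner y \<in> borel_measurable borel"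
  unfolding corner_def[abs_def] by measurable

lemma corner_L2: "corner y \<in> L2 lborel"
proof -
  obtain R where "y \<in> cube R" using mem_own_cube by blast
  then show ?thesis
    using L2_bounded_support(2)[OF corner_measurable cube_sets[of R], of y 1] abs_corner_le corner_zero by blast
qed

text \<open>Telescoping the product shows that the corners differ only on slabs inside the cube, one
  for each \<open>i\<close>, between the i-th coordinates of \<open>y\<close> and \<open>z\<close>.
  Both functions have modulus at most 1, so the square of the difference is at most twice its
  modulus, and the squared norm is linear in the coordinate differences.\<close>

lemma corner_Lipschitz:
  fixes y z :: "real^'n::finite"
  assumes y: "y \<in> cube R" and z: "z \<in> cube R" and R: "R \<ge> 0"
  shows "(L2_norm lborel (\<lambda>x. corner y x - corner z x))\<^sup>2
    \<le> 2 * (2 * R) ^ (CARD('n) - 1) * (\<Sum>i\<in>UNIV. \<bar>y $ i - z $ i\<bar>)"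
proof -
  define lo where "lo i = (\<chi> j. if j = i then min (y $ i) (z $ i) else - R)" for i
  define hi where "hi i = (\<chi> j. if j = i then max (y $ i) (z $ i) else R)" for i
  have le: "lo i $ j \<le> hi i $ j" for i j using R by (simp add: lo_def hi_def min_le_iff_disj le_max_iff_disj)
  have ms: "measure lborel (cbox (lo i) (hi i)) = (2 * R) ^ (CARD('n) - 1) * \<bar>y $ i - z $ i\<bar>" for i
  proof -
    have "cbox (lo i) (hi i) \<noteq> {}" using le by (auto simp: interval_ne_empty_cart)
    then have "measure lborel (cbox (lo i) (hi i)) = (\<Prod>j\<in>UNIV. hi i $ j - lo i $ j)" by (rule content_cbox_cart)
    also have "\<dots> = (hi i $ i - lo i $ i) * (\<Prod>j\<in>UNIV - {i}. hi i $ j - lo i $ j)" by (rule prod.remove) auto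
    also have "(\<Prod>j\<in>UNIV - {i}. hi i $ j - lo i $ j) = (\<Prod>j\<in>UNIV - {i}. 2 * R)"
      by (rule prod.cong) (auto simp: hi_def lo_def)
    also have "\<dots> = (2 * R) ^ (CARD('n) - 1)" by (simp add: card_Diff_singleton)
    also have "hi i $ i - lo i $ i = \<bar>y $ i - z $ i\<bar>" by (simp add: hi_def lo_def)
    finally show ?thesis by simp
  qed
  have ii: "integrable lborel (\<lambda>x. indicator (cbox (lo i) (hi i)) x :: real)" for i
    using emeasure_lborel_cbox_finite[of "lo i" "hi i"] by (intro integrable_real_indicator) auto
  have pw: "(corner y x - corner z x)\<^sup>2 \<le> 2 * (\<Sum>i\<in>UNIV. indicator (cbox (lo i) (hi i)) x)" for x
  proof (cases "x \<in> cube R")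
    case True
    have "\<bar>corner y x - corner z x\<bar> \<le> (\<Sum>i\<in>UNIV. \<bar>step (y $ i) (x $ i) - step (z $ i) (x $ i)\<bar>)"
      unfolding corner_def using norm_prod_diff[of UNIV "\<lambda>i. step (y $ i) (x $ i)" "\<lambda>i. step (z $ i) (x $ i)"]
      by (simp add: abs_step_le)
    also have "\<dots> \<le> (\<Sum>i\<in>UNIV. indicator (cbox (lo i) (hi i)) x)"
    proof (rule sum_mono)
      fix i
      have xj: "- R \<le> x $ j" "x $ j \<le> R" for j
      proof -
        have "\<bar>x $ j\<bar> \<le> R" using True by (simp add: mem_cube)
        then show "- R \<le> x $ j" "x $ j \<le> R" by linarith+
      qed
      show "\<bar>step (y $ i) (x $ i) - step (z $ i) (x $ i)\<bar> \<le> indicator (cbox (lo i) (hi i)) x"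
        using xj by (auto simp: step_def indicator_def mem_box_cart lo_def hi_def)
    qed
    finally have d: "\<bar>corner y x - corner z x\<bar> \<le> (\<Sum>i\<in>UNIV. indicator (cbox (lo i) (hi i)) x)" .
    have "(corner y x - corner z x)\<^sup>2 = \<bar>corner y x - corner z x\<bar> * \<bar>corner y x - corner z x\<bar>"
      by (simp add: power2_eq_square)
    also have "\<dots> \<le> 2 * (\<Sum>i\<in>UNIV. indicator (cbox (lo i) (hi i)) x)"
      using d abs_corner_le[of y x] abs_corner_le[of z x] by (intro mult_mono) auto
    finally show ?thesis .
  next
    case False
    then show ?thesis using corner_zero[OF y] corner_zero[OF z] by (auto intro!: sum_nonneg)
  qed
  have "(\<integral>x. (corner y x - corner z x)\<^sup>2 \<partial>lborel) \<le> (\<integral>x. 2 * (\<Sum>i\<in>UNIV. indicator (cbox (lo i) (hi i)) x) \<partial>lborel)"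
    by (rule integral_mono'[OF _ pw]) (use ii in \<open>auto intro!: sum_nonneg\<close>)
  also have "\<dots> = 2 * (\<Sum>i\<in>UNIV. (2 * R) ^ (CARD('n) - 1) * \<bar>y $ i - z $ i\<bar>)"
    using ii by (simp add: Bochner_Integration.integral_sum ms)
  finally show ?thesis
    by (simp add: L2_norm_eq Bochner_Integration.integral_nonneg sum_distrib_left mult.assoc)
qed

section \<open>Dyadic points\<close>

definition dyadic :: "nat \<Rightarrow> real^'n::finite \<Rightarrow> real^'n" where
  "dyadic l y = (\<chi> i. of_int \<lfloor>2 ^ l * y $ i\<rfloor> / 2 ^ l)"

lemma dyadic_bounds: "dyadic l y $ i \<le> y $ i" "y $ i - (1 / 2) ^ l \<le> dyadic l y $ i"
proof -
  have "of_int \<lfloor>2 ^ l * y $ i\<rfloor> \<le> 2 ^ l * y $ i" "2 ^ l * y $ i - 1 \<le> of_int \<lfloor>2 ^ l * y $ i\<rfloor>" by linarith+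
  then have "of_int \<lfloor>2 ^ l * y $ i\<rfloor> / 2 ^ l \<le> 2 ^ l * y $ i / 2 ^ l"
    "(2 ^ l * y $ i - 1) / 2 ^ l \<le> of_int \<lfloor>2 ^ l * y $ i\<rfloor> / 2 ^ l" by (intro divide_right_mono; simp)+
  then show "dyadic l y $ i \<le> y $ i" "y $ i - (1 / 2) ^ l \<le> dyadic l y $ i"
    by (simp_all add: dyadic_def diff_divide_distrib power_one_over)
qed

text \<open>This consistency lets an approximation of level \<open>l\<close> be written over the
  cells of level \<open>Suc l\<close>, where two successive approximations can be compared.\<close>

lemma dyadic_dyadic: "dyadic l (dyadic (Suc l) y) = dyadic l y"
proof -
  have "\<lfloor>2 ^ l * (of_int \<lfloor>2 ^ Suc l * t\<rfloor> / 2 ^ Suc l :: real)\<rfloor> = \<lfloor>2 ^ l * t\<rfloor>" for t :: real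
  proof -
    define s where "s = 2 ^ l * t"
    have "2 ^ l * (of_int \<lfloor>2 ^ Suc l * t\<rfloor> / 2 ^ Suc l) = of_int \<lfloor>2 * s\<rfloor> / (2::real)"
      by (simp add: s_def mult.assoc)
    moreover have "\<lfloor>of_int \<lfloor>2 * s\<rfloor> / (2::real)\<rfloor> = \<lfloor>s\<rfloor>"
    proof -
      have "2 * \<lfloor>s\<rfloor> \<le> \<lfloor>2 * s\<rfloor>" "\<lfloor>2 * s\<rfloor> \<le> 2 * \<lfloor>s\<rfloor> + 1" by linarith+
      then have "real_of_int (2 * \<lfloor>s\<rfloor>) \<le> of_int \<lfloor>2 * s\<rfloor>" "of_int \<lfloor>2 * s\<rfloor> \<le> real_of_int (2 * \<lfloor>s\<rfloor> + 1)"
        by (simp_all only: of_int_le_iff)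
      then show ?thesis by (intro floor_unique) auto
    qed
    ultimately show ?thesis by (simp add: s_def)
  qed
  then show ?thesis by (simp add: dyadic_def vec_eq_iff)
qed

lemma dyadic_cube:
  assumes "y \<in> cube (real R)" shows "dyadic l y \<in> cube (real R)"
  unfolding mem_cube
proof
  fix i
  have "\<bar>y $ i\<bar> \<le> real R" using assms by (simp add: mem_cube)
  then have "2 ^ l * y $ i \<le> 2 ^ l * real R" "2 ^ l * (- real R) \<le> 2 ^ l * y $ i"
    by (intro mult_left_mono; simp add: abs_le_iff)+
  then have "2 ^ l * y $ i \<le> of_int (2 ^ l * int R)" "of_int (- (2 ^ l * int R)) \<le> 2 ^ l * y $ i" by simp_all
  then have "\<lfloor>2 ^ l * y $ i\<rfloor> \<le> 2 ^ l * int R" "- (2 ^ l * int R) \<le> \<lfloor>2 ^ l * y $ i\<rfloor>" by linarith+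
  then have "of_int \<lfloor>2 ^ l * y $ i\<rfloor> \<le> (of_int (2 ^ l * int R) :: real)" "(of_int (- (2 ^ l * int R)) :: real) \<le> of_int \<lfloor>2 ^ l * y $ i\<rfloor>"
    by (simp_all only: of_int_le_iff)
  then show "\<bar>dyadic l y $ i\<bar> \<le> real R" by (simp add: dyadic_def abs_le_iff field_simps)
qed

lemma finite_dyadic_cube: "finite (dyadic l ` cube (real R) :: (real^'n::finite) set)"
proof -
  define A where "A = (\<lambda>k::int. of_int k / (2 ^ l :: real)) ` {- (2 ^ l * int R) .. 2 ^ l * int R}"
  have "dyadic l ` cube (real R) \<subseteq> (vec_lambda ` (UNIV \<rightarrow>\<^sub>E A) :: (real^'n) set)"
  proof
    fix v :: "real^'n" assume "v \<in> dyadic l ` cube (real R)"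
    then obtain y where y: "y \<in> cube (real R)" "v = dyadic l y" by blast
    have "v $ i \<in> A" for i
    proof -
      have "\<bar>dyadic l y $ i\<bar> \<le> real R" using dyadic_cube[OF y(1), of l] by (simp add: mem_cube)
      then have "\<bar>of_int \<lfloor>2 ^ l * y $ i\<rfloor>\<bar> \<le> 2 ^ l * real R" by (simp add: dyadic_def field_simps)
      then have "of_int \<bar>\<lfloor>2 ^ l * y $ i\<rfloor>\<bar> \<le> (of_int (2 ^ l * int R) :: real)" by simp
      then have "\<bar>\<lfloor>2 ^ l * y $ i\<rfloor>\<bar> \<le> 2 ^ l * int R" by (simp only: of_int_le_iff)
      then show ?thesis by (auto simp: A_def y(2) dyadic_def abs_le_iff)
    qed
    then have "(\<lambda>i. v $ i) \<in> UNIV \<rightarrow>\<^sub>E A" by auto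
    then show "v \<in> vec_lambda ` (UNIV \<rightarrow>\<^sub>E A)" by (rule image_eqI[rotated]) simp
  qed
  moreover have "finite (UNIV \<rightarrow>\<^sub>E A :: ('n \<Rightarrow> real) set)" by (intro finite_PiE) (auto simp: A_def)
  ultimately show ?thesis using finite_surj finite_subset by blast
qed

lemma measurable_dyadic [measurable]: "(dyadic l :: real^'n::finite \<Rightarrow> _) \<in> borel_measurable borel"
proof -
  have "dyadic l y = (\<Sum>i\<in>UNIV. (of_int \<lfloor>2 ^ l * y $ i\<rfloor> / 2 ^ l) *\<^sub>R axis i (1::real))" for y :: "real^'n"
    by (simp add: dyadic_def vec_eq_iff axis_def if_distrib[of "\<lambda>x. _ * x"] cong: if_cong)
  then show ?thesis by (simp cong: measurable_cong)
qed

lemma countable_dyadic: "countable (\<Union>l. range (dyadic l :: real^'n::finite \<Rightarrow> _))"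
proof (intro countable_UN ballI)
  fix l
  have "range (dyadic l :: real^'n \<Rightarrow> _) \<subseteq> (\<Union>R. dyadic l ` cube (real R))"
  proof (clarify)
    fix y :: "real^'n"
    obtain R :: nat where "norm y \<le> real R" using real_arch_simple by blast
    then have "y \<in> cube (real R)" using component_le_norm_cart[of y] by (auto simp: mem_cube intro: order_trans)
    then show "dyadic l y \<in> (\<Union>R. dyadic l ` cube (real R))" by blast
  qed
  moreover have "countable (\<Union>R. dyadic l ` cube (real R) :: (real^'n) set)"
    by (intro countable_UN countableI_type countable_finite finite_dyadic_cube)
  ultimately show "countable (range (dyadic l :: real^'n \<Rightarrow> _))" by (rule countable_subset)
qed simp

text \<open>\<open>dyadic l y\<close> tends to \<open>y\<close> from below, and \<open>step\<close>
  is left continuous in its first argument since the inequality is strict. So there is convergence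
  at every point.\<close>

lemma corner_dyadic_tendsto: "(\<lambda>l. corner (dyadic l y) x) \<longlonglongrightarrow> corner y x"
  unfolding corner_def
proof (rule tendsto_prod)
  fix i
  have "\<forall>\<^sub>F l in sequentially. step (dyadic l y $ i) (x $ i) = step (y $ i) (x $ i)"
  proof (cases "x $ i < y $ i")
    case True
    have "(\<lambda>l. y $ i - (1 / 2) ^ l) \<longlonglongrightarrow> y $ i - 0" by (intro tendsto_intros LIMSEQ_power_zero) simp
    then have "\<forall>\<^sub>F l in sequentially. x $ i < y $ i - (1 / 2) ^ l" using True by (intro order_tendstoD) auto
    then show ?thesis
      by eventually_elim (use True dyadic_bounds(2)[of y i] in \<open>auto simp: step_def intro: less_le_trans\<close>)
  next
    case False
    then have "\<not> x $ i < dyadic l y $ i" for l using dyadic_bounds(1)[of l y i] by linarith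
    then show ?thesis using False by (simp add: step_def)
  qed
  then show "(\<lambda>l. step (dyadic l y $ i) (x $ i)) \<longlonglongrightarrow> step (y $ i) (x $ i)" by (rule tendsto_eventually)
qed

text \<open>\<open>k\<close> is an arbitrary function, because it will also be
  \<open>\<lambda>v. W v t\<close>, for which no regularity in \<open>v\<close> is
  available.\<close>

lemma integral_finite_range:
  fixes g :: "'a \<Rightarrow> real" and k :: "'b \<Rightarrow> real"
  assumes fin: "finite (q ` B)" and m: "\<And>v. {y. q y = v} \<in> sets M" and B: "B \<in> sets M"
    and g: "integrable M g" and z: "\<And>y. y \<notin> B \<Longrightarrow> g y = 0"
  shows "(\<integral>y. g y * k (q y) \<partial>M) = (\<Sum>v\<in>q ` B. k v * (\<integral>y. g y * indicator {y. q y = v} y \<partial>M))"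
    and "integrable M (\<lambda>y. g y * k (q y))"
proof -
  have eq: "g y * k (q y) = (\<Sum>v\<in>q ` B. k v * (g y * indicator {y. q y = v} y))" for y
  proof (cases "y \<in> B")
    case True
    have "(\<Sum>v\<in>q ` B. k v * (g y * indicator {y. q y = v} y)) = (\<Sum>v\<in>q ` B. if v = q y then k v * g y else 0)"
      by (intro sum.cong) (auto simp: indicator_def)
    then show ?thesis using True fin by simp
  qed (simp add: z)
  have i: "integrable M (\<lambda>y. g y * indicator {y. q y = v} y)" for v
    using integrable_mult_indicator[OF m[of v] g] by (simp add: mult.commute)
  show "(\<integral>y. g y * k (q y) \<partial>M) = (\<Sum>v\<in>q ` B. k v * (\<integral>y. g y * indicator {y. q y = v} y \<partial>M))"
    unfolding eq using i by simp
  show "integrable M (\<lambda>y. g y * k (q y))"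
    unfolding eq using i by auto
qed

text \<open>\<open>a l\<close> is the integral representation of \<open>f\<close> with
  \<open>corner y\<close> frozen at the rounded point. Convergence at each \<open>x\<close> is
  dominated by the modulus of \<open>mixed f\<close>; the uniform bound \<open>2 * I\<close> on the
  cube then gives convergence in norm.\<close>

lemma dyadic_approximation:
  fixes f :: "real^'n::finite \<Rightarrow> real"
  assumes f: "f \<in> test_R" and R: "\<And>y. y \<notin> cube (real R) \<Longrightarrow> mixed f y = 0"
  defines "c l v \<equiv> \<integral>y. mixed f y * indicator {y. dyadic l y = v} y \<partial>lborel"
  defines "a l x \<equiv> \<Sum>v\<in>dyadic l ` cube (real R). c l v * corner v x"
  shows "(\<lambda>l. L2_norm lborel (\<lambda>x. f x - a l x)) \<longlonglongrightarrow> 0"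
proof -
  have h: "bounded_compact_support (mixed f)" by (rule test_R_bounded_compact_support[OF mixed_test_R[OF f]])
  note hi = bounded_compact_supportD(2)[OF h]
  have dm: "{y. dyadic l y = v} \<in> sets lborel" for l and v :: "real^'n"
    using measurable_sets[OF measurable_dyadic[of l], of "{v}"] by (simp add: vimage_def)
  have B: "cube (real R) \<in> sets (lborel :: (real^'n) measure)" using cube_sets by simp
  have a: "a l x = (\<integral>y. mixed f y * corner (dyadic l y) x \<partial>lborel)" for l x
    unfolding a_def c_def
    by (rule trans[OF _ integral_finite_range(1)[OF finite_dyadic_cube[of l R] dm B hi R, where k = "\<lambda>v. corner v x", symmetric]])
      (simp_all add: mult.commute)
  have am: "a l \<in> borel_measurable borel" for l
    unfolding a_def using corner_measurable by (intro borel_measurable_sum borel_measurable_times) auto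
  have fm: "f \<in> borel_measurable borel" by (rule test_R_measurable[OF f])
  define I where "I = (\<integral>y. \<bar>mixed f y\<bar> \<partial>lborel)"
  have cm: "(\<lambda>y. corner y x) \<in> borel_measurable borel" for x :: "real^'n"
    unfolding corner_def by measurable
  have hm: "mixed f \<in> borel_measurable borel" using hi by auto
  have bound: "\<bar>\<integral>y. mixed f y * corner (q y) x \<partial>lborel\<bar> \<le> I" for q x
    unfolding I_def
  proof (rule order_trans[OF integral_abs_bound])
    have "\<bar>mixed f y * corner (q y) x\<bar> \<le> \<bar>mixed f y\<bar>" for y
      unfolding abs_mult using mult_left_mono[OF abs_corner_le[of "q y" x] abs_ge_zero[of "mixed f y"]] by simp
    then show "(\<integral>y. \<bar>mixed f y * corner (q y) x\<bar> \<partial>lborel) \<le> (\<integral>y. \<bar>mixed f y\<bar> \<partial>lborel)"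
      using hi by (intro integral_mono') auto
  qed
  have zero: "(\<integral>y. mixed f y * corner (q y) x \<partial>lborel) = 0"
    if "x \<notin> cube (real R)" "\<And>y. y \<in> cube (real R) \<Longrightarrow> q y \<in> cube (real R)" for q x
  proof -
    have "mixed f y * corner (q y) x = 0" for y
      using R[of y] corner_zero[OF that(2) that(1), of y] by (cases "y \<in> cube (real R)") auto
    then have "(\<lambda>y. mixed f y * corner (q y) x) = (\<lambda>y. 0)" by (rule ext)
    then show ?thesis by (simp only: Bochner_Integration.integral_zero)
  qed
  have ptw: "(\<lambda>l. a l x) \<longlonglongrightarrow> f x" for x
    unfolding a mixed_representation[OF f, of x]
  proof (rule integral_dominated_convergence[where w = "\<lambda>y. \<bar>mixed f y\<bar>"])
    show "integrable lborel (\<lambda>y. \<bar>mixed f y\<bar>)" using hi by auto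
    show "(\<lambda>y. mixed f y * corner y x) \<in> borel_measurable lborel" using hm cm[of x] by measurable
    show "(\<lambda>y. mixed f y * corner (dyadic l y) x) \<in> borel_measurable lborel" for l
      using hm measurable_compose[OF measurable_dyadic cm[of x]] by measurable
    show "AE y in lborel. (\<lambda>l. mixed f y * corner (dyadic l y) x) \<longlonglongrightarrow> mixed f y * corner y x"
      by (intro AE_I2 tendsto_mult tendsto_const corner_dyadic_tendsto)
    show "AE y in lborel. norm (mixed f y * corner (dyadic l y) x) \<le> \<bar>mixed f y\<bar>" for l
      using mult_left_mono[OF abs_corner_le abs_ge_zero] by (auto simp: abs_mult)
  qed
  show ?thesis
  proof (rule L2_norm_tendsto_zero[where w = "\<lambda>x. (2 * I)\<^sup>2 * indicator (cube (real R)) x"])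
    show "(\<lambda>x. f x - a l x) \<in> borel_measurable lborel" for l using fm am by measurable
    show "integrable lborel (\<lambda>x. (2 * I)\<^sup>2 * indicator (cube (real R)) (x :: real^'n) :: real)"
      using emeasure_lborel_cbox_finite by (intro integrable_mult_right integrable_real_indicator) (auto simp: cube_def)
    show "AE x in lborel. (\<lambda>l. f x - a l x) \<longlonglongrightarrow> 0"
      using tendsto_diff[OF tendsto_const ptw, of "f x" x for x] by simp
    show "(f x - a l x)\<^sup>2 \<le> (2 * I)\<^sup>2 * indicator (cube (real R)) x" for l x
    proof (cases "x \<in> cube (real R)")
      case True
      have "\<bar>f x - a l x\<bar> \<le> \<bar>2 * I\<bar>"
        using bound[of "\<lambda>y. y" x] bound[of "dyadic l" x] unfolding a mixed_representation[OF f, of x] by linarith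
      then show ?thesis using True by (simp add: abs_le_square_iff)
    next
      case False
      have "f x = 0" "a l x = 0"
        using zero[OF False, of "\<lambda>y. y"] zero[OF False, of "dyadic l"] dyadic_cube
        unfolding a mixed_representation[OF f, of x] by auto
      then show ?thesis using False by simp
    qed
  qed
qed

section \<open>Radon measures on distributions\<close>

lemma Hausdorff_distrib_R: "Hausdorff_space distrib_R_topology"
  unfolding distrib_R_topology_def
  by (intro Hausdorff_space_subtopology) (simp add: Hausdorff_space_product_topology)

lemma topspace_distrib_R: "topspace distrib_R_topology = distrib_R"
  by (auto simp: distrib_R_topology_def distrib_R_def PiE_def)

lemma continuous_map_distrib_R_eval:
  assumes "f \<in> test_R" shows "continuous_map distrib_R_topology euclideanreal (\<lambda>\<phi>. \<phi> f)"
  unfolding distrib_R_topology_def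
  by (intro continuous_map_from_subtopology continuous_map_product_projection assms)

lemma continuous_map_into_distrib_R:
  assumes "\<And>t. t \<in> topspace T \<Longrightarrow> \<Phi> t \<in> distrib_R"
    and "\<And>f. f \<in> test_R \<Longrightarrow> continuous_map T euclideanreal (\<lambda>t. \<Phi> t f)"
  shows "continuous_map T distrib_R_topology \<Phi>"
  unfolding distrib_R_topology_def continuous_map_in_subtopology continuous_map_componentwise
  using assms by (auto simp: distrib_R_def)

text \<open>Finite Borel measures on the line are inner regular. A compact subset of some
  \<open>\<GG> n\<close> has a compact image, which is closed by the Hausdorff property and
  therefore measurable. The constant \<open>c\<close> settles measurability off the union.\<close>

lemma radon_pushforward:
  fixes \<Phi> :: "real \<Rightarrow> 'x" and \<GG> :: "nat \<Rightarrow> real set"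
  assumes \<nu>: "real_distribution \<nu>" and T: "Hausdorff_space T"
    and G: "\<And>n. \<GG> n \<in> sets borel" "incseq \<GG>" "emeasure \<nu> (\<Union>n. \<GG> n) = 1"
    and \<Phi>: "\<And>t. \<Phi> t \<in> topspace T" "\<And>n. continuous_map (top_of_set (\<GG> n)) T \<Phi>"
    and c: "\<And>t. t \<notin> (\<Union>n. \<GG> n) \<Longrightarrow> \<Phi> t = c"
  defines "\<mu> \<equiv> distr \<nu> (sigma (topspace T) {U. openin T U}) \<Phi>"
  shows "\<Phi> \<in> \<nu> \<rightarrow>\<^sub>M sigma (topspace T) {U. openin T U}" "radon_prob T \<mu>"
proof -
  interpret \<nu>: real_distribution \<nu> by (rule \<nu>)
  let ?A = "sigma (topspace T) {U. openin T U}"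
  have sub: "{U. openin T U} \<subseteq> Pow (topspace T)" by (auto dest: openin_subset)
  have sA: "sets ?A = sigma_sets (topspace T) {U. openin T U}" "space ?A = topspace T"
    using sub by simp_all
  have rel: "\<GG> n \<inter> \<Phi> -` V \<in> sets borel" if "openin T V" for n V
  proof -
    have "openin (top_of_set (\<GG> n)) {t \<in> \<GG> n. \<Phi> t \<in> V}"
      using openin_continuous_map_preimage[OF \<Phi>(2)[of n] that] by simp
    then obtain O' where "open O'" "{t \<in> \<GG> n. \<Phi> t \<in> V} = \<GG> n \<inter> O'" by (auto simp: openin_open)
    moreover have "\<GG> n \<inter> \<Phi> -` V = {t \<in> \<GG> n. \<Phi> t \<in> V}" by auto
    ultimately show ?thesis using G(1) by auto
  qed
  show m: "\<Phi> \<in> \<nu> \<rightarrow>\<^sub>M ?A"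
  proof (rule measurable_measure_of)
    show "{U. openin T U} \<subseteq> Pow (topspace T)" by (rule sub)
    show "\<Phi> \<in> space \<nu> \<rightarrow> topspace T" using \<Phi>(1) by auto
    fix V assume "V \<in> {U. openin T U}"
    then have V: "openin T V" by simp
    have eq: "\<Phi> -` V = (\<Union>n. \<GG> n \<inter> \<Phi> -` V) \<union> (if c \<in> V then - (\<Union>n. \<GG> n) else {})"
      using c by auto
    have "(\<Union>n. \<GG> n \<inter> \<Phi> -` V) \<in> sets borel" using rel[OF V] by blast
    moreover have "- (\<Union>n. \<GG> n) \<in> sets borel" using G(1) by (intro borel_comp) blast
    ultimately have "\<Phi> -` V \<in> sets borel"
      by (subst eq, intro sets.Un) simp_all
    then show "\<Phi> -` V \<inter> space \<nu> \<in> sets \<nu>" by simp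
  qed
  have em: "emeasure \<mu> A = emeasure \<nu> (\<Phi> -` A)" if "A \<in> sets ?A" for A
    unfolding \<mu>_def using that by (subst emeasure_distr[OF m]) auto
  have pre: "\<Phi> -` A \<in> sets borel" if "A \<in> sets ?A" for A
    using measurable_sets[OF m that] by simp
  show "radon_prob T \<mu>"
    unfolding radon_prob_def
  proof (intro conjI ballI)
    show "prob_space \<mu>" unfolding \<mu>_def by (rule \<nu>.prob_space_distr[OF m])
    show "space \<mu> = topspace T" "sets \<mu> = sigma_sets (topspace T) {U. openin T U}"
      by (simp_all add: \<mu>_def sA sub)
    fix A assume "A \<in> sets \<mu>"
    then have A: "A \<in> sets ?A" by (simp add: \<mu>_def)
    show "emeasure \<mu> A = (SUP K\<in>{K. compactin T K \<and> K \<in> sets \<mu> \<and> K \<subseteq> A}. emeasure \<mu> K)"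
    proof (rule antisym)
      show "(SUP K\<in>{K. compactin T K \<and> K \<in> sets \<mu> \<and> K \<subseteq> A}. emeasure \<mu> K) \<le> emeasure \<mu> A"
        using \<open>A \<in> sets \<mu>\<close> by (intro SUP_least emeasure_mono) auto
      define B where "B = \<Phi> -` A"
      have B: "B \<in> sets borel" unfolding B_def by (rule pre[OF A])
      have AE: "AE t in \<nu>. t \<in> (\<Union>n. \<GG> n)"
        using G by (intro \<nu>.AE_in_set_eq_1[THEN iffD2]) (auto simp: \<nu>.emeasure_eq_measure)
      have "emeasure \<mu> A = emeasure \<nu> B" unfolding B_def by (rule em[OF A])
      also have "\<dots> = emeasure \<nu> (\<Union>n. B \<inter> \<GG> n)"
      proof (rule emeasure_eq_AE)
        show "AE x in \<nu>. (x \<in> B) = (x \<in> (\<Union>n. B \<inter> \<GG> n))" using AE by eventually_elim auto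
      qed (use B G(1) in auto)
      also have "\<dots> = (SUP n. emeasure \<nu> (B \<inter> \<GG> n))"
        using B G by (intro SUP_emeasure_incseq[symmetric]) (auto simp: incseq_def)
      also have "\<dots> \<le> (SUP K\<in>{K. compactin T K \<and> K \<in> sets \<mu> \<and> K \<subseteq> A}. emeasure \<mu> K)"
      proof (rule SUP_least)
        fix n
        have "emeasure \<nu> (B \<inter> \<GG> n) = (SUP K\<in>{K. K \<subseteq> B \<inter> \<GG> n \<and> compact K}. emeasure \<nu> K)"
          using B G(1) by (intro inner_regular) (auto simp: \<nu>.emeasure_eq_measure)
        also have "\<dots> \<le> (SUP K\<in>{K. compactin T K \<and> K \<in> sets \<mu> \<and> K \<subseteq> A}. emeasure \<mu> K)"
        proof (rule SUP_mono)
          fix K assume "K \<in> {K. K \<subseteq> B \<inter> \<GG> n \<and> compact K}"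
          then have K: "K \<subseteq> B" "K \<subseteq> \<GG> n" "compact K" by auto
          have cK: "compactin T (\<Phi> ` K)"
            using K by (intro image_compactin[OF _ \<Phi>(2)[of n]]) (auto simp: compactin_subtopology)
          then have "closedin T (\<Phi> ` K)" by (rule compactin_imp_closedin[OF T])
          then have "topspace T - (topspace T - \<Phi> ` K) \<in> sets ?A"
            unfolding sA by (intro sigma_sets.Compl sigma_sets.Basic) (auto simp: closedin_def)
          moreover have "topspace T - (topspace T - \<Phi> ` K) = \<Phi> ` K" using \<Phi>(1) by auto
          ultimately have s: "\<Phi> ` K \<in> sets ?A" by simp
          \<comment> \<open>\<open>\<Phi>\<close> may fail to be injective, so the preimage of the
            image can exceed \<open>K\<close>; the inequality has the right direction.\<close>
          have "emeasure \<nu> K \<le> emeasure \<nu> (\<Phi> -` (\<Phi> ` K))"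
            using pre[OF s] by (intro emeasure_mono) auto
          then have "emeasure \<nu> K \<le> emeasure \<mu> (\<Phi> ` K)" unfolding em[OF s] .
          then show "\<exists>L\<in>{K. compactin T K \<and> K \<in> sets \<mu> \<and> K \<subseteq> A}. emeasure \<nu> K \<le> emeasure \<mu> L"
            using cK s K(1) by (intro bexI[of _ "\<Phi> ` K"]) (auto simp: \<mu>_def B_def)
        qed
        finally show "emeasure \<nu> (B \<inter> \<GG> n) \<le> (SUP K\<in>{K. compactin T K \<and> K \<in> sets \<mu> \<and> K \<subseteq> A}. emeasure \<mu> K)" .
      qed
      finally show "emeasure \<mu> A \<le> (SUP K\<in>{K. compactin T K \<and> K \<in> sets \<mu> \<and> K \<subseteq> A}. emeasure \<mu> K)" .
    qed
  qed
qed

text \<open>Weak convergence transfers bounds only for bounded functions; Fatou's lemma removes the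
  truncation.\<close>

lemma nn_integral_abs_le_truncated:
  fixes X :: "'a \<Rightarrow> real"
  assumes "finite_measure M" and [measurable]: "X \<in> borel_measurable M"
    and b: "\<And>N::nat. (\<integral>x. min \<bar>X x\<bar> (real N) \<partial>M) \<le> b"
  shows "(\<integral>\<^sup>+x. ennreal \<bar>X x\<bar> \<partial>M) \<le> ennreal b"
proof -
  interpret finite_measure M by fact
  have lim: "(\<lambda>N. ennreal (min \<bar>X x\<bar> (real N))) \<longlonglongrightarrow> ennreal \<bar>X x\<bar>" for x
  proof (rule tendsto_eventually)
    obtain N0 where "\<bar>X x\<bar> \<le> real N0" using real_arch_simple by blast
    then show "\<forall>\<^sub>F N in sequentially. ennreal (min \<bar>X x\<bar> (real N)) = ennreal \<bar>X x\<bar>"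
      unfolding eventually_sequentially by (intro exI[of _ N0]) (auto simp: min_def)
  qed
  have "(\<integral>\<^sup>+x. ennreal \<bar>X x\<bar> \<partial>M) = (\<integral>\<^sup>+x. liminf (\<lambda>N. ennreal (min \<bar>X x\<bar> (real N))) \<partial>M)"
    by (intro nn_integral_cong lim_imp_Liminf[symmetric] lim) simp
  also have "\<dots> \<le> liminf (\<lambda>N. \<integral>\<^sup>+x. ennreal (min \<bar>X x\<bar> (real N)) \<partial>M)"
    by (rule nn_integral_liminf) simp
  also have "\<dots> \<le> liminf (\<lambda>N. ennreal b)"
  proof (intro Liminf_mono always_eventually allI)
    fix N :: nat
    have "integrable M (\<lambda>x. min \<bar>X x\<bar> (real N))"
      by (rule integrable_const_bound[where B = "real N"]) auto
    then have "(\<integral>\<^sup>+x. ennreal (min \<bar>X x\<bar> (real N)) \<partial>M) = ennreal (\<integral>x. min \<bar>X x\<bar> (real N) \<partial>M)"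
      by (intro nn_integral_eq_integral) auto
    then show "(\<integral>\<^sup>+x. ennreal (min \<bar>X x\<bar> (real N)) \<partial>M) \<le> ennreal b" using b[of N] by (simp add: ennreal_leI)
  qed
  finally show ?thesis by (simp add: Liminf_const)
qed

section \<open>Continuity of functionals\<close>

text \<open>Subadditivity makes the ball absolutely convex. The bound in \<open>bd\<close> is
  homogeneous in \<open>B\<close>, so functions supported in \<open>K\<close> with small derivatives
  up to order \<open>N\<close> lie in the ball.\<close>

lemma seminorm_nbhd0_R:
  fixes p :: "(real^'n::finite \<Rightarrow> real) \<Rightarrow> real"
  assumes p: "\<And>u v s t. u \<in> test_R \<Longrightarrow> v \<in> test_R \<Longrightarrow> p (\<lambda>x. s * u x + t * v x) \<le> \<bar>s\<bar> * p u + \<bar>t\<bar> * p v"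
    and p0: "\<And>u. 0 \<le> p u"
    and bd: "\<And>K. compact K \<Longrightarrow> \<exists>N C. \<forall>f\<in>test_R. \<forall>B. supp f \<subseteq> K \<longrightarrow>
      (\<forall>L x. set L \<subseteq> Basis \<and> length L \<le> N \<longrightarrow> \<bar>iter_deriv L f x\<bar> \<le> B) \<longrightarrow> p f \<le> C * B"
    and e: "e > 0"
  shows "nbhd0_R {v \<in> test_R. p v < e}"
  unfolding nbhd0_R_def
proof (intro conjI ballI allI impI)
  fix u v :: "real^'n \<Rightarrow> real" and s t :: real
  assume "u \<in> {v \<in> test_R. p v < e}" "v \<in> {v \<in> test_R. p v < e}" and st: "\<bar>s\<bar> + \<bar>t\<bar> \<le> 1"
  then have uv: "u \<in> test_R" "v \<in> test_R" "p u < e" "p v < e" by auto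
  define M where "M = max (p u) (p v)"
  have "p (\<lambda>x. s * u x + t * v x) \<le> \<bar>s\<bar> * p u + \<bar>t\<bar> * p v" by (rule p[OF uv(1,2)])
  also have "\<dots> \<le> \<bar>s\<bar> * M + \<bar>t\<bar> * M" by (intro add_mono mult_left_mono) (auto simp: M_def)
  also have "\<dots> = (\<bar>s\<bar> + \<bar>t\<bar>) * M" by (simp add: distrib_right)
  also have "\<dots> \<le> 1 * M" using st p0[of u] by (intro mult_right_mono) (auto simp: M_def)
  also have "\<dots> < e" using uv by (simp add: M_def)
  finally show "(\<lambda>x. s * u x + t * v x) \<in> {v \<in> test_R. p v < e}" using test_R_lincomb[OF uv(1,2)] by simp
next
  fix K :: "(real^'n) set" assume "compact K"
  from bd[OF this] obtain N C where NC: "\<And>f B. f \<in> test_R \<Longrightarrow> supp f \<subseteq> K \<Longrightarrow>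
      (\<And>L x. set L \<subseteq> Basis \<Longrightarrow> length L \<le> N \<Longrightarrow> \<bar>iter_deriv L f x\<bar> \<le> B) \<Longrightarrow> p f \<le> C * B" by metis
  show "\<exists>N. \<exists>e'>0. {f \<in> test_R. supp f \<subseteq> K \<and>
      (\<forall>L x. set L \<subseteq> Basis \<and> length L \<le> N \<longrightarrow> \<bar>iter_deriv L f x\<bar> < e')} \<subseteq> {v \<in> test_R. p v < e}"
  proof (intro exI[of _ N] exI[of _ "e / (\<bar>C\<bar> + 1)"] conjI subsetI)
    show "e / (\<bar>C\<bar> + 1) > 0" using e by simp
    fix f assume "f \<in> {f \<in> test_R. supp f \<subseteq> K \<and>
      (\<forall>L x. set L \<subseteq> Basis \<and> length L \<le> N \<longrightarrow> \<bar>iter_deriv L f x\<bar> < e / (\<bar>C\<bar> + 1))}"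
    then have f: "f \<in> test_R" "supp f \<subseteq> K"
      and fe: "\<And>L x. set L \<subseteq> Basis \<Longrightarrow> length L \<le> N \<Longrightarrow> \<bar>iter_deriv L f x\<bar> < e / (\<bar>C\<bar> + 1)" by auto
    have "p f \<le> C * (e / (\<bar>C\<bar> + 1))" by (rule NC[OF f]) (use fe in \<open>auto intro: less_imp_le\<close>)
    also have "\<dots> \<le> \<bar>C\<bar> * (e / (\<bar>C\<bar> + 1))" using e by (intro mult_right_mono) auto
    also have "\<dots> < e" using e by (simp add: field_simps)
    finally show "f \<in> {v \<in> test_R. p v < e}" using f by simp
  qed
qed

lemma linear_functional_continuous:
  fixes \<phi> :: "(real^'n::finite \<Rightarrow> real) \<Rightarrow> real"
  assumes lin: "linear_functional_on test_R \<phi>"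
    and bd: "\<And>K. compact K \<Longrightarrow> \<exists>N C. \<forall>f\<in>test_R. \<forall>B. supp f \<subseteq> K \<longrightarrow>
      (\<forall>L x. set L \<subseteq> Basis \<and> length L \<le> N \<longrightarrow> \<bar>iter_deriv L f x\<bar> \<le> B) \<longrightarrow> \<bar>\<phi> f\<bar> \<le> C * B"
  shows "continuous_map test_R_topology euclideanreal \<phi>"
  unfolding continuous_map_def topspace_test_R_topology
proof (intro conjI allI impI)
  have lin': "\<phi> (\<lambda>x. s * u x + t * v x) = s * \<phi> u + t * \<phi> v" if "u \<in> test_R" "v \<in> test_R" for u v s t
    using lin that unfolding linear_functional_on_def by blast
  fix W :: "real set" assume W: "openin euclideanreal W"
  show "openin test_R_topology {f \<in> test_R. \<phi> f \<in> W}"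
    unfolding openin_test_R_topology
  proof (intro conjI ballI)
    fix f assume "f \<in> {f \<in> test_R. \<phi> f \<in> W}"
    then have f: "f \<in> test_R" "\<phi> f \<in> W" by auto
    obtain e where e: "e > 0" "\<And>y. dist y (\<phi> f) < e \<Longrightarrow> y \<in> W"
      using W f(2) by (auto simp: open_dist)
    let ?V = "{v \<in> test_R. \<bar>\<phi> v\<bar> < e}"
    have "nbhd0_R ?V"
    proof (rule seminorm_nbhd0_R[OF _ _ bd e(1)])
      show "\<bar>\<phi> (\<lambda>x. s * u x + t * v x)\<bar> \<le> \<bar>s\<bar> * \<bar>\<phi> u\<bar> + \<bar>t\<bar> * \<bar>\<phi> v\<bar>" if "u \<in> test_R" "v \<in> test_R" for u v s t
        unfolding lin'[OF that] abs_mult[symmetric] by (rule abs_triangle_ineq)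
    qed auto
    moreover have "(\<lambda>x. f x + v x) \<in> {f \<in> test_R. \<phi> f \<in> W}" if "v \<in> ?V" for v
    proof -
      have v: "v \<in> test_R" "\<bar>\<phi> v\<bar> < e" using that by simp_all
      have "\<phi> (\<lambda>x. f x + v x) = \<phi> f + \<phi> v" using lin'[OF f(1) v(1), of 1 1] by simp
      then have "\<phi> (\<lambda>x. f x + v x) \<in> W"
        by (intro e(2)) (use v(2) in \<open>simp add: dist_real_def\<close>)
      then show ?thesis using test_R_lincomb[OF f(1) v(1), of 1 1] by simp
    qed
    ultimately show "\<exists>V. V \<subseteq> test_R \<and> nbhd0_R V \<and> (\<forall>v\<in>V. (\<lambda>x. f x + v x) \<in> {f \<in> test_R. \<phi> f \<in> W})"
      by (intro exI[of _ ?V]) auto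
  qed auto
qed auto

lemma geometric_increments:
  fixes a :: "nat \<Rightarrow> real"
  assumes inc: "\<And>l. \<bar>a (Suc l) - a l\<bar> \<le> C * p ^ l" and p: "0 \<le> p" "p < 1"
  shows "convergent a" "\<bar>lim a - a l\<bar> \<le> C * p ^ l / (1 - p)"
proof -
  have sg: "summable (\<lambda>l. C * p ^ l)" using p by (intro summable_mult summable_geometric) simp
  have sm: "summable (\<lambda>l. a (Suc l) - a l)" 
    by (rule summable_comparison_test'[OF sg]) (use inc in auto)
  have tel: "(\<Sum>i<n. a (Suc (i + l)) - a (i + l)) = a (n + l) - a l" for n l
    by (induction n) auto
  have "(\<lambda>n. a (n + 0) - a 0) \<longlonglongrightarrow> (\<Sum>l. a (Suc l) - a l)"
    using summable_LIMSEQ[OF sm] by (simp add: sum_lessThan_telescope)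
  then have "(\<lambda>n. (a n - a 0) + a 0) \<longlonglongrightarrow> (\<Sum>l. a (Suc l) - a l) + a 0" by (intro tendsto_add) auto
  then show conv: "convergent a" by (auto simp: convergent_def)
  have "a \<longlonglongrightarrow> lim a" using conv by (simp add: convergent_LIMSEQ_iff)
  then have "(\<lambda>n. \<bar>a (n + l) - a l\<bar>) \<longlonglongrightarrow> \<bar>lim a - a l\<bar>"
    by (intro tendsto_intros LIMSEQ_ignore_initial_segment)
  moreover have "\<bar>a (n + l) - a l\<bar> \<le> C * p ^ l / (1 - p)" for n
  proof -
    have C: "C \<ge> 0" using inc[of 0] abs_ge_zero[of "a (Suc 0) - a 0"] by simp
    have "\<bar>a (n + l) - a l\<bar> \<le> (\<Sum>i<n. \<bar>a (Suc (i + l)) - a (i + l)\<bar>)" unfolding tel[symmetric] by (rule sum_abs)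
    also have "\<dots> \<le> (\<Sum>i<n. C * p ^ (i + l))" by (intro sum_mono inc)
    also have "\<dots> = C * p ^ l * (\<Sum>i<n. p ^ i)" by (simp add: sum_distrib_left power_add mult_ac)
    also have "(\<Sum>i<n. p ^ i) \<le> 1 / (1 - p)"
      using p sum_le_suminf[OF summable_geometric[of p], of "{..<n}"] suminf_geometric[of p] by simp
    finally show ?thesis using C p by (simp add: mult_left_mono)
  qed
  ultimately show "\<bar>lim a - a l\<bar> \<le> C * p ^ l / (1 - p)" by (intro LIMSEQ_le_const2) auto
qed

text \<open>The error \<open>d l\<close> is uniform in \<open>j\<close>, so the limit in
  \<open>j\<close> may be taken for each approximation separately.\<close>

lemma interchange_limits:
  fixes x :: "nat \<Rightarrow> real"
  assumes xy: "\<And>j l. \<bar>x j - y l j\<bar> \<le> d l" and d: "d \<longlonglongrightarrow> 0"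
    and y: "\<And>l. y l \<longlonglongrightarrow> z l" and z: "z \<longlonglongrightarrow> w"
  shows "x \<longlonglongrightarrow> w"
proof (rule LIMSEQ_I)
  fix e :: real assume e: "e > 0"
  have "\<forall>\<^sub>F l in sequentially. d l < e / 3" using d e by (intro order_tendstoD) auto
  moreover have "\<forall>\<^sub>F l in sequentially. \<bar>z l - w\<bar> < e / 3"
    using tendstoD[OF z, of "e / 3"] e by (simp add: dist_real_def)
  ultimately have "\<forall>\<^sub>F l in sequentially. d l < e / 3 \<and> \<bar>z l - w\<bar> < e / 3" by eventually_elim simp
  then obtain l where l: "d l < e / 3" "\<bar>z l - w\<bar> < e / 3" by (auto simp: eventually_sequentially)
  have "\<forall>\<^sub>F j in sequentially. \<bar>y l j - z l\<bar> < e / 3"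
    using tendstoD[OF y[of l], of "e / 3"] e by (simp add: dist_real_def)
  then obtain j0 where j0: "\<And>j. j \<ge> j0 \<Longrightarrow> \<bar>y l j - z l\<bar> < e / 3" by (auto simp: eventually_sequentially)
  have "norm (x j - w) < e" if "j \<ge> j0" for j
    using xy[of j l] j0[OF that] l unfolding real_norm_def by linarith
  then show "\<exists>no. \<forall>n\<ge>no. norm (x n - w) < e" by blast
qed

lemma mixed_lincomb:
  assumes "f \<in> test_R" "h \<in> test_R"
  shows "mixed (\<lambda>x. s * f x + t * h x) y = s * mixed f y + t * mixed h y"
  using iter_deriv_lincomb(1)[OF open_UNIV _ _ axes_Basis, of f h y s t] assms
  by (simp add: mixed_def test_R_def algebra_simps)

lemma dyadic_level_sets: "{y. dyadic l y = v} \<in> sets lborel" for v :: "real^'n::finite"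
  using measurable_sets[OF measurable_dyadic[of l], of "{v}"] by (simp add: vimage_def)

lemma mixed_zero_outside:
  assumes "supp f \<subseteq> K" "x \<notin> K" shows "mixed f x = 0"
  using iter_deriv_eq_0_outside_supp[of x f axes] assms by (auto simp: mixed_def)

lemma abs_mixed: "\<bar>mixed f x\<bar> = \<bar>iter_deriv axes f x\<bar>"
  by (simp add: mixed_def abs_mult power_abs)

lemma compact_subset_cube:
  assumes "compact K" shows "\<exists>R::nat. K \<subseteq> cube (real R)"
proof -
  obtain B where B: "\<And>x. x \<in> K \<Longrightarrow> norm x \<le> B" using compact_imp_bounded[OF assms] by (auto simp: bounded_iff)
  obtain R :: nat where R: "B \<le> real R" using real_arch_simple by blast
  have "x \<in> cube (real R)" if "x \<in> K" for x
    unfolding mem_cube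
  proof
    fix i show "\<bar>x $ i\<bar> \<le> real R" using component_le_norm_cart[of x i] B[OF that] R by linarith
  qed
  then show ?thesis by blast
qed

section \<open>Limits of random fields\<close>

text \<open>All that the limit argument uses of the sphere: linear integrable fields with a mean
  bound whose constant does not depend on \<open>k\<close>.\<close>

locale random_fields =
  fixes N :: "nat \<Rightarrow> 'b measure" and X :: "nat \<Rightarrow> (real^'n::finite \<Rightarrow> real) \<Rightarrow> 'b \<Rightarrow> real" and K :: real
  assumes prob: "prob_space (N k)"
    and int: "f \<in> L2 lborel \<Longrightarrow> integrable (N k) (X k f)"
    and bd: "f \<in> L2 lborel \<Longrightarrow> (\<integral>g. \<bar>X k f g\<bar> \<partial>N k) \<le> K * L2_norm lborel f"
    and lin: "g \<in> space (N k) \<Longrightarrow> f \<in> L2 lborel \<Longrightarrow> h \<in> L2 lborel \<Longrightarrow>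
      X k (\<lambda>x. s * f x + t * h x) g = s * X k f g + t * X k h g"
    and K: "K \<ge> 0"
begin

lemma field_diff:
  assumes "g \<in> space (N k)" "f \<in> L2 lborel" "h \<in> L2 lborel"
  shows "X k (\<lambda>x. f x - h x) g = X k f g - X k h g"
  using lin[OF assms, of 1 "-1"] by simp

lemma field_sum:
  assumes g: "g \<in> space (N k)" and V: "finite V" and e: "\<And>v. v \<in> V \<Longrightarrow> e v \<in> L2 lborel"
  shows "X k (\<lambda>x. \<Sum>v\<in>V. c v * e v x) g = (\<Sum>v\<in>V. c v * X k (e v) g)"
  using V e
proof (induction V)
  case empty
  show ?case using lin[OF g L2_zero L2_zero, of 0 0] by simp
next
  case (insert v V)
  have s: "(\<lambda>x. \<Sum>v\<in>V. c v * e v x) \<in> L2 lborel"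
    using insert by (intro L2_sum L2_scale) auto
  have "X k (\<lambda>x. \<Sum>v\<in>insert v V. c v * e v x) g = X k (\<lambda>x. c v * e v x + 1 * (\<Sum>v\<in>V. c v * e v x)) g"
    using insert by simp
  also have "\<dots> = c v * X k (e v) g + 1 * X k (\<lambda>x. \<Sum>v\<in>V. c v * e v x) g"
    using insert by (intro lin g s) auto
  finally show ?case using insert by simp
qed

lemma field_Lipschitz:
  assumes f: "f \<in> L2 lborel" and h: "h \<in> L2 lborel"
    and H: "\<And>x y. \<bar>H x - H y\<bar> \<le> \<bar>x - y\<bar>" "\<And>x. \<bar>H x :: real\<bar> \<le> B"
  shows "\<bar>(\<integral>g. H (X k f g) \<partial>N k) - (\<integral>g. H (X k h g) \<partial>N k)\<bar> \<le> K * L2_norm lborel (\<lambda>x. f x - h x)"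
proof -
  interpret prob_space "N k" by (rule prob)
  have "continuous_on UNIV H"
    unfolding continuous_on_iff dist_real_def using H(1) by (meson order_le_less_trans)
  then have [measurable]: "H \<in> borel_measurable borel" by (rule borel_measurable_continuous_onI)
  have [measurable]: "X k f \<in> borel_measurable (N k)" "X k h \<in> borel_measurable (N k)" using int f h by auto
  have i: "integrable (N k) (\<lambda>g. H (X k f g))" "integrable (N k) (\<lambda>g. H (X k h g))"
    using H(2) by (auto intro!: integrable_const_bound[where B = B])
  have fh: "(\<lambda>x. f x - h x) \<in> L2 lborel" by (rule L2_diff[OF f h])
  have "\<bar>(\<integral>g. H (X k f g) \<partial>N k) - (\<integral>g. H (X k h g) \<partial>N k)\<bar> = \<bar>\<integral>g. H (X k f g) - H (X k h g) \<partial>N k\<bar>"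
    using i by simp
  also have "\<dots> \<le> (\<integral>g. \<bar>H (X k f g) - H (X k h g)\<bar> \<partial>N k)" by (rule integral_abs_bound)
  also have "\<dots> \<le> (\<integral>g. \<bar>X k (\<lambda>x. f x - h x) g\<bar> \<partial>N k)"
  proof (rule integral_mono)
    show "integrable (N k) (\<lambda>g. \<bar>H (X k f g) - H (X k h g)\<bar>)" using i by auto
    show "integrable (N k) (\<lambda>g. \<bar>X k (\<lambda>x. f x - h x) g\<bar>)" using int[OF fh] by auto
    show "\<bar>H (X k f g) - H (X k h g)\<bar> \<le> \<bar>X k (\<lambda>x. f x - h x) g\<bar>" if "g \<in> space (N k)" for g
      unfolding field_diff[OF that f h] by (rule H(1))
  qed
  also have "\<dots> \<le> K * L2_norm lborel (\<lambda>x. f x - h x)" by (rule bd[OF fh])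
  finally show ?thesis .
qed

end

lemma (in prob_space) integral_exp_i:
  fixes X :: "'a \<Rightarrow> real"
  assumes [measurable]: "X \<in> borel_measurable M"
  shows "(\<integral>g. exp (\<i> * complex_of_real (X g)) \<partial>M)
    = complex_of_real (\<integral>g. cos (X g) \<partial>M) + \<i> * complex_of_real (\<integral>g. sin (X g) \<partial>M)"
proof -
  have i: "integrable M (\<lambda>g. cos (X g))" "integrable M (\<lambda>g. sin (X g))"
    by (auto intro!: integrable_const_bound[where B = 1])
  have "(\<lambda>g. exp (\<i> * complex_of_real (X g))) = (\<lambda>g. complex_of_real (cos (X g)) + \<i> * complex_of_real (sin (X g)))"
    by (simp add: fun_eq_iff exp_eq_polar[of "\<i> * complex_of_real _"] cis_conv_exp[symmetric] cis.ctr complex_eq_iff)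
  then show ?thesis using i by simp
qed

lemma sin_cos_Lipschitz: "\<bar>sin x - sin y\<bar> \<le> \<bar>x - y :: real\<bar>" "\<bar>cos x - cos y\<bar> \<le> \<bar>x - y\<bar>"
proof -
  have s: "\<bar>sin t\<bar> \<le> \<bar>t\<bar>" for t :: real by (rule abs_sin_x_le_abs_x)
  have "\<bar>sin x - sin y\<bar> = 2 * \<bar>sin ((x - y) / 2)\<bar> * \<bar>cos ((x + y) / 2)\<bar>"
    unfolding sin_diff_sin by (simp add: abs_mult)
  also have "\<dots> \<le> 2 * \<bar>(x - y) / 2\<bar> * 1"
    by (intro mult_mono mult_left_mono s abs_cos_le_one) simp_all
  finally show "\<bar>sin x - sin y\<bar> \<le> \<bar>x - y\<bar>" by simp
  have "\<bar>cos x - cos y\<bar> = 2 * \<bar>sin ((y - x) / 2)\<bar> * \<bar>sin ((x + y) / 2)\<bar>"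
    unfolding cos_diff_cos by (simp add: abs_mult)
  also have "\<dots> \<le> 2 * \<bar>(y - x) / 2\<bar> * 1"
    by (intro mult_mono mult_left_mono s abs_sin_le_one) simp_all
  finally show "\<bar>cos x - cos y\<bar> \<le> \<bar>x - y\<bar>" by simp
qed

text \<open>A limit of the random functions \<open>y \<mapsto> X k (corner y)\<close> at the dyadic points.\<close>

locale limit_field = random_fields N X K
  for N :: "nat \<Rightarrow> 'b measure" and X :: "nat \<Rightarrow> (real^'n::finite \<Rightarrow> real) \<Rightarrow> 'b \<Rightarrow> real" and K :: real +
  fixes r :: "nat \<Rightarrow> nat" and \<nu> :: "real measure" and W :: "real^'n \<Rightarrow> real \<Rightarrow> real" and \<Gamma> :: "real set"
  assumes \<nu>: "real_distribution \<nu>" and \<Gamma>: "\<Gamma> \<in> sets borel" "measure \<nu> \<Gamma> = 1"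
    and Wm: "W v \<in> borel_measurable borel" and Wc: "continuous_on \<Gamma> (W v)"
    and lim: "\<And>H B. (\<And>x. isCont H x) \<Longrightarrow> (\<And>x. \<bar>H x :: real\<bar> \<le> B) \<Longrightarrow> finite V \<Longrightarrow> V \<subseteq> (\<Union>l. range (dyadic l)) \<Longrightarrow>
       (\<lambda>j. \<integral>g. H (\<Sum>v\<in>V. c v * X (r j) (corner v) g) \<partial>N (r j)) \<longlonglongrightarrow> (\<integral>t. H (\<Sum>v\<in>V. c v * W v t) \<partial>\<nu>)"

lemma (in random_fields) limit_field_exists:
  obtains r \<nu> W \<Gamma> where "strict_mono r" "limit_field N X K r \<nu> W \<Gamma>"
proof -
  define D where "D = (\<Union>l. range (dyadic l :: real^'n \<Rightarrow> _))"
  have D: "countable D" unfolding D_def by (rule countable_dyadic)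
  define pts where "pts = from_nat_into D"
  define num where "num = to_nat_on D"
  have pn: "pts (num v) = v" if "v \<in> D" for v
    unfolding pts_def num_def using D that by (rule from_nat_into_to_nat_on)
  obtain r \<nu> Z \<Gamma> where *: "strict_mono r" "real_distribution \<nu>" "\<Gamma> \<in> sets borel" "measure \<nu> \<Gamma> = 1"
    "\<And>n. Z n \<in> borel_measurable borel" "\<And>n. continuous_on \<Gamma> (Z n)"
    and lim: "\<And>H B J c. (\<And>x. isCont H x) \<Longrightarrow> (\<And>x. \<bar>H x :: real\<bar> \<le> B) \<Longrightarrow> finite J \<Longrightarrow>
       (\<lambda>j. \<integral>g. H (\<Sum>n\<in>J. c n * X (r j) (corner (pts n)) g) \<partial>N (r j)) \<longlonglongrightarrow> (\<integral>t. H (\<Sum>n\<in>J. c n * Z n t) \<partial>\<nu>)"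
    by (rule weak_limit_sequence[of N "\<lambda>k n. X k (corner (pts n))" "\<lambda>n. K * L2_norm lborel (corner (pts n))"])
      (use prob int[OF corner_L2] bd[OF corner_L2] in auto)
  have "limit_field N X K r \<nu> (\<lambda>v. Z (num v)) \<Gamma>"
  proof (intro limit_field.intro limit_field_axioms.intro)
    fix c V and H :: "real \<Rightarrow> real" and B
    assume H: "\<And>x. isCont H x" "\<And>x. \<bar>H x\<bar> \<le> B" and V: "finite V" "V \<subseteq> (\<Union>l. range (dyadic l :: real^'n \<Rightarrow> _))"
    have V': "v \<in> D" if "v \<in> V" for v using V(2) that unfolding D_def by blast
    have inj: "inj_on num V" by (rule inj_on_inverseI[of _ pts]) (use V' pn in auto)
    have re: "(\<Sum>n\<in>num ` V. c (pts n) * \<phi> n) = (\<Sum>v\<in>V. c v * \<phi> (num v))" for \<phi> :: "nat \<Rightarrow> real"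
      unfolding sum.reindex[OF inj] by (rule sum.cong) (simp_all add: pn V')
    have re': "(\<Sum>v\<in>V. c v * X k (corner (pts (num v))) g) = (\<Sum>v\<in>V. c v * X k (corner v) g)" for k g
      by (rule sum.cong) (simp_all add: pn V')
    show "(\<lambda>j. \<integral>g. H (\<Sum>v\<in>V. c v * X (r j) (corner v) g) \<partial>N (r j)) \<longlonglongrightarrow> (\<integral>t. H (\<Sum>v\<in>V. c v * Z (num v) t) \<partial>\<nu>)"
      using lim[OF H finite_imageI[OF V(1), of num], where c = "\<lambda>n. c (pts n)"] unfolding re re' .
  qed (rule random_fields_axioms *)+
  then show ?thesis by (rule that[OF *(1)])
qed

context limit_field
begin

sublocale \<nu>: real_distribution \<nu> by (rule \<nu>)

text \<open>The truncated modulus is bounded and continuous, so the mean bound of the approximating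
  fields passes to the limit for each truncation.\<close>

lemma W_increment:
  assumes "v \<in> (\<Union>l. range (dyadic l))" "w \<in> (\<Union>l. range (dyadic l))"
  shows "(\<integral>\<^sup>+t. ennreal \<bar>W v t - W w t\<bar> \<partial>\<nu>) \<le> ennreal (K * L2_norm lborel (\<lambda>x. corner v x - corner w x))"
proof (rule nn_integral_abs_le_truncated)
  show "finite_measure \<nu>" by unfold_locales
  show "(\<lambda>t. W v t - W w t) \<in> borel_measurable \<nu>" using Wm[of v] Wm[of w] by simp
  fix n :: nat
  let ?H = "\<lambda>s::real. min \<bar>s\<bar> (real n)"
  \<comment> \<open>Written as a difference of indicators, the coefficients also cancel correctly
    when \<open>v = w\<close>.\<close>
  define c where "c u = of_bool (u = v) - (of_bool (u = w) :: real)" for u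
  have two: "(\<Sum>u\<in>{v, w}. c u * \<phi> u) = \<phi> v - \<phi> w" for \<phi> by (cases "v = w") (auto simp: c_def)
  have "(\<lambda>j. \<integral>g. ?H (\<Sum>u\<in>{v, w}. c u * X (r j) (corner u) g) \<partial>N (r j)) \<longlonglongrightarrow> (\<integral>t. ?H (\<Sum>u\<in>{v, w}. c u * W u t) \<partial>\<nu>)"
    by (rule lim[where B = "real n"]) (use assms in \<open>auto intro!: continuous_intros\<close>)
  then have "(\<lambda>j. \<integral>g. ?H (X (r j) (corner v) g - X (r j) (corner w) g) \<partial>N (r j)) \<longlonglongrightarrow> (\<integral>t. ?H (W v t - W w t) \<partial>\<nu>)"
    unfolding two .
  moreover have "(\<integral>g. ?H (X k (corner v) g - X k (corner w) g) \<partial>N k) \<le> K * L2_norm lborel (\<lambda>x. corner v x - corner w x)" for k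
  proof -
    interpret prob_space "N k" by (rule prob)
    have vw: "(\<lambda>x. corner v x - corner w x) \<in> L2 lborel" by (intro L2_diff corner_L2)
    have "(\<integral>g. ?H (X k (corner v) g - X k (corner w) g) \<partial>N k) \<le> (\<integral>g. \<bar>X k (\<lambda>x. corner v x - corner w x) g\<bar> \<partial>N k)"
    proof (rule integral_mono)
      show "integrable (N k) (\<lambda>g. \<bar>X k (\<lambda>x. corner v x - corner w x) g\<bar>)" using int[OF vw] by auto
      show "integrable (N k) (\<lambda>g. ?H (X k (corner v) g - X k (corner w) g))"
        using int[OF corner_L2, of k v] int[OF corner_L2, of k w] by (intro integrable_const_bound[where B = "real n"]) auto
      show "?H (X k (corner v) g - X k (corner w) g) \<le> \<bar>X k (\<lambda>x. corner v x - corner w x) g\<bar>" if "g \<in> space (N k)" for g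
        unfolding field_diff[OF that corner_L2 corner_L2] by simp
    qed
    also have "\<dots> \<le> K * L2_norm lborel (\<lambda>x. corner v x - corner w x)" by (rule bd[OF vw])
    finally show ?thesis .
  qed
  ultimately show "(\<integral>t. ?H (W v t - W w t) \<partial>\<nu>) \<le> K * L2_norm lborel (\<lambda>x. corner v x - corner w x)"
    by (intro LIMSEQ_le_const2) auto
qed

section \<open>Dyadic variation of the limit field\<close>

definition cell :: "nat \<Rightarrow> nat \<Rightarrow> real^'n \<Rightarrow> real" where
  "cell l R v = measure lborel {y \<in> cube (real R). dyadic l y = v}"

lemma cell_nonneg: "cell l R v \<ge> 0" by (simp add: cell_def)

lemma cell_meas: "{y \<in> cube (real R). dyadic l y = v} \<in> fmeasurable lborel" for v :: "real^'n"
proof (rule fmeasurableI2)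
  show "cube (real R) \<in> fmeasurable (lborel :: (real^'n) measure)"
    unfolding cube_def by (rule fmeasurable_cbox)
  have "{y \<in> cube (real R). dyadic l y = v} = cube (real R) \<inter> {y. dyadic l y = v}" by auto
  then show "{y \<in> cube (real R). dyadic l y = v} \<in> sets lborel" using dyadic_level_sets[of l v] cube_sets(2)[of "real R"] by auto
qed auto

lemma sum_cell: "(\<Sum>v\<in>dyadic l ` cube (real R). cell l R v) \<le> measure lborel (cube (real R) :: (real^'n) set)"
proof -
  have "(\<Sum>v\<in>dyadic l ` cube (real R). cell l R v) = measure lborel (\<Union>v\<in>dyadic l ` cube (real R). {y \<in> cube (real R). dyadic l y = v} :: (real^'n) set)"
    unfolding cell_def using finite_dyadic_cube fmeasurableD[OF cell_meas] fmeasurableD2[OF cell_meas]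
    by (intro measure_finite_Union[symmetric]) (auto simp: disjoint_family_on_def)
  also have "(\<Union>v\<in>dyadic l ` cube (real R). {y \<in> cube (real R). dyadic l y = v} :: (real^'n) set) = cube (real R)" by auto
  finally show ?thesis by simp
qed

text \<open>By \<open>dyadic_dyadic\<close> this is the L1 norm over the cube of the difference of
  the step functions \<open>\<lambda>y. W (dyadic (Suc l) y) t\<close> and
  \<open>\<lambda>y. W (dyadic l y) t\<close>.\<close>

definition variation :: "nat \<Rightarrow> nat \<Rightarrow> real \<Rightarrow> real" where
  "variation l R t = (\<Sum>v\<in>dyadic (Suc l) ` cube (real R). \<bar>W v t - W (dyadic l v) t\<bar> * cell (Suc l) R v)"

text \<open>What remains when coordinate differences of at most \<open>(1 / 2) ^ l\<close> are
  inserted in \<open>corner_Lipschitz\<close> and the factor \<open>sqrt (1 / 2) ^ l\<close> is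
  split off. The volume comes from summing the cells.\<close>

definition var_const :: "nat \<Rightarrow> real" where
  "var_const R = K * sqrt (2 * (2 * real R) ^ (CARD('n) - 1) * real CARD('n)) * measure lborel (cube (real R) :: (real^'n) set)"

lemma var_const_nonneg: "var_const R \<ge> 0" using K by (simp add: var_const_def)

text \<open>A dyadic point of level \<open>Suc l\<close> is within \<open>(1 / 2) ^ l\<close> of its
  rounding in every coordinate; the square root in the norm turns this into
  \<open>sqrt (1 / 2) ^ l\<close>.\<close>

lemma variation_expectation:
  "(\<integral>\<^sup>+t. ennreal (variation l R t) \<partial>\<nu>) \<le> ennreal (var_const R * sqrt (1 / 2) ^ l)"
proof -
  let ?I = "dyadic (Suc l) ` cube (real R) :: (real^'n) set"
  define A where "A = sqrt (2 * (2 * real R) ^ (CARD('n) - 1) * real CARD('n))"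
  have [measurable]: "W v \<in> borel_measurable borel" for v by (rule Wm)
  have close: "L2_norm lborel (\<lambda>x. corner v x - corner (dyadic l v) x) \<le> A * sqrt (1 / 2) ^ l" if vI: "v \<in> ?I" for v
  proof -
    obtain y where y: "y \<in> cube (real R)" "v = dyadic (Suc l) y" using vI by blast
    have v: "v \<in> cube (real R)" "dyadic l v \<in> cube (real R)" using y by (auto intro: dyadic_cube)
    have d: "\<bar>v $ i - dyadic l v $ i\<bar> \<le> (1 / 2) ^ l" for i using dyadic_bounds(1)[of l v i] dyadic_bounds(2)[of v i l] by linarith
    have "(L2_norm lborel (\<lambda>x. corner v x - corner (dyadic l v) x))\<^sup>2
      \<le> 2 * (2 * real R) ^ (CARD('n) - 1) * (\<Sum>i\<in>UNIV. \<bar>v $ i - dyadic l v $ i\<bar>)"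
      by (rule corner_Lipschitz[OF v]) simp
    also have "\<dots> \<le> 2 * (2 * real R) ^ (CARD('n) - 1) * (\<Sum>i\<in>(UNIV::'n set). (1 / 2) ^ l)"
      by (intro mult_left_mono sum_mono d) auto
    also have "\<dots> = (2 * (2 * real R) ^ (CARD('n) - 1) * real CARD('n)) * (1 / 2) ^ l" by simp
    also have "\<dots> = (A * sqrt (1 / 2) ^ l)\<^sup>2"
    proof -
      have "(sqrt (1 / 2) ^ l)\<^sup>2 = (1 / 2 :: real) ^ l"
        by (simp add: power2_eq_square power_mult_distrib[symmetric])
      then show ?thesis by (simp add: A_def power_mult_distrib)
    qed
    finally show ?thesis by (rule power2_le_imp_le) (simp add: A_def)
  qed
  have "(\<integral>\<^sup>+t. ennreal (variation l R t) \<partial>\<nu>)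
      = (\<integral>\<^sup>+t. (\<Sum>v\<in>?I. ennreal \<bar>W v t - W (dyadic l v) t\<bar> * ennreal (cell (Suc l) R v)) \<partial>\<nu>)"
  proof (intro nn_integral_cong)
    fix t
    have "ennreal (variation l R t) = (\<Sum>v\<in>?I. ennreal (\<bar>W v t - W (dyadic l v) t\<bar> * cell (Suc l) R v))"
      unfolding variation_def by (rule sum_ennreal[symmetric]) (simp add: cell_nonneg)
    then show "ennreal (variation l R t) = (\<Sum>v\<in>?I. ennreal \<bar>W v t - W (dyadic l v) t\<bar> * ennreal (cell (Suc l) R v))"
      by (simp only: ennreal_mult[OF abs_ge_zero cell_nonneg])
  qed
  also have "\<dots> = (\<Sum>v\<in>?I. (\<integral>\<^sup>+t. ennreal \<bar>W v t - W (dyadic l v) t\<bar> \<partial>\<nu>) * ennreal (cell (Suc l) R v))"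
    by (simp add: nn_integral_sum nn_integral_multc)
  also have "\<dots> \<le> (\<Sum>v\<in>?I. ennreal (K * (A * sqrt (1 / 2) ^ l)) * ennreal (cell (Suc l) R v))"
  proof (intro sum_mono mult_right_mono)
    fix v assume v: "v \<in> ?I"
    then have "v \<in> (\<Union>l. range (dyadic l))" by auto
    moreover have "dyadic l v \<in> (\<Union>l. range (dyadic l))" by auto
    ultimately have "(\<integral>\<^sup>+t. ennreal \<bar>W v t - W (dyadic l v) t\<bar> \<partial>\<nu>)
        \<le> ennreal (K * L2_norm lborel (\<lambda>x. corner v x - corner (dyadic l v) x))" by (rule W_increment)
    also have "ennreal (K * L2_norm lborel (\<lambda>x. corner v x - corner (dyadic l v) x)) \<le> ennreal (K * (A * sqrt (1 / 2) ^ l))"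
      by (intro ennreal_leI mult_left_mono close v K)
    finally show "(\<integral>\<^sup>+t. ennreal \<bar>W v t - W (dyadic l v) t\<bar> \<partial>\<nu>) \<le> ennreal (K * (A * sqrt (1 / 2) ^ l))" .
  qed simp
  also have "\<dots> = ennreal (K * (A * sqrt (1 / 2) ^ l) * (\<Sum>v\<in>?I. cell (Suc l) R v))"
  proof -
    have "K * (A * sqrt (1 / 2) ^ l) \<ge> 0" using K by (simp add: A_def)
    moreover have "(\<Sum>v\<in>?I. ennreal (cell (Suc l) R v)) = ennreal (\<Sum>v\<in>?I. cell (Suc l) R v)"
      by (rule sum_ennreal) (rule cell_nonneg)
    ultimately show ?thesis
      by (simp only: sum_distrib_left[symmetric] ennreal_mult[OF _ sum_nonneg[OF cell_nonneg]])
  qed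
  also have "\<dots> \<le> ennreal (K * (A * sqrt (1 / 2) ^ l) * measure lborel (cube (real R) :: (real^'n) set))"
    using K by (intro ennreal_leI mult_left_mono sum_cell) (simp add: A_def)
  also have "K * (A * sqrt (1 / 2) ^ l) * measure lborel (cube (real R) :: (real^'n) set) = var_const R * sqrt (1 / 2) ^ l"
    by (simp add: var_const_def A_def mult_ac)
  finally show ?thesis .
qed

text \<open>The mean variation at level \<open>l\<close> decays like \<open>p ^ (2 * l)\<close>. One factor \<open>p ^ l\<close> makes the weighted
  sum \<open>total\<close> converge, the other one is left as the decay of the variation where \<open>total\<close> is finite.\<close>

definition p :: real where "p = sqrt (sqrt (1 / 2))"

lemma p: "0 < p" "p < 1" "p * p = sqrt (1 / 2)"
  by (simp_all add: p_def)

text \<open>The factor \<open>(1 / 2) ^ R\<close> allows all cubes to be treated in one sum, and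
  \<open>1 + var_const R\<close> absorbs the constant of the cube without a division by 0.\<close>

definition wt :: "nat \<Rightarrow> nat \<Rightarrow> real" where
  "wt l R = (1 / 2) ^ R / ((1 + var_const R) * p ^ l)"

lemma wt_pos: "wt l R > 0" unfolding wt_def
  using var_const_nonneg[of R] p by (intro divide_pos_pos mult_pos_pos) auto

definition total :: "real \<Rightarrow> ennreal" where
  "total t = (\<Sum>R. \<Sum>l. ennreal (variation l R t * wt l R))"

lemma variation_measurable: "variation l R \<in> borel_measurable borel"
  unfolding variation_def using Wm by (intro borel_measurable_sum borel_measurable_times borel_measurable_abs borel_measurable_diff) auto

lemma total_measurable: "total \<in> borel_measurable borel"
proof -
  note [measurable] = variation_measurable
  show ?thesis unfolding total_def[abs_def] by measurable
qed

lemma total_expectation: "(\<integral>\<^sup>+t. total t \<partial>\<nu>) < \<infinity>"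
proof -
  have [measurable]: "variation l R \<in> borel_measurable borel" for l R by (rule variation_measurable)
  have le: "(\<integral>\<^sup>+t. ennreal (variation l R t * wt l R) \<partial>\<nu>) \<le> ennreal ((1 / 2) ^ R * p ^ l)" for l R
  proof -
    have v0: "variation l R t \<ge> 0" for t unfolding variation_def by (intro sum_nonneg mult_nonneg_nonneg cell_nonneg) auto
    have "(\<integral>\<^sup>+t. ennreal (variation l R t * wt l R) \<partial>\<nu>) = (\<integral>\<^sup>+t. ennreal (variation l R t) \<partial>\<nu>) * ennreal (wt l R)"
      using wt_pos[of l R] by (simp add: ennreal_mult'' less_imp_le nn_integral_multc)
    also have "\<dots> \<le> ennreal (var_const R * sqrt (1 / 2) ^ l) * ennreal (wt l R)"
      by (intro mult_right_mono variation_expectation) simp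
    also have "\<dots> = ennreal (var_const R * sqrt (1 / 2) ^ l * wt l R)"
      using wt_pos[of l R] by (simp add: ennreal_mult'' less_imp_le)
    also have "\<dots> \<le> ennreal ((1 / 2) ^ R * p ^ l)"
    proof (rule ennreal_leI)
      have pl: "p ^ l > 0" using p by simp
      have cancel: "e * (x * x) * (s / ((1 + e) * x)) = (e / (1 + e)) * (s * x)" if "x \<noteq> 0" "1 + e \<noteq> 0" for e x s :: real
        using that by (simp add: divide_simps mult_ac)
      have "var_const R * sqrt (1 / 2) ^ l * wt l R = (var_const R / (1 + var_const R)) * ((1 / 2) ^ R * p ^ l)"
        unfolding wt_def p(3)[symmetric] power_mult_distrib
        using pl var_const_nonneg[of R] p(1) by (intro cancel) auto
      also have "\<dots> \<le> 1 * ((1 / 2) ^ R * p ^ l)"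
        using var_const_nonneg[of R] pl by (intro mult_right_mono) auto
      finally show "var_const R * sqrt (1 / 2) ^ l * wt l R \<le> (1 / 2) ^ R * p ^ l" by simp
    qed
    finally show ?thesis .
  qed
  have "(\<integral>\<^sup>+t. total t \<partial>\<nu>) = (\<Sum>R. \<Sum>l. (\<integral>\<^sup>+t. ennreal (variation l R t * wt l R) \<partial>\<nu>))"
    unfolding total_def by (simp add: nn_integral_suminf)
  also have "\<dots> \<le> (\<Sum>R. \<Sum>l. ennreal ((1 / 2) ^ R * p ^ l))"
    by (intro suminf_le le summableI)
  also have "\<dots> = (\<Sum>R. ennreal ((1 / 2) ^ R * (1 / (1 - p))))"
  proof (intro suminf_cong)
    fix R
    have "(\<lambda>l. (1 / 2) ^ R * p ^ l) sums ((1 / 2) ^ R * (1 / (1 - p)))"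
      using p by (intro sums_mult geometric_sums) simp
    then show "(\<Sum>l. ennreal ((1 / 2) ^ R * p ^ l)) = ennreal ((1 / 2) ^ R * (1 / (1 - p)))"
      using p by (intro suminf_ennreal_eq) auto
  qed
  also have "\<dots> = ennreal (2 * (1 / (1 - p)))"
  proof (rule suminf_ennreal_eq)
    have "(\<lambda>R. (1 / 2 :: real) ^ R) sums 2" using geometric_sums[of "1 / 2 :: real"] by simp
    then show "(\<lambda>R. (1 / 2) ^ R * (1 / (1 - p))) sums (2 * (1 / (1 - p)))" by (rule sums_mult2)
  qed (use p in simp)
  finally show ?thesis by (rule order_le_less_trans) simp
qed

text \<open>Sublevel sets of \<open>total\<close>: the convergence will be uniform on each of them
  for every test function, and together they have full measure.\<close>

definition good :: "nat \<Rightarrow> real set" where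
  "good n = \<Gamma> \<inter> {t. total t \<le> of_nat n}"

lemma good_sets: "good n \<in> sets borel"
proof -
  note [measurable] = total_measurable \<Gamma>(1)
  show ?thesis unfolding good_def by measurable
qed

lemma good_incseq: "incseq good"
  unfolding incseq_def good_def
proof (intro allI impI Int_mono subset_refl Collect_mono)
  fix m n :: nat and t assume "m \<le> n" "total t \<le> of_nat m"
  then show "total t \<le> of_nat n" using of_nat_mono[of m n, where 'a = ennreal] by (meson order_trans)
qed

lemma good_full: "emeasure \<nu> (\<Union>n. good n) = 1"
proof -
  have "AE t in \<nu>. t \<in> \<Gamma>" using \<Gamma> by (intro \<nu>.AE_in_set_eq_1[THEN iffD2]) auto
  moreover have "AE t in \<nu>. total t \<noteq> \<infinity>"
    using total_measurable total_expectation by (intro nn_integral_PInf_AE) auto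
  ultimately have "AE t in \<nu>. t \<in> (\<Union>n. good n)"
  proof eventually_elim
    case (elim t)
    then obtain x where "total t = ennreal x" "x \<ge> 0" by (cases "total t") auto
    moreover obtain n :: nat where "x \<le> real n" using real_arch_simple by blast
    ultimately have "total t \<le> of_nat n" by (simp add: ennreal_of_nat_eq_real_of_nat ennreal_leI)
    then show ?case using elim by (auto simp: good_def)
  qed
  then have "emeasure \<nu> (\<Union>n. good n) = emeasure \<nu> (space \<nu>)"
    using good_sets by (intro emeasure_eq_AE) auto
  then show ?thesis using \<nu>.emeasure_space_1 by simp
qed

lemma variation_good:
  assumes "t \<in> good n" shows "variation l R t \<le> real n / wt l R"
proof -
  have "ennreal (variation l R t * wt l R) \<le> (\<Sum>l. ennreal (variation l R t * wt l R))"
    using sum_le_suminf[of "\<lambda>l. ennreal (variation l R t * wt l R)" "{l}"] by simp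
  also have "\<dots> \<le> total t"
    unfolding total_def using sum_le_suminf[of "\<lambda>R. \<Sum>l. ennreal (variation l R t * wt l R)" "{R}"] by simp
  also have "\<dots> \<le> ennreal (real n)" using assms by (simp add: good_def ennreal_of_nat_eq_real_of_nat)
  finally have "variation l R t * wt l R \<le> real n" by simp
  then show ?thesis using wt_pos[of l R] by (simp add: pos_le_divide_eq)
qed

end

section \<open>The limit as a random distribution\<close>

context limit_field
begin

definition coef :: "nat \<Rightarrow> real^'n \<Rightarrow> (real^'n \<Rightarrow> real) \<Rightarrow> real" where
  "coef l v f = (\<integral>y. mixed f y * indicator {y. dyadic l y = v} y \<partial>lborel)"

text \<open>The mixed derivative, in the sense of distributions, of the step function
  \<open>\<lambda>y. W (dyadic l y) t\<close>; the sign of the integrations by parts is contained in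
  \<open>mixed\<close>.\<close>

definition T :: "nat \<Rightarrow> real \<Rightarrow> (real^'n \<Rightarrow> real) \<Rightarrow> real" where
  "T l t f = (\<integral>y. mixed f y * W (dyadic l y) t \<partial>lborel)"

lemma mixed_integrable:
  assumes "f \<in> test_R" shows "integrable lborel (mixed f)"
  by (rule bounded_compact_supportD(2)[OF test_R_bounded_compact_support[OF mixed_test_R[OF assms]]])

lemma integral_dyadic:
  assumes f: "f \<in> test_R" and R: "\<forall>y. y \<notin> cube (real R) \<longrightarrow> mixed f y = 0"
  shows "(\<integral>y. mixed f y * k (dyadic l y) \<partial>lborel) = (\<Sum>v\<in>dyadic l ` cube (real R). k v * coef l v f)"
    and "integrable lborel (\<lambda>y. mixed f y * k (dyadic l y))"
proof -
  have B: "cube (real R) \<in> sets (lborel :: (real^'n) measure)" using cube_sets by simp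
  note * = integral_finite_range[OF finite_dyadic_cube[of l R] dyadic_level_sets B mixed_integrable[OF f] R[rule_format], where k = k]
  show "(\<integral>y. mixed f y * k (dyadic l y) \<partial>lborel) = (\<Sum>v\<in>dyadic l ` cube (real R). k v * coef l v f)"
    unfolding coef_def by (rule *(1))
  show "integrable lborel (\<lambda>y. mixed f y * k (dyadic l y))" by (rule *(2))
qed

lemma T_sum:
  assumes "f \<in> test_R" and "\<forall>y. y \<notin> cube (real R) \<longrightarrow> mixed f y = 0"
  shows "T l t f = (\<Sum>v\<in>dyadic l ` cube (real R). W v t * coef l v f)"
  unfolding T_def by (rule integral_dyadic(1)[OF assms, where k = "\<lambda>v. W v t"])

text \<open>Both levels are sums over the finer cells, and a coefficient is at most \<open>B\<close>
  times the volume of its cell. The second bound serves as the start of the telescoping at level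
  0.\<close>

lemma T_increment:
  assumes f: "f \<in> test_R" and R: "\<forall>y. y \<notin> cube (real R) \<longrightarrow> mixed f y = 0"
    and B: "\<And>y. \<bar>mixed f y\<bar> \<le> B"
  shows "\<bar>T (Suc l) t f - T l t f\<bar> \<le> B * variation l R t"
    and "\<bar>T 0 t f\<bar> \<le> B * (\<Sum>v\<in>dyadic 0 ` cube (real R). \<bar>W v t\<bar> * cell 0 R v)"
proof -
  have B0: "B \<ge> 0" using B[of undefined] by (rule order_trans[OF abs_ge_zero])
  have cb: "\<bar>coef l v f\<bar> \<le> B * cell l R v" for l v
  proof -
    have fin: "emeasure lborel {y \<in> cube (real R). dyadic l y = v} < \<infinity>"
      using fmeasurableD2[OF cell_meas[of R l v]] by (simp add: less_top)
    have i: "integrable lborel (\<lambda>y. B * indicator {y \<in> cube (real R). dyadic l y = v} y)"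
      using fin fmeasurableD[OF cell_meas[of R l v]] by (intro integrable_mult_right integrable_real_indicator)
    have "\<bar>coef l v f\<bar> \<le> (\<integral>y. \<bar>mixed f y * indicator {y. dyadic l y = v} y\<bar> \<partial>lborel)"
      unfolding coef_def by (rule integral_abs_bound)
    also have "\<dots> \<le> (\<integral>y. B * indicator {y \<in> cube (real R). dyadic l y = v} y \<partial>lborel)"
      by (rule integral_mono'[OF i]) (use B B0 R in \<open>auto simp: indicator_def\<close>)
    also have "\<dots> = B * cell l R v"
      using fmeasurableD[OF cell_meas[of R l v]] fin by (simp add: cell_def)
    finally show ?thesis .
  qed
  have "T l t f = (\<integral>y. mixed f y * W (dyadic l (dyadic (Suc l) y)) t \<partial>lborel)"
    by (simp add: T_def dyadic_dyadic)
  also have "\<dots> = (\<Sum>v\<in>dyadic (Suc l) ` cube (real R). W (dyadic l v) t * coef (Suc l) v f)"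
    by (rule integral_dyadic(1)[OF f R, where k = "\<lambda>v. W (dyadic l v) t"])
  finally have "T (Suc l) t f - T l t f
      = (\<Sum>v\<in>dyadic (Suc l) ` cube (real R). (W v t - W (dyadic l v) t) * coef (Suc l) v f)"
    unfolding T_sum[OF f R]
    by (simp add: sum_subtractf left_diff_distrib)
  also have "\<bar>\<dots>\<bar> \<le> (\<Sum>v\<in>dyadic (Suc l) ` cube (real R). \<bar>W v t - W (dyadic l v) t\<bar> * (B * cell (Suc l) R v))"
    by (intro order_trans[OF sum_abs] sum_mono) (auto simp: abs_mult intro: mult_left_mono cb)
  also have "\<dots> = B * variation l R t" by (simp add: variation_def sum_distrib_left mult_ac)
  finally show "\<bar>T (Suc l) t f - T l t f\<bar> \<le> B * variation l R t" .
  have "\<bar>T 0 t f\<bar> \<le> (\<Sum>v\<in>dyadic 0 ` cube (real R). \<bar>W v t\<bar> * (B * cell 0 R v))"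
    unfolding T_sum[OF f R]
    by (intro order_trans[OF sum_abs] sum_mono) (auto simp: abs_mult intro: mult_left_mono cb)
  then show "\<bar>T 0 t f\<bar> \<le> B * (\<Sum>v\<in>dyadic 0 ` cube (real R). \<bar>W v t\<bar> * cell 0 R v)"
    by (simp add: sum_distrib_left mult_ac)
qed

text \<open>This is \<open>real n / wt l R\<close> without its factor \<open>p ^ l\<close>.\<close>

definition bound :: "nat \<Rightarrow> nat \<Rightarrow> real" where
  "bound n R = real n * (1 + var_const R) * 2 ^ R"

lemma T_converges:
  assumes t: "t \<in> good n" and f: "f \<in> test_R" and R: "\<forall>y. y \<notin> cube (real R) \<longrightarrow> mixed f y = 0"
    and B: "\<And>y. \<bar>mixed f y\<bar> \<le> B"
  shows "convergent (\<lambda>l. T l t f)"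
    and "\<bar>lim (\<lambda>l. T l t f) - T l t f\<bar> \<le> B * bound n R * p ^ l / (1 - p)"
proof -
  have B0: "B \<ge> 0" using B[of undefined] by (rule order_trans[OF abs_ge_zero])
  have inc: "\<bar>T (Suc l) t f - T l t f\<bar> \<le> B * bound n R * p ^ l" for l
  proof -
    have "real n / wt l R = bound n R * p ^ l"
      unfolding wt_def bound_def power_one_over by (simp add: mult_ac)
    then have "B * variation l R t \<le> B * (bound n R * p ^ l)"
      using variation_good[OF t, of l R] B0 by (intro mult_left_mono) auto
    then show ?thesis using T_increment(1)[OF f R B, of l t] by (simp add: mult.assoc)
  qed
  note * = geometric_increments[of "\<lambda>l. T l t f", OF inc]
  show "convergent (\<lambda>l. T l t f)" by (rule *(1)) (use p in auto)
  show "\<bar>lim (\<lambda>l. T l t f) - T l t f\<bar> \<le> B * bound n R * p ^ l / (1 - p)" by (rule *(2)) (use p in auto)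
qed

lemma test_R_mixed_bounds:
  assumes "f \<in> test_R"
  obtains R :: nat and B where "supp f \<subseteq> cube (real R)" "\<forall>y. y \<notin> cube (real R) \<longrightarrow> mixed f y = 0" "\<And>y. \<bar>mixed f y\<bar> \<le> B"
proof -
  obtain R :: nat where "supp f \<subseteq> cube (real R)"
    using compact_subset_cube[of "supp f"] assms by (auto simp: test_R_def)
  moreover obtain B where "\<And>y. \<bar>mixed f y\<bar> \<le> B" using test_R_bounded[OF mixed_test_R[OF assms]] by blast
  ultimately show ?thesis using that[of R B] mixed_zero_outside by blast
qed

lemma T_lincomb:
  assumes f: "f \<in> test_R" and h: "h \<in> test_R"
  shows "T l t (\<lambda>x. a * f x + b * h x) = a * T l t f + b * T l t h"
proof -
  obtain R B where R: "\<forall>y. y \<notin> cube (real R) \<longrightarrow> mixed f y = 0" by (rule test_R_mixed_bounds[OF f]) blast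
  obtain R' B' where R': "\<forall>y. y \<notin> cube (real R') \<longrightarrow> mixed h y = 0" by (rule test_R_mixed_bounds[OF h]) blast
  have "T l t (\<lambda>x. a * f x + b * h x)
      = (\<integral>y. a * (mixed f y * W (dyadic l y) t) + b * (mixed h y * W (dyadic l y) t) \<partial>lborel)"
    unfolding T_def mixed_lincomb[OF f h] by (simp add: distrib_right mult.assoc)
  then show ?thesis
    using integral_dyadic(2)[OF f R, where k = "\<lambda>v. W v t" and l = l] integral_dyadic(2)[OF h R', where k = "\<lambda>v. W v t" and l = l] by (simp add: T_def)
qed

text \<open>Off the good sets the zero functional is taken: it is a distribution, and
  \<open>radon_pushforward\<close> asks for a constant there.\<close>

definition \<Phi> :: "real \<Rightarrow> (real^'n \<Rightarrow> real) \<Rightarrow> real" where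
  "\<Phi> t = restrict (\<lambda>f. if t \<in> (\<Union>n. good n) then lim (\<lambda>l. T l t f) else 0) test_R"

lemma \<Phi>_good:
  assumes "t \<in> good n" "f \<in> test_R"
  shows "\<Phi> t f = lim (\<lambda>l. T l t f)" "(\<lambda>l. T l t f) \<longlonglongrightarrow> \<Phi> t f"
proof -
  show e: "\<Phi> t f = lim (\<lambda>l. T l t f)" using assms by (auto simp: \<Phi>_def)
  obtain R B where "\<forall>y. y \<notin> cube (real R) \<longrightarrow> mixed f y = 0" "\<And>y. \<bar>mixed f y\<bar> \<le> B"
    by (rule test_R_mixed_bounds[OF assms(2)]) blast
  then have "convergent (\<lambda>l. T l t f)" by (rule T_converges(1)[OF assms])
  then show "(\<lambda>l. T l t f) \<longlonglongrightarrow> \<Phi> t f" unfolding e by (simp add: convergent_LIMSEQ_iff)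
qed

lemma \<Phi>_linear: "linear_functional_on test_R (\<Phi> t)"
  unfolding linear_functional_on_def
proof (intro ballI allI)
  fix f h :: "real^'n \<Rightarrow> real" and a b assume f: "f \<in> test_R" and h: "h \<in> test_R"
  note fh = test_R_lincomb[OF f h, of a b]
  show "\<Phi> t (\<lambda>x. a * f x + b * h x) = a * \<Phi> t f + b * \<Phi> t h"
  proof (cases "t \<in> (\<Union>n. good n)")
    case True
    then obtain n where t: "t \<in> good n" by blast
    have "(\<lambda>l. T l t (\<lambda>x. a * f x + b * h x)) \<longlonglongrightarrow> a * \<Phi> t f + b * \<Phi> t h"
      unfolding T_lincomb[OF f h] by (intro tendsto_intros \<Phi>_good(2)[OF t] f h)
    then show ?thesis using \<Phi>_good(2)[OF t fh] LIMSEQ_unique by blast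
  next
    case False
    then show ?thesis using f h fh by (simp add: \<Phi>_def)
  qed
qed

text \<open>Level 0 plus a geometric series. Only the supremum of \<open>mixed f\<close> enters, so
  on every compact set the derivatives up to order \<open>length axes\<close> control the
  functional.\<close>

lemma \<Phi>_distrib: "\<Phi> t \<in> distrib_R"
proof -
  have "continuous_map test_R_topology euclideanreal (\<Phi> t)"
  proof (rule linear_functional_continuous[OF \<Phi>_linear])
    fix K' :: "(real^'n) set" assume "compact K'"
    then obtain R :: nat where R: "K' \<subseteq> cube (real R)" using compact_subset_cube by blast
    show "\<exists>N C. \<forall>f\<in>test_R. \<forall>B. supp f \<subseteq> K' \<longrightarrow>
      (\<forall>L x. set L \<subseteq> Basis \<and> length L \<le> N \<longrightarrow> \<bar>iter_deriv L f x\<bar> \<le> B) \<longrightarrow> \<bar>\<Phi> t f\<bar> \<le> C * B"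
    proof (cases "t \<in> (\<Union>n. good n)")
      case True
      then obtain n where t: "t \<in> good n" by blast
      define C where "C = bound n R * p ^ 0 / (1 - p) + (\<Sum>v\<in>dyadic 0 ` cube (real R). \<bar>W v t\<bar> * cell 0 R v)"
      have "\<bar>\<Phi> t f\<bar> \<le> C * B" if f: "f \<in> test_R" and s: "supp f \<subseteq> K'"
        and B: "\<forall>L x. set L \<subseteq> Basis \<and> length L \<le> length (axes :: (real^'n) list) \<longrightarrow> \<bar>iter_deriv L f x\<bar> \<le> B" for f B
      proof -
        have z: "\<forall>y. y \<notin> cube (real R) \<longrightarrow> mixed f y = 0"
          using mixed_zero_outside[of f "cube (real R)"] s R by blast
        have mB: "\<bar>mixed f y\<bar> \<le> B" for y using B axes_Basis unfolding abs_mixed by blast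
        have "\<bar>\<Phi> t f\<bar> \<le> \<bar>lim (\<lambda>l. T l t f) - T 0 t f\<bar> + \<bar>T 0 t f\<bar>" unfolding \<Phi>_good(1)[OF t f] by linarith
        also have "\<dots> \<le> B * bound n R * p ^ 0 / (1 - p) + B * (\<Sum>v\<in>dyadic 0 ` cube (real R). \<bar>W v t\<bar> * cell 0 R v)"
          by (intro add_mono T_converges(2)[OF t f z mB] T_increment(2)[OF f z mB])
        also have "\<dots> = C * B" by (simp add: C_def distrib_right mult.commute[of B])
        finally show ?thesis .
      qed
      then show ?thesis by blast
    next
      case False
      then show ?thesis by (intro exI[of _ "0::nat"] exI[of _ "0::real"]) (simp add: \<Phi>_def)
    qed
  qed
  then show ?thesis using \<Phi>_linear by (simp add: distrib_R_def \<Phi>_def)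
qed

text \<open>The error of level \<open>l\<close> is bounded on \<open>good n\<close> independently of
  \<open>t\<close>, so \<open>\<lambda>t. \<Phi> t f\<close> is a uniform limit of finite sums of
  functions that are continuous on \<open>\<Gamma>\<close>.\<close>

lemma \<Phi>_continuous:
  "continuous_map (top_of_set (good n)) distrib_R_topology \<Phi>"
proof (rule continuous_map_into_distrib_R[OF \<Phi>_distrib])
  fix f :: "real^'n \<Rightarrow> real" assume f: "f \<in> test_R"
  obtain R B where R: "\<forall>y. y \<notin> cube (real R) \<longrightarrow> mixed f y = 0" and B: "\<And>y. \<bar>mixed f y\<bar> \<le> B"
    by (rule test_R_mixed_bounds[OF f]) blast
  have "uniform_limit (good n) (\<lambda>l t. T l t f) (\<lambda>t. \<Phi> t f) sequentially"
    unfolding uniform_limit_iff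
  proof (intro allI impI)
    fix e :: real assume e: "e > 0"
    have "(\<lambda>l. B * bound n R * p ^ l / (1 - p)) \<longlonglongrightarrow> B * bound n R * 0 / (1 - p)"
      using p by (intro tendsto_intros LIMSEQ_power_zero) auto
    then have "\<forall>\<^sub>F l in sequentially. B * bound n R * p ^ l / (1 - p) < e"
      using e by (intro order_tendstoD) auto
    then show "\<forall>\<^sub>F l in sequentially. \<forall>t\<in>good n. dist (T l t f) (\<Phi> t f) < e"
    proof eventually_elim
      case (elim l)
      show ?case
      proof
        fix t assume t: "t \<in> good n"
        show "dist (T l t f) (\<Phi> t f) < e"
          using T_converges(2)[OF t f R B, where l = l] elim unfolding dist_real_def \<Phi>_good(1)[OF t f] by linarith
      qed
    qed
  qed
  moreover have "continuous_on (good n) (\<lambda>t. T l t f)" for l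
    unfolding T_sum[OF f R]
    by (intro continuous_intros continuous_on_subset[OF Wc]) (auto simp: good_def)
  ultimately have "continuous_on (good n) (\<lambda>t. \<Phi> t f)"
    by (intro uniform_limit_theorem[OF _ _ sequentially_bot]) auto
  then show "continuous_map (top_of_set (good n)) euclideanreal (\<lambda>t. \<Phi> t f)" by simp
qed

definition \<mu> :: "((real^'n \<Rightarrow> real) \<Rightarrow> real) measure" where
  "\<mu> = distr \<nu> (sigma (topspace distrib_R_topology) {U. openin distrib_R_topology U}) \<Phi>"

lemma \<Phi>_measurable: "\<Phi> \<in> \<nu> \<rightarrow>\<^sub>M sigma (topspace distrib_R_topology) {U. openin distrib_R_topology U}"
  and radon_\<mu>: "radon_prob distrib_R_topology \<mu>"
proof -
  have c: "\<Phi> t = restrict (\<lambda>_. 0) test_R" if "t \<notin> (\<Union>n. good n)" for t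
    using that by (auto simp: \<Phi>_def fun_eq_iff restrict_def)
  have d: "\<Phi> t \<in> topspace distrib_R_topology" for t by (simp add: topspace_distrib_R \<Phi>_distrib)
  note * = radon_pushforward[OF \<nu> Hausdorff_distrib_R good_sets good_incseq good_full d \<Phi>_continuous c, folded \<mu>_def]
  show "\<Phi> \<in> \<nu> \<rightarrow>\<^sub>M sigma (topspace distrib_R_topology) {U. openin distrib_R_topology U}" by (rule *(1))
  show "radon_prob distrib_R_topology \<mu>" by (rule *(2))
qed

lemma eval_measurable:
  fixes f :: "real^'n \<Rightarrow> real"
  assumes "f \<in> test_R"
  shows "(\<lambda>\<phi>. \<phi> f) \<in> borel_measurable (sigma (topspace distrib_R_topology) {U. openin distrib_R_topology U})"
proof (rule continuous_map_borel_measurable[OF continuous_map_distrib_R_eval[OF assms]])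
  have "{U. openin distrib_R_topology U} \<subseteq> Pow (topspace (distrib_R_topology :: ((real^'n \<Rightarrow> real) \<Rightarrow> real) topology))"
    by (auto dest: openin_subset)
  then show "space (sigma (topspace distrib_R_topology) {U. openin (distrib_R_topology :: ((real^'n \<Rightarrow> real) \<Rightarrow> real) topology) U}) = topspace distrib_R_topology"
    "sets (sigma (topspace distrib_R_topology) {U. openin (distrib_R_topology :: ((real^'n \<Rightarrow> real) \<Rightarrow> real) topology) U})
      = sigma_sets (topspace distrib_R_topology) {U. openin distrib_R_topology U}" by simp_all
qed

text \<open>Two limits are interchanged. Replacing \<open>f\<close> by the combination
  \<open>a l\<close> of corners costs at most \<open>K\<close> times a norm, whatever
  \<open>j\<close> is. For fixed \<open>l\<close> only finitely many corners occur and weak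
  convergence applies. As \<open>l\<close> grows, \<open>T l t f\<close> tends to
  \<open>\<Phi> t f\<close> almost surely.\<close>

lemma Lipschitz_limit:
  fixes H :: "real \<Rightarrow> real"
  assumes f: "f \<in> test_R" and H: "\<And>x y. \<bar>H x - H y\<bar> \<le> \<bar>x - y\<bar>" "\<And>x. \<bar>H x\<bar> \<le> 1"
  shows "(\<lambda>j. \<integral>g. H (X (r j) f g) \<partial>N (r j)) \<longlonglongrightarrow> (\<integral>t. H (\<Phi> t f) \<partial>\<nu>)"
proof -
  obtain R B where R: "\<forall>y. y \<notin> cube (real R) \<longrightarrow> mixed f y = 0"
    by (rule test_R_mixed_bounds[OF f]) blast
  define I where "I l = (dyadic l ` cube (real R) :: (real^'n) set)" for l
  define a where "a l x = (\<Sum>v\<in>I l. coef l v f * corner v x)" for l x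
  have Hc: "continuous_on UNIV H"
    unfolding continuous_on_iff dist_real_def using H(1) by (meson order_le_less_trans)
  then have Hm [measurable]: "H \<in> borel_measurable borel" by (rule borel_measurable_continuous_onI)
  have Hi: "isCont H x" for x using Hc by (simp add: continuous_on_eq_continuous_at)
  have I: "finite (I l)" "I l \<subseteq> (\<Union>l. range (dyadic l))" for l
    unfolding I_def using finite_dyadic_cube by auto
  have fL: "f \<in> L2 lborel" by (rule bounded_compact_supportD(3)[OF test_R_bounded_compact_support[OF f]])
  have aL: "a l \<in> L2 lborel" for l unfolding a_def by (intro L2_sum L2_scale corner_L2)
  have Tm: "(\<lambda>t. T l t f) \<in> borel_measurable \<nu>" for l
    unfolding T_sum[OF f R]
    using Wm by (intro borel_measurable_sum borel_measurable_times borel_measurable_const) simp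
  show ?thesis
  proof (rule interchange_limits)
    show "\<bar>(\<integral>g. H (X (r j) f g) \<partial>N (r j)) - (\<integral>g. H (X (r j) (a l) g) \<partial>N (r j))\<bar> \<le> K * L2_norm lborel (\<lambda>x. f x - a l x)" for j l
      by (rule field_Lipschitz[OF fL aL H])
    have "(\<lambda>l. L2_norm lborel (\<lambda>x. f x - a l x)) \<longlonglongrightarrow> 0"
      unfolding a_def I_def coef_def by (rule dyadic_approximation[OF f R[rule_format]])
    then show "(\<lambda>l. K * L2_norm lborel (\<lambda>x. f x - a l x)) \<longlonglongrightarrow> 0" by (rule tendsto_mult_right_zero)
    show "(\<lambda>j. \<integral>g. H (X (r j) (a l) g) \<partial>N (r j)) \<longlonglongrightarrow> (\<integral>t. H (T l t f) \<partial>\<nu>)" for l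
    proof -
      have "(\<lambda>j. \<integral>g. H (\<Sum>v\<in>I l. coef l v f * X (r j) (corner v) g) \<partial>N (r j)) \<longlonglongrightarrow> (\<integral>t. H (\<Sum>v\<in>I l. coef l v f * W v t) \<partial>\<nu>)"
        by (rule lim[OF Hi H(2) I])
      moreover have "(\<integral>g. H (\<Sum>v\<in>I l. coef l v f * X k (corner v) g) \<partial>N k) = (\<integral>g. H (X k (a l) g) \<partial>N k)" for k
        unfolding a_def by (rule Bochner_Integration.integral_cong[OF refl])
          (simp add: field_sum[OF _ I(1) corner_L2])
      moreover have "(\<Sum>v\<in>I l. coef l v f * W v t) = T l t f" for t
        unfolding T_sum[OF f R] by (simp add: I_def mult.commute)
      ultimately show ?thesis by simp
    qed
    show "(\<lambda>l. \<integral>t. H (T l t f) \<partial>\<nu>) \<longlonglongrightarrow> (\<integral>t. H (\<Phi> t f) \<partial>\<nu>)"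
    proof (rule integral_dominated_convergence[where w = "\<lambda>_. 1"])
      show "(\<lambda>t. H (\<Phi> t f)) \<in> borel_measurable \<nu>"
        using measurable_compose[OF measurable_compose[OF \<Phi>_measurable eval_measurable[OF f]] Hm] .
      show "(\<lambda>t. H (T l t f)) \<in> borel_measurable \<nu>" for l using measurable_compose[OF Tm Hm] .
      have "AE t in \<nu>. t \<in> (\<Union>n. good n)"
        using good_full good_sets by (intro \<nu>.AE_in_set_eq_1[THEN iffD2]) (auto simp: \<nu>.emeasure_eq_measure)
      then show "AE t in \<nu>. (\<lambda>l. H (T l t f)) \<longlonglongrightarrow> H (\<Phi> t f)"
      proof eventually_elim
        case (elim t)
        then obtain n where "t \<in> good n" by blast
        then show ?case using isCont_tendsto_compose[OF Hi \<Phi>_good(2)[OF _ f]] by blast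
      qed
    qed (use H(2) in auto)
  qed
qed

lemma charfun_limit:
  assumes f: "f \<in> test_R"
  shows "(\<lambda>j. \<integral>g. exp (\<i> * complex_of_real (X (r j) f g)) \<partial>N (r j)) \<longlonglongrightarrow> charfun_R \<mu> f"
proof -
  have fL: "f \<in> L2 lborel" by (rule bounded_compact_supportD(3)[OF test_R_bounded_compact_support[OF f]])
  have Xm: "X k f \<in> borel_measurable (N k)" for k using int[OF fL] by auto
  have \<Phi>m: "(\<lambda>t. \<Phi> t f) \<in> borel_measurable \<nu>" by (rule measurable_compose[OF \<Phi>_measurable eval_measurable[OF f]])
  note [measurable] = eval_measurable[OF f]
  have "charfun_R \<mu> f = (\<integral>t. exp (\<i> * complex_of_real (\<Phi> t f)) \<partial>\<nu>)"
    unfolding charfun_R_def \<mu>_def by (rule integral_distr[OF \<Phi>_measurable]) measurable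
  also have "\<dots> = complex_of_real (\<integral>t. cos (\<Phi> t f) \<partial>\<nu>) + \<i> * complex_of_real (\<integral>t. sin (\<Phi> t f) \<partial>\<nu>)"
    by (rule \<nu>.integral_exp_i[OF \<Phi>m])
  finally have e: "charfun_R \<mu> f = complex_of_real (\<integral>t. cos (\<Phi> t f) \<partial>\<nu>) + \<i> * complex_of_real (\<integral>t. sin (\<Phi> t f) \<partial>\<nu>)" .
  show ?thesis
    unfolding e prob_space.integral_exp_i[OF prob Xm]
    by (intro tendsto_add tendsto_mult tendsto_const tendsto_of_real Lipschitz_limit f sin_cos_Lipschitz
        abs_cos_le_one abs_sin_le_one)
qed

end

lemma (in random_fields) random_distribution_limit:
  "\<exists>r \<mu>. strict_mono r \<and> radon_prob distrib_R_topology \<mu> \<and>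
     (\<forall>f\<in>test_R. (\<lambda>j. \<integral>g. exp (\<i> * complex_of_real (X (r j) f g)) \<partial>N (r j)) \<longlonglongrightarrow> charfun_R \<mu> f)"
proof -
  obtain r \<nu> W \<Gamma> where r: "strict_mono r" and l: "limit_field N X K r \<nu> W \<Gamma>" by (rule limit_field_exists)
  interpret limit_field N X K r \<nu> W \<Gamma> by (rule l)
  show ?thesis using r radon_\<mu> charfun_limit by blast
qed

section \<open>Equicontinuity and convergence\<close>

text \<open>On functions supported in a fixed compact set the supremum controls the L2 norm, so
  derivatives of order 0 suffice.\<close>

lemma L2_norm_nbhd0_R:
  assumes "e > 0" shows "nbhd0_R {v \<in> test_R. L2_norm lborel v < e}"
proof (rule seminorm_nbhd0_R[OF _ L2_norm_nonneg _ assms])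
  have tL: "u \<in> L2 lborel" if "u \<in> test_R" for u :: "real^'n \<Rightarrow> real"
    by (rule bounded_compact_supportD(3)[OF test_R_bounded_compact_support[OF that]])
  fix u v :: "real^'n \<Rightarrow> real" and s t assume "u \<in> test_R" "v \<in> test_R"
  then have "u \<in> L2 lborel" "v \<in> L2 lborel" by (auto intro: tL)
  then show "L2_norm lborel (\<lambda>x. s * u x + t * v x) \<le> \<bar>s\<bar> * L2_norm lborel u + \<bar>t\<bar> * L2_norm lborel v"
    using L2_norm_triangle[OF L2_scale L2_scale, of u lborel v s t] by (simp add: L2_norm_scale)
next
  fix K :: "(real^'n) set" assume K: "compact K"
  have "L2_norm lborel f \<le> sqrt (measure lborel K) * B" if f: "f \<in> test_R" "supp f \<subseteq> K"
    and B: "\<forall>L x. set L \<subseteq> Basis \<and> length L \<le> 0 \<longrightarrow> \<bar>iter_deriv L f x\<bar> \<le> B" for f B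
  proof -
    have fB: "\<bar>f x\<bar> \<le> B" for x using B[rule_format, of "[]" x] by simp
    have "L2_norm lborel f \<le> B * sqrt (measure lborel K)"
      using K f(2) not_in_supp
      by (intro L2_bounded_support(3)[OF test_R_measurable[OF f(1)] _ _ fB]) (auto intro: lmeasurable_compact borel_compact)
    then show ?thesis by (simp add: mult.commute)
  qed
  then show "\<exists>N C. \<forall>f\<in>test_R. \<forall>B. supp f \<subseteq> K \<longrightarrow>
      (\<forall>L x. set L \<subseteq> Basis \<and> length L \<le> N \<longrightarrow> \<bar>iter_deriv L f x\<bar> \<le> B) \<longrightarrow> L2_norm lborel f \<le> C * B"
    by blast
qed

text \<open>The topology of test functions is finer than that of the L2 norm, so a Lipschitz bound
  in this norm, uniform in \<open>k\<close>, yields equicontinuity.\<close>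

lemma openin_L2_ball:
  assumes f: "f \<in> test_R"
  shows "openin test_R_topology {g \<in> test_R. L2_norm lborel (\<lambda>x. g x - f x) < e}"
  unfolding openin_test_R_topology
proof (intro conjI ballI)
  have tL: "u \<in> L2 lborel" if "u \<in> test_R" for u :: "real^'n \<Rightarrow> real"
    by (rule bounded_compact_supportD(3)[OF test_R_bounded_compact_support[OF that]])
  fix g assume "g \<in> {g \<in> test_R. L2_norm lborel (\<lambda>x. g x - f x) < e}"
  then have g: "g \<in> test_R" "L2_norm lborel (\<lambda>x. g x - f x) < e" by auto
  define d where "d = e - L2_norm lborel (\<lambda>x. g x - f x)"
  have d: "d > 0" using g by (simp add: d_def)
  have "(\<lambda>x. g x + v x) \<in> {g \<in> test_R. L2_norm lborel (\<lambda>x. g x - f x) < e}"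
    if "v \<in> {v \<in> test_R. L2_norm lborel v < d}" for v
  proof -
    have v: "v \<in> test_R" "L2_norm lborel v < d" using that by auto
    have "L2_norm lborel (\<lambda>x. (g x - f x) + v x) \<le> L2_norm lborel (\<lambda>x. g x - f x) + L2_norm lborel v"
      by (intro L2_norm_triangle L2_diff tL f g v)
    also have "\<dots> < e" using v(2) by (simp add: d_def)
    finally have "L2_norm lborel (\<lambda>x. (g x + v x) - f x) < e" by (simp add: algebra_simps)
    then show ?thesis using test_R_lincomb[OF g(1) v(1), of 1 1] by simp
  qed
  then show "\<exists>V. V \<subseteq> test_R \<and> nbhd0_R V \<and> (\<forall>v\<in>V. (\<lambda>x. g x + v x) \<in> {g \<in> test_R. L2_norm lborel (\<lambda>x. g x - f x) < e})"
    by (intro exI[of _ "{v \<in> test_R. L2_norm lborel v < d}"] conjI L2_norm_nbhd0_R d) auto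
qed auto

lemma (in random_fields) charfun_Lipschitz:
  assumes f: "f \<in> L2 lborel" and h: "h \<in> L2 lborel"
  shows "dist (\<integral>g. exp (\<i> * complex_of_real (X k f g)) \<partial>N k) (\<integral>g. exp (\<i> * complex_of_real (X k h g)) \<partial>N k)
    \<le> 2 * K * L2_norm lborel (\<lambda>x. f x - h x)"
proof -
  interpret prob_space "N k" by (rule prob)
  have m: "X k f \<in> borel_measurable (N k)" "X k h \<in> borel_measurable (N k)" using int f h by auto
  define c where "c = (\<integral>g. cos (X k f g) \<partial>N k) - (\<integral>g. cos (X k h g) \<partial>N k)"
  define s where "s = (\<integral>g. sin (X k f g) \<partial>N k) - (\<integral>g. sin (X k h g) \<partial>N k)"
  \<comment> \<open>Real and imaginary part contribute \<open>K\<close> each, hence the factor 2 in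
    the bound.\<close>
  have "\<bar>c\<bar> \<le> K * L2_norm lborel (\<lambda>x. f x - h x)" "\<bar>s\<bar> \<le> K * L2_norm lborel (\<lambda>x. f x - h x)"
    unfolding c_def s_def
    by (rule field_Lipschitz[OF f h sin_cos_Lipschitz(2) abs_cos_le_one] field_Lipschitz[OF f h sin_cos_Lipschitz(1) abs_sin_le_one])+
  moreover have "dist (\<integral>g. exp (\<i> * complex_of_real (X k f g)) \<partial>N k) (\<integral>g. exp (\<i> * complex_of_real (X k h g)) \<partial>N k)
      = norm (complex_of_real c + \<i> * complex_of_real s)"
    unfolding dist_norm integral_exp_i[OF m(1)] integral_exp_i[OF m(2)] c_def s_def by (simp add: algebra_simps)
  moreover have "norm (complex_of_real c + \<i> * complex_of_real s) \<le> \<bar>c\<bar> + \<bar>s\<bar>"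
    by (rule order_trans[OF norm_triangle_ineq]) (simp add: norm_mult)
  ultimately show ?thesis by linarith
qed

theorem proposition4p1:
  fixes m :: real
    and a :: "nat \<Rightarrow> 'n::finite amb \<Rightarrow> 'n amb \<Rightarrow> real"
    and M :: "nat \<Rightarrow> ('n amb \<Rightarrow> real) measure"
    and \<rho> :: "nat \<Rightarrow> ('n amb \<Rightarrow> real) \<Rightarrow> real"
  assumes "m > 0"
    and "isometry_invariant_mollifiers a"
    and "\<And>k. k \<ge> 1 \<Longrightarrow> gaussian_measure_S (C_tilde m a k) (M k)"
    and "\<And>k. k \<ge> 1 \<Longrightarrow> is_density (M k) (\<rho> k)"
    and "(INF k\<in>{1..}. eL1_norm (M k) (\<rho> k)) > 0"
    and "(SUP k\<in>{1..}. eL2_norm (M k) (\<rho> k)) < \<infinity>"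
  shows "equicontinuous_on (test_R_topology :: (real^'n \<Rightarrow> real) topology) {1..}
           (\<lambda>k f. charfun_S (normalized_density (M k) (\<rho> k)) (U_alpha (U_beta k f))) \<and>
         (\<exists>(r :: nat \<Rightarrow> nat) (\<mu> :: ((real^'n \<Rightarrow> real) \<Rightarrow> real) measure).
           strict_mono r \<and> (\<forall>j. r j \<ge> 1) \<and> radon_prob distrib_R_topology \<mu> \<and>
           (\<forall>f\<in>test_R.
             (\<lambda>j. charfun_S (normalized_density (M (r j)) (\<rho> (r j))) (U_alpha (U_beta (r j) f)))
               \<longlonglongrightarrow> charfun_R \<mu> f))"
proof -
  \<comment> \<open>The hypotheses start at k = 1, from where on the dilation is invertible; the
    index is shifted to fit the locale, which counts from 0.\<close>
  define N where "N k = normalized_density (M (Suc k)) (\<rho> (Suc k))" for k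
  define X where "X k f g = L2_inner sphere_measure g (to_sphere (Suc k) f)" for k and f :: "real^'n \<Rightarrow> real" and g
  obtain K where K: "K \<ge> 0" "\<And>k. k \<ge> 1 \<Longrightarrow> prob_space (normalized_density (M k) (\<rho> k))"
    "\<And>k f. k \<ge> 1 \<Longrightarrow> f \<in> L2 lborel \<Longrightarrow>
       integrable (normalized_density (M k) (\<rho> k)) (\<lambda>g. L2_inner sphere_measure g (to_sphere k f))"
    "\<And>k f. k \<ge> 1 \<Longrightarrow> f \<in> L2 lborel \<Longrightarrow>
       (\<integral>g. \<bar>L2_inner sphere_measure g (to_sphere k f)\<bar> \<partial>normalized_density (M k) (\<rho> k)) \<le> K * L2_norm lborel f"
    using interacting_field_bound[of m a M \<rho>] assms by blast
  have sp: "space (N k) = test_S" for k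
    using assms(3)[of "Suc k"] by (simp add: N_def normalized_density_def gaussian_measure_S_def radon_prob_def topspace_test_S_topology)
  interpret random_fields N X K
  proof (rule random_fields.intro)
    fix k :: nat and g :: "'n amb \<Rightarrow> real" and f h :: "real^'n \<Rightarrow> real" and s t
    assume g: "g \<in> space (N k)" and f: "f \<in> L2 lborel" and h: "h \<in> L2 lborel"
    show "X k (\<lambda>x. s * f x + t * h x) g = s * X k f g + t * X k h g"
      unfolding X_def U_lincomb
      by (intro L2_inner_lincomb_right U_L2(1) f h test_S_L2) (use g sp in auto)
  qed (use K in \<open>simp_all add: N_def X_def[abs_def]\<close>)
  have cf: "charfun_S (normalized_density (M (Suc k)) (\<rho> (Suc k))) (U_alpha (U_beta (Suc k) f))
      = (\<integral>g. exp (\<i> * complex_of_real (X k f g)) \<partial>N k)" for k f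
    by (simp add: charfun_S_def N_def X_def to_sphere_def)
  have "equicontinuous_on (test_R_topology :: (real^'n \<Rightarrow> real) topology) {1..}
      (\<lambda>k f. charfun_S (normalized_density (M k) (\<rho> k)) (U_alpha (U_beta k f)))"
    unfolding equicontinuous_on_def topspace_test_R_topology
  proof (intro ballI allI impI)
    fix f :: "real^'n \<Rightarrow> real" and e :: real assume f: "f \<in> test_R" and e: "e > 0"
    have tL: "u \<in> L2 lborel" if "u \<in> test_R" for u :: "real^'n \<Rightarrow> real"
      by (rule bounded_compact_supportD(3)[OF test_R_bounded_compact_support[OF that]])
    \<comment> \<open>The summand 1 keeps the denominator positive when \<open>K\<close> is 0 and
      makes \<open>2 * K * d < e\<close> strict.\<close>
    define d where "d = e / (2 * K + 1)"
    have d: "d > 0" "2 * K * d < e" using e K(1) by (simp_all add: d_def field_simps add_pos_nonneg)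
    let ?U = "{g \<in> test_R. L2_norm lborel (\<lambda>x. g x - f x) < d}"
    have "dist (charfun_S (normalized_density (M k) (\<rho> k)) (U_alpha (U_beta k g)))
        (charfun_S (normalized_density (M k) (\<rho> k)) (U_alpha (U_beta k f))) < e" if k: "k \<in> {1..}" and g: "g \<in> ?U" for k g
    proof -
      obtain k' where k': "k = Suc k'" using k by (cases k) auto
      have "2 * K * L2_norm lborel (\<lambda>x. g x - f x) \<le> 2 * K * d"
        using g K(1) by (intro mult_left_mono) auto
      then show ?thesis
        unfolding k' cf using charfun_Lipschitz[OF tL[of g] tL[OF f], of k'] g d(2) by auto
    qed
    moreover have "f \<in> ?U" using f d by (simp add: L2_norm_eq)
    ultimately show "\<exists>U. openin test_R_topology U \<and> f \<in> U \<and> (\<forall>k\<in>{1..}. \<forall>g\<in>U.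
        dist (charfun_S (normalized_density (M k) (\<rho> k)) (U_alpha (U_beta k g)))
          (charfun_S (normalized_density (M k) (\<rho> k)) (U_alpha (U_beta k f))) < e)"
      using openin_L2_ball[OF f, of d] by blast
  qed
  moreover obtain r \<mu> where r: "strict_mono r" "radon_prob distrib_R_topology \<mu>"
    and lim: "\<And>f. f \<in> test_R \<Longrightarrow> (\<lambda>j. \<integral>g. exp (\<i> * complex_of_real (X (r j) f g)) \<partial>N (r j)) \<longlonglongrightarrow> charfun_R \<mu> f"
    using random_distribution_limit by blast
  have "strict_mono (\<lambda>j. Suc (r j))" using r(1) by (simp add: strict_mono_def)
  then have "\<exists>(r :: nat \<Rightarrow> nat) (\<mu> :: ((real^'n \<Rightarrow> real) \<Rightarrow> real) measure).
      strict_mono r \<and> (\<forall>j. r j \<ge> 1) \<and> radon_prob distrib_R_topology \<mu> \<and>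
      (\<forall>f\<in>test_R. (\<lambda>j. charfun_S (normalized_density (M (r j)) (\<rho> (r j))) (U_alpha (U_beta (r j) f))) \<longlonglongrightarrow> charfun_R \<mu> f)"
    using r(2) lim by (intro exI[of _ "\<lambda>j. Suc (r j)"] exI[of _ \<mu>]) (simp add: cf)
  ultimately show ?thesis by blast
qed

end
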